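(* Let $K\ge1$ and let $M$ be a $C^1$ Finsler manifold in the sense of Neeb-Upmeier which is $K$-weak-uniform and modeled on a Banach space $X$ that admits property $( *^1)$ with a constant $C_0$ that does not depend on the (equivalent) norm considered on $X$. Let $N\subset M$ be a closed $C^1$ submanifold and let $f:N\to\mathbb{R}$ be a $C^1$-smooth function. If $f$ is Lipschitz as a function on $M$ (i.e., there is $L\ge0$ such that $|f(p)-f(q)|\le L\,d_M(p,q)$ for every $p,q\in N$), then there is a $C^1$-smooth and Lipschitz extension $g:M\to\mathbb{R}$ of $f$ such that $\operatorname{Lip}(g)\le S\operatorname{Lip}(f)$, where $S:=\frac12+2RK^2$ and $R:=\frac{29}{2}C_0\left(\frac94+66C_0\right)$.
   Context: Let $M$ be a paracompact $C^1$ Banach manifold modeled on a real Banach space $(X,\|\cdot\|)$, with tangent bundle $TM$, and let $\|\cdot\|_M:TM\to[0,\infty)$ be a continuous map; write $\|\cdot\|_x$ for its restriction to $T_xM$. Condition (P1): for every $x\in M$, $\|\cdot\|_x$ is a norm on $T_xM$ such that for every chart $\varphi:U\to X$ with $x\in U$, the norm $v\in X\mapsto\|d\varphi^{-1}(\varphi(x))(v)\|_x$ is equivalent to $\|\cdot\|$ on $X$. $(M,\|\cdot\|_M)$ is a $C^1$ Finsler manifold in the sense of Neeb-Upmeier which is $K$-weak-uniform if (P1) holds and for every $x_0\in M$ there is a chart $\varphi:U\to X$ with $x_0\in U$ such that for every $x\in U$ and $v\in X$, $$\tfrac1K\|d\varphi^{-1}(\varphi(x_0))(v)\|_{x_0}\le\|d\varphi^{-1}(\varphi(x))(v)\|_x\le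 K\|d\varphi^{-1}(\varphi(x_0))(v)\|_{x_0}.$$ The Finsler metric $d_M(p,q)$ is the infimum of the lengths $\int_a^b\|c'(t)\|_{c(t)}\,dt$ of piecewise $C^1$ paths $c:[a,b]\to M$ joining $p$ to $q$ (with value $+\infty$ if $p,q$ lie in different connected components). For $g:M\to\mathbb{R}$, $\operatorname{Lip}(g)$ is the least Lipschitz constant with respect to $d_M$; for $f:N\to\mathbb{R}$, $\operatorname{Lip}(f)=\sup\{|f(p)-f(q)|/d_M(p,q): p,q\in N,\ p\ne q\}$ (the metric is that of $M$; pairs at infinite distance impose no condition). A subset $N\subset M$ is a $C^1$ submanifold of $M$ if (for a closed subspace $Y$ of $X$) for every $p\in N$ there is a chart $(V_p,\varphi_p)$ of $M$ with $p\in V_p$ and $\varphi_p(V_p\cap N)=A\cap Y$, where $A$ is an open subset of $X$ with $\varphi_p(p)\in A\cap Y$. The subspace $Y$ is not required to be complemented in $X$. Property $( *^1)$: a Banach space $(X,\|\cdot\|)$ satisfies property $( *^1)$ with constant $C_0\ge1$ (depending only on $(X,\|\cdot\|)$) if for every Lipschitz function $f:X\to\mathbb{R}$ and every $\varepsilon>0$ there is a Lipschitz, $C^1$-smooth function $h:X\to\mathbb{R}$ with $|f(x)-h(x)|<\varepsilon$ for all $x\in X$ and $\operatorname{Lip}(h)\le C_0\operatorname{Lip}(f)$. "The constant $C_0$ does not depend on the norm" means that for every norm $|\cdot|$ on $X$ equivalent to $\|\cdot\|$, the space $(X,|\cdot|)$ satisfies property $( *^1)$ with the same constant $C_0$. 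*)

theory Defs
  imports "HOL-Analysis.Analysis"
begin

section \<open>Lipschitz functions and Lipschitz constants\<close>

text \<open>Distances take values in \<^typ>\<open>ennreal\<close>, since the Finsler metric is infinite between points of
  different connected components.\<close>

definition lipschitz_wrt :: "('a \<Rightarrow> 'a \<Rightarrow> ennreal) \<Rightarrow> 'a set \<Rightarrow> ('a \<Rightarrow> real) \<Rightarrow> bool" where
  "lipschitz_wrt d A f \<longleftrightarrow>
     (\<exists>L::real. 0 \<le> L \<and> (\<forall>p\<in>A. \<forall>q\<in>A. ennreal \<bar>f p - f q\<bar> \<le> ennreal L * d p q))"

text \<open>Since \<open>a / \<top> = 0\<close> for real \<open>a\<close>, pairs at infinite distance impose no condition; since the
  supremum is taken in \<^typ>\<open>ennreal\<close>, it is 0 if there are no two distinct points.\<close>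

definition lip_const :: "('a \<Rightarrow> 'a \<Rightarrow> ennreal) \<Rightarrow> 'a set \<Rightarrow> ('a \<Rightarrow> real) \<Rightarrow> ennreal" where
  "lip_const d A f = Sup {ennreal \<bar>f p - f q\<bar> / d p q | p q. p \<in> A \<and> q \<in> A \<and> p \<noteq> q}"

lemma lip_const_le_iff:
  assumes "L \<noteq> top"
  shows "lip_const d A f \<le> L \<longleftrightarrow>
    (\<forall>p\<in>A. \<forall>q\<in>A. d p q \<noteq> top \<longrightarrow> ennreal \<bar>f p - f q\<bar> \<le> L * d p q)"
proof -
  have iff: "a / e \<le> L \<longleftrightarrow> (e \<noteq> top \<longrightarrow> a \<le> L * e)" if "a \<noteq> top" for a e :: ennreal
  proof (cases "e = top")
    case True
    with that show ?thesis by simp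
  next
    case False
    show ?thesis
    proof (cases "e = 0")
      case True
      then show ?thesis using assms
        by (cases "a = 0") (auto simp: top_unique)
    next
      case nz: False
      have "a / e \<le> L \<longleftrightarrow> a \<le> L * e"
      proof
        assume "a / e \<le> L"
        then have "a / e * e \<le> L * e" by (rule mult_right_mono) simp
        moreover have "a / e * e = a"
          using nz False by (simp add: ennreal_divide_times ennreal_divide_self less_top)
        ultimately show "a \<le> L * e" by simp
      next
        assume "a \<le> L * e"
        then show "a / e \<le> L"
          using nz by (intro divide_le_posI_ennreal) (auto simp: mult.commute zero_less_iff_neq_zero)
      qed
      then show ?thesis using False by simp
    qed
  qed
  have "lip_const d A f \<le> L \<longleftrightarrow>
      (\<forall>p\<in>A. \<forall>q\<in>A. p \<noteq> q \<longrightarrow> ennreal \<bar>f p - f q\<bar> / d p q \<le> L)"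
    unfolding lip_const_def Sup_le_iff by blast
  also have "\<dots> \<longleftrightarrow> (\<forall>p\<in>A. \<forall>q\<in>A. p \<noteq> q \<longrightarrow> d p q \<noteq> top \<longrightarrow> ennreal \<bar>f p - f q\<bar> \<le> L * d p q)"
    by (simp only: iff[OF ennreal_neq_top])
  also have "\<dots> \<longleftrightarrow> (\<forall>p\<in>A. \<forall>q\<in>A. d p q \<noteq> top \<longrightarrow> ennreal \<bar>f p - f q\<bar> \<le> L * d p q)"
    by (metis abs_zero diff_self ennreal_0 zero_le)
  finally show ?thesis .
qed


section \<open>Norms and property \<open>(*\<^sup>1)\<close>\<close>

definition is_norm :: "('x::real_vector \<Rightarrow> real) \<Rightarrow> bool" where
  "is_norm \<nu> \<longleftrightarrow> (\<forall>v. 0 \<le> \<nu> v) \<and> (\<forall>v. \<nu> v = 0 \<longleftrightarrow> v = 0) \<and>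
     (\<forall>u v. \<nu> (u + v) \<le> \<nu> u + \<nu> v) \<and> (\<forall>a v. \<nu> (a *\<^sub>R v) = \<bar>a\<bar> * \<nu> v)"

definition equivalent_norm :: "('x::real_normed_vector \<Rightarrow> real) \<Rightarrow> bool" where
  "equivalent_norm \<nu> \<longleftrightarrow> is_norm \<nu> \<and>
     (\<exists>a>0. \<exists>b>0. \<forall>v. a * norm v \<le> \<nu> v \<and> \<nu> v \<le> b * norm v)"

definition norm_dist :: "('x::real_vector \<Rightarrow> real) \<Rightarrow> 'x \<Rightarrow> 'x \<Rightarrow> ennreal" where
  "norm_dist \<nu> x y = ennreal (\<nu> (x - y))"

text \<open>Frechet \<open>C\<^sup>1\<close>-smoothness on an open set, with the derivative continuous in operator norm.\<close>

definition C1_on :: "'x::real_normed_vector set \<Rightarrow> ('x \<Rightarrow> 'y::real_normed_vector) \<Rightarrow> bool" where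
  "C1_on S f \<longleftrightarrow> (\<exists>D :: 'x \<Rightarrow> 'x \<Rightarrow>\<^sub>L 'y. continuous_on S D \<and>
     (\<forall>x\<in>S. (f has_derivative blinfun_apply (D x)) (at x)))"

text \<open>Property \<open>(*\<^sup>1)\<close> of the normed space \<open>(X, \<nu>)\<close>, for an equivalent norm \<open>\<nu>\<close> on \<open>X\<close>;
  \<open>C\<^sup>1\<close>-smoothness is the same for all equivalent norms.\<close>

definition property_star1 :: "('x::real_normed_vector \<Rightarrow> real) \<Rightarrow> real \<Rightarrow> bool" where
  "property_star1 \<nu> C0 \<longleftrightarrow> 1 \<le> C0 \<and>
     (\<forall>f. lipschitz_wrt (norm_dist \<nu>) UNIV f \<longrightarrow>
       (\<forall>\<epsilon>>0. \<exists>h. lipschitz_wrt (norm_dist \<nu>) UNIV h \<and> C1_on UNIV h \<and>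
          (\<forall>x. \<bar>f x - h x\<bar> < \<epsilon>) \<and>
          lip_const (norm_dist \<nu>) UNIV h \<le> ennreal C0 * lip_const (norm_dist \<nu>) UNIV f))"


section \<open>Banach manifolds\<close>

definition paracompact_space :: "'a topology \<Rightarrow> bool" where
  "paracompact_space T \<longleftrightarrow>
     (\<forall>\<U>. (\<forall>U\<in>\<U>. openin T U) \<and> \<Union>\<U> = topspace T \<longrightarrow>
       (\<exists>\<V>. (\<forall>V\<in>\<V>. openin T V) \<and> \<Union>\<V> = topspace T \<and>
            (\<forall>V\<in>\<V>. \<exists>U\<in>\<U>. V \<subseteq> U) \<and> locally_finite_in T \<V>))"

text \<open>A chart is a pair \<open>(U, \<phi>)\<close>; only the values of \<open>\<phi>\<close> on \<open>U\<close> are relevant, and the inverse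
  of the chart is \<open>inv_into U \<phi>\<close>.\<close>

type_synonym ('m, 'x) chart = "'m set \<times> ('m \<Rightarrow> 'x)"

definition is_chart :: "('m::topological_space, 'x::real_normed_vector) chart \<Rightarrow> bool" where
  "is_chart = (\<lambda>(U, \<phi>). open U \<and> open (\<phi> ` U) \<and> homeomorphism U (\<phi> ` U) \<phi> (inv_into U \<phi>))"

definition C1_compatible ::
    "('m::topological_space, 'x::real_normed_vector) chart \<Rightarrow> ('m, 'x) chart \<Rightarrow> bool" where
  "C1_compatible = (\<lambda>(U, \<phi>) (V, \<psi>).
     C1_on (\<phi> ` (U \<inter> V)) (\<psi> \<circ> inv_into U \<phi>) \<and> C1_on (\<psi> ` (U \<inter> V)) (\<phi> \<circ> inv_into V \<psi>))"

text \<open>The \<open>C\<^sup>1\<close> structures on the space \<^typ>\<open>'m\<close>, given by their maximal atlases.\<close>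

definition C1_structure :: "('m::topological_space, 'x::banach) chart set \<Rightarrow> bool" where
  "C1_structure \<A> \<longleftrightarrow>
     (\<forall>c\<in>\<A>. is_chart c) \<and> \<Union>(fst ` \<A>) = UNIV \<and> (\<forall>c\<in>\<A>. \<forall>c'\<in>\<A>. C1_compatible c c') \<and>
     (\<forall>c. is_chart c \<and> (\<forall>c'\<in>\<A>. C1_compatible c c') \<longrightarrow> c \<in> \<A>)"

definition C1_function ::
    "('m::topological_space, 'x::banach) chart set \<Rightarrow> ('m \<Rightarrow> real) \<Rightarrow> bool" where
  "C1_function \<A> g \<longleftrightarrow> (\<forall>(U, \<phi>)\<in>\<A>. C1_on (\<phi> ` U) (g \<circ> inv_into U \<phi>))"


section \<open>The tangent bundle\<close>

text \<open>A tangent vector at \<open>x\<close> is given by its coordinates with respect to all charts around \<open>x\<close>,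
  which are related by the derivatives of the changes of charts (equivalently, it is an
  equivalence class of pairs of a chart around \<open>x\<close> and a vector of \<open>X\<close>). The coordinate
  for any other pair is 0, to make the representation unique. The vector space operations of
  a tangent space are the pointwise ones.\<close>

definition tangent_space ::
    "('m::topological_space, 'x::banach) chart set \<Rightarrow> 'm \<Rightarrow> (('m, 'x) chart \<Rightarrow> 'x) set" where
  "tangent_space \<A> x = {\<xi>.
     (\<forall>U \<phi>. \<not> ((U, \<phi>) \<in> \<A> \<and> x \<in> U) \<longrightarrow> \<xi> (U, \<phi>) = 0) \<and>
     (\<forall>U \<phi> V \<psi>. (U, \<phi>) \<in> \<A> \<and> (V, \<psi>) \<in> \<A> \<and> x \<in> U \<inter> V \<longrightarrow>
        \<xi> (V, \<psi>) = frechet_derivative (\<psi> \<circ> inv_into U \<phi>) (at (\<phi> x)) (\<xi> (U, \<phi>)))}"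

type_synonym ('m, 'x) tangent_vec = "'m \<times> (('m, 'x) chart \<Rightarrow> 'x)"

definition tangent_bundle ::
    "('m::topological_space, 'x::banach) chart set \<Rightarrow> ('m, 'x) tangent_vec set" where
  "tangent_bundle \<A> = {(x, \<xi>). \<xi> \<in> tangent_space \<A> x}"

text \<open>The topology whose basic open sets are the preimages of the open sets under the bundle charts
  \<open>(x, \<xi>) \<mapsto> (\<phi> x, \<xi> (U, \<phi>))\<close>, defined on the part of the tangent bundle over \<open>U\<close>.\<close>

definition tangent_bundle_topology ::
    "('m::topological_space, 'x::banach) chart set \<Rightarrow> ('m, 'x) tangent_vec topology" where
  "tangent_bundle_topology \<A> = topology_generated_by
     {{(x, \<xi>) \<in> tangent_bundle \<A>. x \<in> U \<and> (\<phi> x, \<xi> (U, \<phi>)) \<in> W} | U \<phi> W. (U, \<phi>) \<in> \<A> \<and> open W}"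

text \<open>The differential \<open>d\<phi>\<^sup>-\<^sup>1(y) : X \<rightarrow> T\<^sub>x M\<close> for \<open>y = \<phi> x\<close>, \<open>x \<in> U\<close>.\<close>

definition d_chart_inv ::
    "('m::topological_space, 'x::banach) chart set \<Rightarrow> ('m, 'x) chart \<Rightarrow> 'x \<Rightarrow> 'x \<Rightarrow>
     ('m, 'x) tangent_vec" where
  "d_chart_inv \<A> = (\<lambda>(U, \<phi>) y v. (inv_into U \<phi> y,
     \<lambda>(V, \<psi>). if (V, \<psi>) \<in> \<A> \<and> inv_into U \<phi> y \<in> V
              then frechet_derivative (\<psi> \<circ> inv_into U \<phi>) (at y) v else 0))"


section \<open>Finsler manifolds\<close>

definition is_tangent_norm ::
    "('m::topological_space, 'x::banach) chart set \<Rightarrow> 'm \<Rightarrow> ((('m, 'x) chart \<Rightarrow> 'x) \<Rightarrow> real) \<Rightarrow> bool" where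
  "is_tangent_norm \<A> x \<nu> \<longleftrightarrow>
     (\<forall>\<xi>\<in>tangent_space \<A> x. 0 \<le> \<nu> \<xi> \<and> (\<nu> \<xi> = 0 \<longleftrightarrow> \<xi> = (\<lambda>c. 0))) \<and>
     (\<forall>\<xi>\<in>tangent_space \<A> x. \<forall>\<eta>\<in>tangent_space \<A> x. \<nu> (\<lambda>c. \<xi> c + \<eta> c) \<le> \<nu> \<xi> + \<nu> \<eta>) \<and>
     (\<forall>\<xi>\<in>tangent_space \<A> x. \<forall>a. \<nu> (\<lambda>c. a *\<^sub>R \<xi> c) = \<bar>a\<bar> * \<nu> \<xi>)"

definition property_P1 ::
    "('m::topological_space, 'x::banach) chart set \<Rightarrow> (('m, 'x) tangent_vec \<Rightarrow> real) \<Rightarrow> bool" where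
  "property_P1 \<A> nrm \<longleftrightarrow>
     (\<forall>x. is_tangent_norm \<A> x (\<lambda>\<xi>. nrm (x, \<xi>)) \<and>
       (\<forall>(U, \<phi>)\<in>\<A>. x \<in> U \<longrightarrow> equivalent_norm (\<lambda>v. nrm (d_chart_inv \<A> (U, \<phi>) (\<phi> x) v))))"

text \<open>The function \<open>nrm\<close> is only relevant on the tangent bundle.\<close>

definition weak_uniform_finsler ::
    "real \<Rightarrow> ('m::topological_space, 'x::banach) chart set \<Rightarrow> (('m, 'x) tangent_vec \<Rightarrow> real) \<Rightarrow> bool" where
  "weak_uniform_finsler K \<A> nrm \<longleftrightarrow>
     continuous_map (tangent_bundle_topology \<A>) euclideanreal nrm \<and>
     property_P1 \<A> nrm \<and>
     (\<forall>x0. \<exists>(U, \<phi>)\<in>\<A>. x0 \<in> U \<and> (\<forall>x\<in>U. \<forall>v.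
        1 / K * nrm (d_chart_inv \<A> (U, \<phi>) (\<phi> x0) v) \<le> nrm (d_chart_inv \<A> (U, \<phi>) (\<phi> x) v) \<and>
        nrm (d_chart_inv \<A> (U, \<phi>) (\<phi> x) v) \<le> K * nrm (d_chart_inv \<A> (U, \<phi>) (\<phi> x0) v)))"


section \<open>The Finsler metric\<close>

text \<open>On each piece the curve is \<open>C\<^sup>1\<close> up to the endpoints (one-sided derivatives). The library's
  piecewise \<open>C\<^sup>1\<close> functions are unsuitable: their derivatives may be unbounded, and even
  not integrable, near the break points.\<close>

definition C1_curve ::
    "('m::topological_space, 'x::banach) chart set \<Rightarrow> real \<Rightarrow> real \<Rightarrow> (real \<Rightarrow> 'm) \<Rightarrow> bool" where
  "C1_curve \<A> a b c \<longleftrightarrow> continuous_on {a..b} c \<and>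
     (\<forall>(U, \<phi>)\<in>\<A>. \<exists>D. continuous_on {t\<in>{a..b}. c t \<in> U} D \<and>
        (\<forall>t\<in>{a..b}. c t \<in> U \<longrightarrow> ((\<phi> \<circ> c) has_vector_derivative D t) (at t within {a..b})))"

definition piecewise_C1_curve ::
    "('m::topological_space, 'x::banach) chart set \<Rightarrow> real \<Rightarrow> real \<Rightarrow> (real \<Rightarrow> 'm) \<Rightarrow> bool" where
  "piecewise_C1_curve \<A> a b c \<longleftrightarrow> a < b \<and>
     (\<exists>(n::nat) s. s 0 = a \<and> s n = b \<and>
        (\<forall>i<n. s i < s (Suc i) \<and> C1_curve \<A> (s i) (s (Suc i)) c))"

text \<open>At the finitely many break points the velocity is unspecified, which does not affect the
  length.\<close>

definition velocity ::
    "('m::topological_space, 'x::banach) chart set \<Rightarrow> real \<Rightarrow> real \<Rightarrow> (real \<Rightarrow> 'm) \<Rightarrow> real \<Rightarrow>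
     ('m, 'x) tangent_vec" where
  "velocity \<A> a b c t = (c t,
     \<lambda>(V, \<psi>). if (V, \<psi>) \<in> \<A> \<and> c t \<in> V
              then vector_derivative (\<psi> \<circ> c) (at t within {a..b}) else 0)"

definition curve_length ::
    "('m::topological_space, 'x::banach) chart set \<Rightarrow> (('m, 'x) tangent_vec \<Rightarrow> real) \<Rightarrow>
     real \<Rightarrow> real \<Rightarrow> (real \<Rightarrow> 'm) \<Rightarrow> real" where
  "curve_length \<A> nrm a b c = integral {a..b} (\<lambda>t. nrm (velocity \<A> a b c t))"

definition finsler_dist ::
    "('m::topological_space, 'x::banach) chart set \<Rightarrow> (('m, 'x) tangent_vec \<Rightarrow> real) \<Rightarrow>
     'm \<Rightarrow> 'm \<Rightarrow> ennreal" where
  "finsler_dist \<A> nrm p q =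
     Inf {ennreal (curve_length \<A> nrm a b c) | a b c. piecewise_C1_curve \<A> a b c \<and> c a = p \<and> c b = q}"


section \<open>Submanifolds\<close>

definition C1_submanifold ::
    "('m::topological_space, 'x::banach) chart set \<Rightarrow> 'x set \<Rightarrow> 'm set \<Rightarrow> bool" where
  "C1_submanifold \<A> Y N \<longleftrightarrow> subspace Y \<and> closed Y \<and>
     (\<forall>p\<in>N. \<exists>V \<phi> A. (V, \<phi>) \<in> \<A> \<and> p \<in> V \<and> open A \<and> \<phi> p \<in> A \<inter> Y \<and> \<phi> ` (V \<inter> N) = A \<inter> Y)"

text \<open>Frechet \<open>C\<^sup>1\<close>-smoothness of a real function on an open subset \<open>S\<close> of the normed space \<open>Y\<close>,
  which is a subspace of the ambient type. The derivatives \<open>D y\<close> are bounded linear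
  functionals on \<open>Y\<close> only; their values outside \<open>Y\<close> are irrelevant.\<close>

definition C1_on_subspace ::
    "'x::real_normed_vector set \<Rightarrow> 'x set \<Rightarrow> ('x \<Rightarrow> real) \<Rightarrow> bool" where
  "C1_on_subspace Y S f \<longleftrightarrow> (\<exists>D :: 'x \<Rightarrow> 'x \<Rightarrow> real. \<forall>y\<in>S.
     (\<forall>u\<in>Y. \<forall>v\<in>Y. D y (u + v) = D y u + D y v) \<and>
     (\<forall>a. \<forall>v\<in>Y. D y (a *\<^sub>R v) = a * D y v) \<and>
     (\<exists>B. \<forall>v\<in>Y. \<bar>D y v\<bar> \<le> B * norm v) \<and>
     ((\<lambda>z. (f z - f y - D y (z - y)) / norm (z - y)) \<longlongrightarrow> 0) (at y within S) \<and>
     (\<forall>e>0. \<exists>d>0. \<forall>z\<in>S. dist z y < d \<longrightarrow> (\<forall>v\<in>Y. \<bar>D z v - D y v\<bar> \<le> e * norm v)))"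

lemma C1_on_subspace_UNIV:
  fixes S :: "'x::real_normed_vector set" and f :: "'x \<Rightarrow> real"
  assumes "open S"
  shows "C1_on_subspace UNIV S f \<longleftrightarrow> C1_on S f"
proof -
  have eq: "(1 / r) *\<^sub>R (a - (b + c)) = (a - b - c) / r" for a b c r :: real
    by (simp add: diff_diff_eq)
  show ?thesis
  proof
    assume "C1_on_subspace UNIV S f"
    then obtain D where "\<forall>y\<in>S.
        (\<forall>u\<in>UNIV. \<forall>v\<in>UNIV. D y (u + v) = D y u + D y v) \<and>
        (\<forall>a. \<forall>v\<in>UNIV. D y (a *\<^sub>R v) = a * D y v) \<and>
        (\<exists>B. \<forall>v\<in>UNIV. \<bar>D y v\<bar> \<le> B * norm v) \<and>
        ((\<lambda>z. (f z - f y - D y (z - y)) / norm (z - y)) \<longlongrightarrow> 0) (at y within S) \<and>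
        (\<forall>e>0. \<exists>d>0. \<forall>z\<in>S. dist z y < d \<longrightarrow> (\<forall>v\<in>UNIV. \<bar>D z v - D y v\<bar> \<le> e * norm v))"
      unfolding C1_on_subspace_def by (elim exE)
    then have D: "\<And>y u v. y \<in> S \<Longrightarrow> D y (u + v) = D y u + D y v"
        "\<And>y a v. y \<in> S \<Longrightarrow> D y (a *\<^sub>R v) = a * D y v"
        "\<And>y. y \<in> S \<Longrightarrow> \<exists>B. \<forall>v. \<bar>D y v\<bar> \<le> B * norm v"
        "\<And>y. y \<in> S \<Longrightarrow> ((\<lambda>z. (f z - f y - D y (z - y)) / norm (z - y)) \<longlongrightarrow> 0) (at y within S)"
        "\<And>y e. y \<in> S \<Longrightarrow> 0 < e \<Longrightarrow>
          \<exists>d>0. \<forall>z\<in>S. dist z y < d \<longrightarrow> (\<forall>v. \<bar>D z v - D y v\<bar> \<le> e * norm v)"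
      by simp_all
    have lin: "bounded_linear (D y)" if y: "y \<in> S" for y
    proof -
      obtain B where "\<forall>v. \<bar>D y v\<bar> \<le> B * norm v" using D(3)[OF y] by blast
      then show ?thesis
        by (intro bounded_linear_intro[where K = B]) (auto simp: D(1,2)[OF y] mult.commute)
    qed
    have app: "blinfun_apply (Blinfun (D y)) = D y" if "y \<in> S" for y
      by (rule bounded_linear_Blinfun_apply[OF lin[OF that]])
    have "(f has_derivative D y) (at y)" if y: "y \<in> S" for y
    proof -
      have "(f has_derivative D y) (at y within S)"
        unfolding has_derivative_within
        using lin[OF y] D(4)[OF y] by (simp only: eq simp_thms)
      then show ?thesis using at_within_open[OF y assms] by simp
    qed
    moreover have "continuous_on S (\<lambda>y. Blinfun (D y))"
      unfolding continuous_on_iff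
    proof (intro ballI allI impI)
      fix y and e :: real assume y: "y \<in> S" and e: "0 < e"
      from D(5)[OF y half_gt_zero[OF e]] obtain d where d: "d > 0"
        "\<And>z v. z \<in> S \<Longrightarrow> dist z y < d \<Longrightarrow> \<bar>D z v - D y v\<bar> \<le> e / 2 * norm v" by blast
      have "dist (Blinfun (D z)) (Blinfun (D y)) < e" if "z \<in> S" "dist z y < d" for z
      proof -
        have "norm (Blinfun (D z) - Blinfun (D y)) \<le> e / 2"
          using d(2)[OF that] e that y by (intro norm_blinfun_bound) (auto simp: app blinfun.diff_left)
        then show ?thesis using e by (simp add: dist_norm)
      qed
      then show "\<exists>d>0. \<forall>z\<in>S. dist z y < d \<longrightarrow> dist (Blinfun (D z)) (Blinfun (D y)) < e"
        using d(1) by blast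
    qed
    ultimately show "C1_on S f"
      unfolding C1_on_def by (intro exI[of _ "\<lambda>y. Blinfun (D y)"]) (simp add: app)
  next
    assume "C1_on S f"
    then obtain D :: "'x \<Rightarrow> 'x \<Rightarrow>\<^sub>L real" where cont: "continuous_on S D"
      and D: "\<And>x. x \<in> S \<Longrightarrow> (f has_derivative blinfun_apply (D x)) (at x)"
      unfolding C1_on_def by blast
    show "C1_on_subspace UNIV S f"
      unfolding C1_on_subspace_def
    proof (intro exI[of _ "\<lambda>y. blinfun_apply (D y)"] ballI conjI allI impI)
      fix y assume y: "y \<in> S"
      show "\<exists>B. \<forall>v\<in>UNIV. \<bar>D y v\<bar> \<le> B * norm v"
        using norm_blinfun[of "D y"] by (intro exI[of _ "norm (D y)"]) simp
      have "(f has_derivative blinfun_apply (D y)) (at y within S)"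
        using D[OF y] by (rule has_derivative_at_withinI)
      then show "((\<lambda>z. (f z - f y - D y (z - y)) / norm (z - y)) \<longlongrightarrow> 0) (at y within S)"
        unfolding has_derivative_within by (simp only: eq simp_thms)
      fix e :: real assume "0 < e"
      with cont y obtain d where d: "d > 0" "\<And>z. z \<in> S \<Longrightarrow> dist z y < d \<Longrightarrow> dist (D z) (D y) < e"
        unfolding continuous_on_iff by metis
      have "\<bar>D z v - D y v\<bar> \<le> e * norm v" if "z \<in> S" "dist z y < d" for z v
      proof -
        have "\<bar>D z v - D y v\<bar> \<le> norm (D z - D y) * norm v"
          using norm_blinfun[of "D z - D y" v] by (simp add: blinfun.diff_left)
        also have "\<dots> \<le> e * norm v"
          using d(2)[OF that] by (intro mult_right_mono) (auto simp: dist_norm)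
        finally show ?thesis .
      qed
      then show "\<exists>d>0. \<forall>z\<in>S. dist z y < d \<longrightarrow> (\<forall>v\<in>UNIV. \<bar>D z v - D y v\<bar> \<le> e * norm v)"
        using d(1) by blast
    qed (simp_all add: blinfun.add_right blinfun.scaleR_right)
  qed
qed

text \<open>\<open>C\<^sup>1\<close>-smoothness on \<open>N\<close> as a manifold modelled on \<open>Y\<close>, whose charts are the restrictions
  to \<open>N\<close> of the charts of \<open>M\<close> adapted to \<open>N\<close>.\<close>

definition C1_function_on_submanifold ::
    "('m::topological_space, 'x::banach) chart set \<Rightarrow> 'x set \<Rightarrow> 'm set \<Rightarrow> ('m \<Rightarrow> real) \<Rightarrow> bool" where
  "C1_function_on_submanifold \<A> Y N f \<longleftrightarrow>
     (\<forall>V \<phi> A. (V, \<phi>) \<in> \<A> \<and> open A \<and> \<phi> ` (V \<inter> N) = A \<inter> Y \<longrightarrow>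
        C1_on_subspace Y (A \<inter> Y) (f \<circ> inv_into V \<phi>))"

end

theory Submission
  imports Defs
begin

text \<open>
  Lipschitz bounds are tested along \<open>C\<^sup>1\<close> curves, which turns them into a local property. Around each point a
  chart compares the length of curves with one equivalent norm on \<open>X\<close>, up to the factor \<open>2 K\<close>, so
  property \<open>(*\<^sup>1)\<close> for this norm provides local smooth approximations of any Lipschitz function \<open>F\<close>. Near
  points of \<open>N\<close> they can be chosen such that their difference to \<open>F\<close> on \<open>N\<close> extends to a function with small
  Lipschitz constant: the derivative of \<open>F\<close> along \<open>Y\<close> is extended to \<open>X\<close> by Hahn-Banach, although \<open>Y\<close> need
  not be complemented. A \<open>C\<^sup>1\<close> partition of unity glues the local approximations. Each step thus
  replaces the extension problem for \<open>F\<close> by the one for a remainder with half the Lipschitz constant, and the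
  sum of the approximations obtained by iterating is the desired extension.
\<close>

section \<open>\<open>C\<^sup>1\<close> maps between normed spaces\<close>

text \<open>With a projection onto \<open>Y\<close>, \<open>f\<close> could be extended smoothly
  near each point of \<open>N\<close>. Without one, the local smooth functions match
  \<open>F\<close> on \<open>N\<close> only up to a remainder, and this forces the iteration. The
  extended remainder need not be smooth off \<open>N\<close>, so the property carried along is
  strict differentiability along \<open>Y\<close> at the points of \<open>N\<close>: it depends only
  on values on \<open>N\<close>, survives subtraction of C1 functions, and says that near such a
  point the function minus its derivative has arbitrarily small Lipschitz constant on
  \<open>Y\<close>. Approximant and remainder are glued with the same weights, so their sum is still
  exactly \<open>F\<close> on \<open>N\<close>. Constants: passing from curves to a chart norm and
  back costs \<open>2 * K\<close> each way. The approximation in the chart costs at most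
  \<open>7 * C0\<close>, which gives \<open>28 * C0 * K\<^sup>2\<close>; gluing raises 28 to at most
  29, and the geometric series doubles this. The result \<open>58 * C0 * K\<^sup>2\<close> is below
  \<open>S\<close>.\<close>

lemma C1_on_subset: "C1_on S f \<Longrightarrow> T \<subseteq> S \<Longrightarrow> C1_on T f"
  unfolding C1_on_def by (meson continuous_on_subset subsetD)

lemma C1_on_cong:
  assumes "C1_on S f" "open S" "\<And>x. x \<in> S \<Longrightarrow> f x = g x"
  shows "C1_on S g"
proof -
  obtain D where D: "continuous_on S D" "\<And>x. x \<in> S \<Longrightarrow> (f has_derivative blinfun_apply (D x)) (at x)"
    using assms(1) unfolding C1_on_def by blast
  have "(g has_derivative blinfun_apply (D x)) (at x)" if "x \<in> S" for x
    using has_derivative_transform_within_open[OF D(2)[OF that] assms(2) that] assms(3) by blast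
  with D(1) show ?thesis unfolding C1_on_def by blast
qed

text \<open>Derivatives at a point are unique, so the derivative fields on the various
  \<open>T\<close> all agree with the one given by \<open>frechet_derivative\<close>, which serves
  as the global witness.\<close>

lemma C1_on_local:
  assumes "\<And>x. x \<in> S \<Longrightarrow> \<exists>T. open T \<and> x \<in> T \<and> C1_on T f"
  shows "C1_on S f"
proof -
  define D where "D x = Blinfun (frechet_derivative f (at x))" for x
  have D: "isCont D x \<and> (f has_derivative blinfun_apply (D x)) (at x)" if x: "x \<in> S" for x
  proof -
    obtain T where T: "open T" "x \<in> T" "C1_on T f" using assms[OF x] by blast
    obtain E where E: "continuous_on T E" "\<And>y. y \<in> T \<Longrightarrow> (f has_derivative blinfun_apply (E y)) (at y)"
      using T(3) unfolding C1_on_def by blast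
    have DE: "D y = E y" if "y \<in> T" for y
      unfolding D_def using frechet_derivative_at[OF E(2)[OF that]]
      by (metis blinfun_apply_inverse)
    have "continuous_on T D" using E(1) DE by (metis continuous_on_cong)
    then have "isCont D x" using T continuous_on_eq_continuous_at by blast
    then show ?thesis using E(2)[OF T(2)] DE[OF T(2)] by simp
  qed
  then have "continuous_on S D" by (meson continuous_at_imp_continuous_on)
  with D show ?thesis unfolding C1_on_def by blast
qed

lemma C1_on_imp_continuous_on: "C1_on S f \<Longrightarrow> continuous_on S f"
  unfolding C1_on_def by (meson continuous_at_imp_continuous_on has_derivative_continuous)

lemma C1_on_compose:
  assumes "C1_on S f" "C1_on T g" "f ` S \<subseteq> T"
  shows "C1_on S (g \<circ> f)"
proof -
  obtain D where D: "continuous_on S D" "\<And>x. x \<in> S \<Longrightarrow> (f has_derivative blinfun_apply (D x)) (at x)"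
    using assms(1) unfolding C1_on_def by blast
  obtain E where E: "continuous_on T E" "\<And>x. x \<in> T \<Longrightarrow> (g has_derivative blinfun_apply (E x)) (at x)"
    using assms(2) unfolding C1_on_def by blast
  have "continuous_on S (\<lambda>x. E (f x) o\<^sub>L D x)"
    using continuous_on_compose2[OF E(1) C1_on_imp_continuous_on[OF assms(1)] assms(3)] D(1)
    by (intro continuous_intros)
  moreover have "((g \<circ> f) has_derivative blinfun_apply (E (f x) o\<^sub>L D x)) (at x)" if "x \<in> S" for x
  proof -
    have "((g \<circ> f) has_derivative (blinfun_apply (E (f x)) \<circ> blinfun_apply (D x))) (at x)"
      using that assms(3) by (intro diff_chain_at D E) auto
    then show ?thesis by (simp only: blinfun_compose.rep_eq)
  qed
  ultimately show ?thesis unfolding C1_on_def by blast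
qed

lemma C1_on_const: "C1_on S (\<lambda>x. c)"
  unfolding C1_on_def by (intro exI[of _ "\<lambda>x. 0"]) (auto simp: zero_blinfun.rep_eq)

lemma C1_on_bounded_linear: "bounded_linear T \<Longrightarrow> C1_on S T"
  unfolding C1_on_def
  by (intro exI[of _ "\<lambda>x. Blinfun T"]) (auto simp: bounded_linear_Blinfun_apply bounded_linear_imp_has_derivative)

lemma C1_on_add:
  assumes "C1_on S f" "C1_on S g"
  shows "C1_on S (\<lambda>x. f x + g x)"
proof -
  obtain D where D: "continuous_on S D" "\<And>x. x \<in> S \<Longrightarrow> (f has_derivative blinfun_apply (D x)) (at x)"
    using assms(1) unfolding C1_on_def by blast
  obtain E where E: "continuous_on S E" "\<And>x. x \<in> S \<Longrightarrow> (g has_derivative blinfun_apply (E x)) (at x)"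
    using assms(2) unfolding C1_on_def by blast
  have "continuous_on S (\<lambda>x. D x + E x)" using D E by (intro continuous_intros)
  moreover have "((\<lambda>x. f x + g x) has_derivative blinfun_apply (D x + E x)) (at x)" if "x \<in> S" for x
    using has_derivative_add[OF D(2) E(2)] that by (simp add: plus_blinfun.rep_eq)
  ultimately show ?thesis unfolding C1_on_def by blast
qed

lemma C1_on_mult:
  fixes f g :: "'x::real_normed_vector \<Rightarrow> real"
  assumes "C1_on S f" "C1_on S g"
  shows "C1_on S (\<lambda>x. f x * g x)"
proof -
  obtain D where D: "continuous_on S D" "\<And>x. x \<in> S \<Longrightarrow> (f has_derivative blinfun_apply (D x)) (at x)"
    using assms(1) unfolding C1_on_def by blast
  obtain E where E: "continuous_on S E" "\<And>x. x \<in> S \<Longrightarrow> (g has_derivative blinfun_apply (E x)) (at x)"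
    using assms(2) unfolding C1_on_def by blast
  have "continuous_on S (\<lambda>x. f x *\<^sub>R E x + g x *\<^sub>R D x)"
    using D E C1_on_imp_continuous_on assms by (intro continuous_intros)
  moreover have "((\<lambda>x. f x * g x) has_derivative blinfun_apply (f x *\<^sub>R E x + g x *\<^sub>R D x)) (at x)"
    if "x \<in> S" for x
    using has_derivative_mult[OF D(2)[OF that] E(2)[OF that]]
    by (simp add: plus_blinfun.rep_eq scaleR_blinfun.rep_eq mult.commute)
  ultimately show ?thesis unfolding C1_on_def by blast
qed

lemma C1_on_diff:
  fixes f g :: "'x::real_normed_vector \<Rightarrow> real"
  assumes "C1_on S f" "C1_on S g"
  shows "C1_on S (\<lambda>x. f x - g x)"
  using C1_on_add[OF assms(1) C1_on_mult[OF C1_on_const[of S "-1"] assms(2)]] by simp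

lemma C1_on_real:
  fixes \<tau> :: "real \<Rightarrow> real"
  assumes "\<And>s. (\<tau> has_real_derivative \<tau>' s) (at s)" "continuous_on UNIV \<tau>'"
  shows "C1_on UNIV \<tau>"
  unfolding C1_on_def
proof (intro exI[of _ "\<lambda>s. blinfun_scaleR_right (\<tau>' s)"] conjI ballI)
  show "continuous_on UNIV (\<lambda>s. blinfun_scaleR_right (\<tau>' s) :: real \<Rightarrow>\<^sub>L real)"
    using assms(2) by (intro bounded_linear.continuous_on[OF bounded_linear_blinfun_scaleR_right])
  show "(\<tau> has_derivative blinfun_apply (blinfun_scaleR_right (\<tau>' s))) (at s)" for s
    using assms(1)[of s] by (simp add: has_field_derivative_def real_scaleR_def[abs_def])
qed

text \<open>Both cutoff functions below are linear combinations of translates of \<open>max 0 s ^ 2\<close>,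
  which is \<open>C\<^sup>1\<close>.\<close>

lemma has_real_derivative_max_power2:
  "((\<lambda>s::real. (max 0 s)\<^sup>2) has_real_derivative 2 * max 0 s) (at s)"
proof (cases "s = 0")
  case True
  have "((\<lambda>x::real. (max 0 x)\<^sup>2 / x) \<longlongrightarrow> 0) (at 0)"
  proof (rule Lim_null_comparison)
    show "\<forall>\<^sub>F x in at 0. norm ((max 0 x)\<^sup>2 / x) \<le> \<bar>x\<bar>" for x::real
      by (rule always_eventually) (auto simp: max_def power2_eq_square)
    show "((\<lambda>x::real. \<bar>x\<bar>) \<longlongrightarrow> 0) (at 0)" by (rule tendsto_rabs_zero) (rule tendsto_ident_at)
  qed
  then show ?thesis unfolding DERIV_def using True by simp
next
  case False
  show ?thesis
  proof (cases "s > 0")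
    case True
    have "((\<lambda>s::real. s\<^sup>2) has_real_derivative 2 * s) (at s)" by (auto intro!: derivative_eq_intros)
    from has_field_derivative_transform_within_open[OF this, of "{0<..}" "\<lambda>s. (max 0 s)\<^sup>2"]
    show ?thesis using True by simp
  next
    case False
    have "((\<lambda>s::real. 0) has_real_derivative 0) (at s)" by (rule DERIV_const)
    from has_field_derivative_transform_within_open[OF this, of "{..<0}" "\<lambda>s. (max 0 s)\<^sup>2"]
    show ?thesis using False \<open>s \<noteq> 0\<close> by simp
  qed
qed

lemma has_real_derivative_max_power2':
  "((\<lambda>s. (max 0 (e * s + a))\<^sup>2) has_real_derivative 2 * e * max 0 (e * s + a)) (at s)"
proof -
  have "((\<lambda>s. e * s + a) has_real_derivative e) (at s)" by (auto intro!: derivative_eq_intros)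
  from DERIV_chain2[OF has_real_derivative_max_power2 this] show ?thesis by (simp add: algebra_simps)
qed

lemma lipschitz_from_derivative:
  fixes \<tau> :: "real \<Rightarrow> real"
  assumes "\<And>s. (\<tau> has_real_derivative \<tau>' s) (at s)" "\<And>s. \<bar>\<tau>' s\<bar> \<le> B"
  shows "\<bar>\<tau> s - \<tau> t\<bar> \<le> B * \<bar>s - t\<bar>"
  using field_differentiable_bound[of UNIV \<tau> \<tau>' B s t] assms by (auto simp: has_field_derivative_at_within)

lemma smooth_step:
  "\<exists>\<beta>::real \<Rightarrow> real. C1_on UNIV \<beta> \<and> (\<forall>s t. \<bar>\<beta> s - \<beta> t\<bar> \<le> 2 * \<bar>s - t\<bar>) \<and>
     (\<forall>s. 0 \<le> \<beta> s \<and> \<beta> s \<le> 1) \<and> (\<forall>s\<le>1/2. \<beta> s = 0) \<and> (\<forall>s\<ge>3/2. \<beta> s = 1)"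
proof -
  define \<beta> where "\<beta> s = 2 * (max 0 (1 * s + -1/2))\<^sup>2 - 4 * (max 0 (1 * s + -1))\<^sup>2 + 2 * (max 0 (1 * s + -3/2))\<^sup>2" for s :: real
  \<comment> \<open>A tent over the interval from 1/2 to 3/2 with peak 2 at 1: its area is 1, so
    \<open>\<beta>\<close> climbs from exactly 0 to exactly 1.\<close>
  define \<beta>' where "\<beta>' s = 4 * max 0 (s - 1/2) - 8 * max 0 (s - 1) + 4 * max 0 (s - 3/2)" for s :: real
  have d: "(\<beta> has_real_derivative \<beta>' s) (at s)" for s
    unfolding \<beta>_def \<beta>'_def
    by (rule derivative_eq_intros has_real_derivative_max_power2' refl)+ simp
  have c: "continuous_on UNIV \<beta>'" unfolding \<beta>'_def by (intro continuous_intros)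
  have b: "\<bar>\<beta>' s\<bar> \<le> 2" "0 \<le> \<beta>' s" for s unfolding \<beta>'_def by (auto simp: max_def)
  have mono: "\<beta> s \<le> \<beta> t" if "s \<le> t" for s t
    by (rule DERIV_nonneg_imp_nondecreasing[OF that]) (use d b in blast)
  have z: "\<beta> s = 0" if "s \<le> 1/2" for s using that unfolding \<beta>_def by (simp add: max_def)
  have o: "\<beta> s = 1" if "s \<ge> 3/2" for s using that unfolding \<beta>_def
    by (simp add: max_def power2_eq_square algebra_simps)
  have "0 \<le> \<beta> s" for s using mono[of "min s (1/2)" s] z[of "min s (1/2)"] by simp
  moreover have "\<beta> s \<le> 1" for s using mono[of s "max s (3/2)"] o[of "max s (3/2)"] by simp
  ultimately show ?thesis using C1_on_real[OF d c] lipschitz_from_derivative[OF d b(1)] z o by blast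
qed

text \<open>Composition with \<open>\<tau>\<close> turns a function that is at most
  \<open>\<epsilon>\<close> on some set into one that vanishes there, without increasing Lipschitz
  constants. The derivative is even, 0 up to \<open>\<epsilon>\<close>, rises linearly to 1 at
  \<open>2 * \<epsilon>\<close> and stays 1.\<close>

lemma smooth_shrink:
  assumes "\<epsilon> > 0"
  shows "\<exists>\<tau>::real \<Rightarrow> real. C1_on UNIV \<tau> \<and> (\<forall>s t. \<bar>\<tau> s - \<tau> t\<bar> \<le> \<bar>s - t\<bar>) \<and>
     (\<forall>s. \<bar>\<tau> s - s\<bar> \<le> 3 * \<epsilon>) \<and> (\<forall>s. \<bar>s\<bar> \<le> \<epsilon> \<longrightarrow> \<tau> s = 0)"
proof -
  define \<tau> where "\<tau> s = (1 / (2*\<epsilon>)) * ((max 0 (1 * s + -\<epsilon>))\<^sup>2 - (max 0 (1 * s + -(2*\<epsilon>)))\<^sup>2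
      - (max 0 (-1 * s + -\<epsilon>))\<^sup>2 + (max 0 (-1 * s + -(2*\<epsilon>)))\<^sup>2)" for s :: real
  define \<tau>' where "\<tau>' s = (1 / \<epsilon>) * (max 0 (s - \<epsilon>) - max 0 (s - 2*\<epsilon>) + max 0 (-s-\<epsilon>) - max 0 (-s-2*\<epsilon>))" for s :: real
  have d: "(\<tau> has_real_derivative \<tau>' s) (at s)" for s
    unfolding \<tau>_def \<tau>'_def
    by (rule derivative_eq_intros has_real_derivative_max_power2' refl)+ (use assms in \<open>simp add: field_simps\<close>)
  have c: "continuous_on UNIV \<tau>'" unfolding \<tau>'_def by (intro continuous_intros)
  have b: "\<bar>\<tau>' s\<bar> \<le> 1" for s
  proof -
    have "\<bar>max 0 (s - \<epsilon>) - max 0 (s - 2*\<epsilon>) + max 0 (-s-\<epsilon>) - max 0 (-s-2*\<epsilon>)\<bar> \<le> \<epsilon>"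
      using assms by (simp add: max_def)
    then show ?thesis using assms unfolding \<tau>'_def by (simp add: abs_mult)
  qed
  have z: "\<tau> s = 0" if "\<bar>s\<bar> \<le> \<epsilon>" for s using that assms unfolding \<tau>_def by (simp add: max_def abs_le_iff)
  have s1: "\<tau> s = s - 3/2*\<epsilon>" if "s \<ge> 2*\<epsilon>" for s
    using that assms unfolding \<tau>_def by (simp add: max_def field_simps power2_eq_square)
  have s2: "\<tau> s = s + 3/2*\<epsilon>" if "s \<le> -2*\<epsilon>" for s
    using that assms unfolding \<tau>_def by (simp add: max_def field_simps power2_eq_square)
  have lip: "\<bar>\<tau> s - \<tau> t\<bar> \<le> \<bar>s - t\<bar>" for s t using lipschitz_from_derivative[OF d b, of s t] by simp
  \<comment> \<open>Between \<open>\<epsilon>\<close> and \<open>2 * \<epsilon>\<close> the value of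
    \<open>\<tau>\<close> is at most \<open>\<epsilon>\<close>, which gives the 3; from
    \<open>2 * \<epsilon>\<close> on, the shift is only \<open>3/2 * \<epsilon>\<close>.\<close>
  have "\<bar>\<tau> s - s\<bar> \<le> 3 * \<epsilon>" for s
  proof -
    consider "\<bar>s\<bar> \<le> \<epsilon>" | "\<epsilon> < s" "s < 2 * \<epsilon>" | "- 2 * \<epsilon> < s" "s < - \<epsilon>" | "2 * \<epsilon> \<le> s" | "s \<le> - 2 * \<epsilon>"
      by linarith
    moreover have "\<tau> \<epsilon> = 0" "\<tau> (- \<epsilon>) = 0" using z assms by auto
    ultimately show ?thesis
    proof cases
      case 2
      then show ?thesis using lip[of s \<epsilon>] \<open>\<tau> \<epsilon> = 0\<close> by linarith
    next
      case 3
      then show ?thesis using lip[of s "-\<epsilon>"] \<open>\<tau> (- \<epsilon>) = 0\<close> by linarith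
    qed (use z[of s] s1[of s] s2[of s] assms in simp_all)
  qed
  then show ?thesis using C1_on_real[OF d c] lip z by blast
qed

section \<open>Extension of linear functionals and of Lipschitz functions\<close>

text \<open>Functionals on subspaces are represented by their graphs.\<close>

lemma Hahn_Banach_graph:
  fixes p :: "'x::real_vector \<Rightarrow> real" and G0 :: "('x \<times> real) set"
  assumes add: "\<And>u v. p (u + v) \<le> p u + p v"
    and hom: "\<And>a v. 0 \<le> a \<Longrightarrow> p (a *\<^sub>R v) = a * p v"
    and G0: "subspace G0" "\<And>x r. (x, r) \<in> G0 \<Longrightarrow> r \<le> p x"
  shows "\<exists>T. linear T \<and> (\<forall>x r. (x, r) \<in> G0 \<longrightarrow> T x = r) \<and> (\<forall>x. T x \<le> p x)"
proof -
  define \<G> where "\<G> = {G. subspace G \<and> G0 \<subseteq> G \<and> (\<forall>(x, r)\<in>G. r \<le> p x)}"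
  have "\<exists>G\<in>\<G>. \<forall>H\<in>\<G>. G \<subseteq> H \<longrightarrow> H = G"
  proof (rule subset_Zorn_nonempty)
    show "\<G> \<noteq> {}" using G0 unfolding \<G>_def by blast
    fix \<C> assume ne: "\<C> \<noteq> {}" and ch: "subset.chain \<G> \<C>"
    have C: "subspace G" "G0 \<subseteq> G" "\<And>x r. (x, r) \<in> G \<Longrightarrow> r \<le> p x" if "G \<in> \<C>" for G
      using ch that unfolding subset.chain_def \<G>_def by auto
    have "subspace (\<Union>\<C>)"
    proof (rule subspaceI)
      show "0 \<in> \<Union>\<C>" using ne C(1) subspace_0 by blast
      show "x + y \<in> \<Union>\<C>" if xy: "x \<in> \<Union>\<C>" "y \<in> \<Union>\<C>" for x y
      proof -
        obtain G H where GH: "G \<in> \<C>" "H \<in> \<C>" "x \<in> G" "y \<in> H" using xy by blast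
        then have "G \<subseteq> H \<or> H \<subseteq> G" using ch unfolding subset.chain_def by blast
        then show ?thesis using GH C(1) subspace_add by (metis UnionI subsetD)
      qed
      show "c *\<^sub>R x \<in> \<Union>\<C>" if "x \<in> \<Union>\<C>" for c x using that C(1) subspace_scale by blast
    qed
    then show "\<Union>\<C> \<in> \<G>" unfolding \<G>_def using C ne by fast
  qed
  then obtain G where "G \<in> \<G>" and max: "\<And>H. H \<in> \<G> \<Longrightarrow> G \<subseteq> H \<Longrightarrow> H = G"
    by blast
  then have G: "subspace G" "G0 \<subseteq> G" "\<And>x r. (x, r) \<in> G \<Longrightarrow> r \<le> p x"
    unfolding \<G>_def by auto
  have p0: "p 0 = 0" using hom[of 0 0] by simp
  \<comment> \<open>Single-valuedness comes from domination: both \<open>r\<close> and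
    \<open>-r\<close> lie over 0, and \<open>p 0 = 0\<close>.\<close>
  have zero: "r = 0" if "(0, r) \<in> G" for r
    using G(3)[OF that] G(3)[of 0 "-r"] subspace_scale[OF G(1) that, of "-1"] p0 by simp
  have uniq: "r = s" if "(x, r) \<in> G" "(x, s) \<in> G" for x r s
    using zero[of "r - s"] subspace_diff[OF G(1) that] by simp
  have total: "\<exists>r. (x0, r) \<in> G" for x0
  proof (rule ccontr)
    assume x0: "\<nexists>r. (x0, r) \<in> G"
    \<comment> \<open>A value over \<open>x0\<close> must lie above every member of \<open>L\<close>
      and below every \<open>p (y + x0) - s\<close>. Subadditivity orders the two families, so
      \<open>Sup L\<close> qualifies.\<close>
    define L where "L = {r - p (x - x0) | x r. (x, r) \<in> G}"
    have LU: "r - p (x - x0) \<le> p (y + x0) - s" if "(x, r) \<in> G" "(y, s) \<in> G" for x r y s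
    proof -
      have "r + s \<le> p (x + y)" using subspace_add[OF G(1) that] G(3) by simp
      also have "\<dots> \<le> p (x - x0) + p (y + x0)" using add[of "x - x0" "y + x0"] by simp
      finally show ?thesis by simp
    qed
    have zG: "(0, 0) \<in> G" using subspace_0[OF G(1)] by (simp add: zero_prod_def)
    have "L \<noteq> {}" unfolding L_def using zG by blast
    have "bdd_above L" unfolding L_def bdd_above_def using LU[OF _ zG] by blast
    define a where "a = Sup L"
    have a1: "r - p (x - x0) \<le> a" if "(x, r) \<in> G" for x r
      unfolding a_def using \<open>bdd_above L\<close> that by (intro cSup_upper) (auto simp: L_def)
    have a2: "a \<le> p (y + x0) - s" if "(y, s) \<in> G" for y s
      unfolding a_def using \<open>L \<noteq> {}\<close> LU that by (intro cSup_least) (auto simp: L_def)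
    define H where "H = {(x + t *\<^sub>R x0, r + t * a) | x r t. (x, r) \<in> G}"
    have "subspace H"
    proof (rule subspaceI)
      show "0 \<in> H" unfolding H_def using zG by (force simp: zero_prod_def)
      show "u + v \<in> H" if uv: "u \<in> H" "v \<in> H" for u v
      proof -
        obtain x r t y s t' where *: "u = (x + t *\<^sub>R x0, r + t * a)" "(x, r) \<in> G"
            "v = (y + t' *\<^sub>R x0, s + t' * a)" "(y, s) \<in> G"
          using uv unfolding H_def by blast
        have "u + v = ((x + y) + (t + t') *\<^sub>R x0, (r + s) + (t + t') * a)" "(x + y, r + s) \<in> G"
          using * subspace_add[OF G(1) *(2) *(4)] by (auto simp: algebra_simps)
        then show ?thesis unfolding H_def by blast
      qed
      show "c *\<^sub>R u \<in> H" if u: "u \<in> H" for c u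
      proof -
        obtain x r t where *: "u = (x + t *\<^sub>R x0, r + t * a)" "(x, r) \<in> G"
          using u unfolding H_def by blast
        have "c *\<^sub>R u = (c *\<^sub>R x + (c * t) *\<^sub>R x0, c * r + (c * t) * a)" "(c *\<^sub>R x, c * r) \<in> G"
          using * subspace_scale[OF G(1) *(2), of c] by (auto simp: algebra_simps)
        then show ?thesis unfolding H_def by blast
      qed
    qed
    moreover have GH: "G \<subseteq> H"
    proof
      fix u assume "u \<in> G"
      moreover obtain x r where "u = (x, r)" by fastforce
      ultimately have "u = (x + 0 *\<^sub>R x0, r + 0 * a)" "(x, r) \<in> G" by auto
      then show "u \<in> H" unfolding H_def by blast
    qed
    \<comment> \<open>Positive homogeneity scales \<open>t\<close> to 1 or -1, where the claim is
      \<open>a2\<close> or \<open>a1\<close>.\<close>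
    moreover have "r + t * a \<le> p (x + t *\<^sub>R x0)" if xr: "(x, r) \<in> G" for x r t
    proof -
      consider "t = 0" | "t > 0" | "t < 0" by linarith
      then show ?thesis
      proof cases
        case 1
        then show ?thesis using G(3)[OF xr] by simp
      next
        case 2
        have "((1 / t) *\<^sub>R x, r / t) \<in> G" using subspace_scale[OF G(1) xr, of "1 / t"] by simp
        from a2[OF this] have "t * a \<le> t * (p ((1 / t) *\<^sub>R x + x0) - r / t)" using 2 by simp
        also have "\<dots> = p (t *\<^sub>R ((1 / t) *\<^sub>R x + x0)) - r"
          using 2 hom[of t "(1 / t) *\<^sub>R x + x0"] by (simp add: right_diff_distrib)
        also have "t *\<^sub>R ((1 / t) *\<^sub>R x + x0) = x + t *\<^sub>R x0" using 2 by (simp add: algebra_simps)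
        finally show ?thesis by simp
      next
        case 3
        define s where "s = - t"
        have s: "s > 0" using 3 s_def by simp
        have "((1 / s) *\<^sub>R x, r / s) \<in> G" using subspace_scale[OF G(1) xr, of "1 / s"] by simp
        from a1[OF this] have "s * (r / s - p ((1 / s) *\<^sub>R x - x0)) \<le> s * a" using s by simp
        moreover have "s * (r / s - p ((1 / s) *\<^sub>R x - x0)) = r - p (s *\<^sub>R ((1 / s) *\<^sub>R x - x0))"
          using s hom[of s "(1 / s) *\<^sub>R x - x0"] by (simp add: right_diff_distrib)
        moreover have "s *\<^sub>R ((1 / s) *\<^sub>R x - x0) = x + t *\<^sub>R x0" using s by (simp add: algebra_simps s_def)
        ultimately show ?thesis by (simp add: s_def)
      qed
    qed
    ultimately have "H \<in> \<G>" unfolding \<G>_def using G(2) by (auto simp: H_def)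
    then have "H = G" using max GH by blast
    moreover have "(0 + 1 *\<^sub>R x0, 0 + 1 * a) \<in> H" unfolding H_def using zG by blast
    ultimately show False using x0 by auto
  qed
  define T where "T x = (THE r. (x, r) \<in> G)" for x
  have TG: "(x, T x) \<in> G" for x
    unfolding T_def using total[of x] uniq by (metis theI)
  have T: "T x = r" if "(x, r) \<in> G" for x r using uniq TG that by blast
  have "linear T"
  proof (rule linearI)
    show "T (x + y) = T x + T y" for x y using T subspace_add[OF G(1) TG TG] by simp
    show "T (c *\<^sub>R x) = c *\<^sub>R T x" for c x using T subspace_scale[OF G(1) TG] by simp
  qed
  then show ?thesis using T G TG by blast
qed

lemma is_normD:
  assumes "is_norm \<nu>"
  shows "0 \<le> \<nu> v" "\<nu> 0 = 0" "\<nu> v = 0 \<longleftrightarrow> v = 0" "\<nu> (u + v) \<le> \<nu> u + \<nu> v" "\<nu> (a *\<^sub>R v) = \<bar>a\<bar> * \<nu> v"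
    "\<nu> (- v) = \<nu> v" "\<nu> (u - v) = \<nu> (v - u)" "\<nu> (u - v) \<le> \<nu> (u - w) + \<nu> (w - v)"
proof -
  show *: "0 \<le> \<nu> v" "\<nu> 0 = 0" "\<nu> v = 0 \<longleftrightarrow> v = 0" "\<And>u v. \<nu> (u + v) \<le> \<nu> u + \<nu> v"
    and s: "\<And>a v. \<nu> (a *\<^sub>R v) = \<bar>a\<bar> * \<nu> v"
    using assms unfolding is_norm_def by auto
  show "\<nu> (- v) = \<nu> v" using s[of "-1" v] by simp
  show "\<nu> (u - v) = \<nu> (v - u)" using s[of "-1" "u - v"] by simp
  show "\<nu> (u - v) \<le> \<nu> (u - w) + \<nu> (w - v)" using *(4)[of "u - w" "w - v"] by simp
qed

lemma Hahn_Banach_norm: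
  assumes \<nu>: "is_norm \<nu>" and Y: "subspace Y" and M: "0 \<le> M"
    and T: "\<And>u v. u \<in> Y \<Longrightarrow> v \<in> Y \<Longrightarrow> T (u + v) = T u + T v" "\<And>a v. v \<in> Y \<Longrightarrow> T (a *\<^sub>R v) = a * T v"
    and le: "\<And>v. v \<in> Y \<Longrightarrow> T v \<le> M * \<nu> v"
  shows "\<exists>T'. linear T' \<and> (\<forall>v\<in>Y. T' v = T v) \<and> (\<forall>v. \<bar>T' v\<bar> \<le> M * \<nu> v)"
proof -
  define G0 where "G0 = (\<lambda>v. (v, T v)) ` Y"
  have T0: "T 0 = 0" using T(2)[of 0 0] Y subspace_0 by fastforce
  have "subspace G0"
  proof (rule subspaceI)
    show "0 \<in> G0" using T0 Y subspace_0 unfolding G0_def by (force simp: zero_prod_def)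
    show "x + y \<in> G0" if xy: "x \<in> G0" "y \<in> G0" for x y
    proof -
      obtain u v where *: "x = (u, T u)" "y = (v, T v)" "u \<in> Y" "v \<in> Y" using xy unfolding G0_def by blast
      then have "x + y = (u + v, T (u + v))" "u + v \<in> Y" using T(1) Y subspace_add by auto
      then show ?thesis unfolding G0_def by blast
    qed
    show "c *\<^sub>R x \<in> G0" if x: "x \<in> G0" for c x
    proof -
      obtain u where *: "x = (u, T u)" "u \<in> Y" using x unfolding G0_def by blast
      then have "c *\<^sub>R x = (c *\<^sub>R u, T (c *\<^sub>R u))" "c *\<^sub>R u \<in> Y" using T(2) Y subspace_scale by auto
      then show ?thesis unfolding G0_def by blast
    qed
  qed
  moreover have "M * \<nu> (u + v) \<le> M * \<nu> u + M * \<nu> v" for u v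
    using mult_left_mono[OF is_normD(4)[OF \<nu>] M, of u v] by (simp add: distrib_left)
  moreover have "M * \<nu> (a *\<^sub>R v) = a * (M * \<nu> v)" if "0 \<le> a" for a v
    using is_normD(5)[OF \<nu>, of a v] that by simp
  moreover have "r \<le> M * \<nu> x" if "(x, r) \<in> G0" for x r
    using that le unfolding G0_def by auto
  ultimately obtain T' where T': "linear T'" "\<And>x r. (x, r) \<in> G0 \<Longrightarrow> T' x = r" "\<And>x. T' x \<le> M * \<nu> x"
    using Hahn_Banach_graph[of "\<lambda>v. M * \<nu> v" G0] by blast
  have "\<bar>T' v\<bar> \<le> M * \<nu> v" for v
    using T'(3)[of v] T'(3)[of "- v"] by (simp add: abs_le_iff is_normD(6)[OF \<nu>] linear_neg[OF T'(1)])
  then show ?thesis using T' unfolding G0_def by blast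
qed

text \<open>Hahn-Banach, starting from the line spanned by \<open>(u, \<nu> u)\<close>. It reduces
  estimates of a vector-valued increment to the real fundamental theorem of calculus.\<close>

lemma norming_functional:
  assumes \<nu>: "is_norm \<nu>"
  shows "\<exists>T. linear T \<and> T u = \<nu> u \<and> (\<forall>v. \<bar>T v\<bar> \<le> \<nu> v)"
proof -
  define G0 where "G0 = range (\<lambda>t. t *\<^sub>R (u, \<nu> u))"
  have "subspace G0" unfolding G0_def using subspace_span span_singleton by metis
  moreover have "r \<le> \<nu> x" if "(x, r) \<in> G0" for x r
    using that is_normD(1,5)[OF \<nu>] unfolding G0_def by (auto simp: mult_right_mono)
  moreover have "\<nu> (a *\<^sub>R v) = a * \<nu> v" if "0 \<le> a" for a v
    using is_normD(5)[OF \<nu>, of a v] that by simp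
  ultimately obtain T' where T': "linear T'" "\<And>x r. (x, r) \<in> G0 \<Longrightarrow> T' x = r" "\<And>x. T' x \<le> \<nu> x"
    using Hahn_Banach_graph[of "\<nu>" G0] is_normD(4)[OF \<nu>] by blast
  have "\<bar>T' v\<bar> \<le> \<nu> v" for v
    using T'(3)[of v] T'(3)[of "- v"] by (simp add: abs_le_iff is_normD(6)[OF \<nu>] linear_neg[OF T'(1)])
  moreover have "(u, \<nu> u) \<in> G0" unfolding G0_def by (intro image_eqI[of _ _ 1]) auto
  ultimately show ?thesis using T' by blast
qed

text \<open>The infimum of \<open>f q + L * d q x\<close>, taken only over the points of
  \<open>B\<close> at finite distance from \<open>x\<close>. Points at finite distance from each
  other have the same index set \<open>I\<close>, so the default value 0 for an empty
  \<open>I x\<close> is compared only with itself.\<close>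

lemma McShane_extension:
  fixes d :: "'a \<Rightarrow> 'a \<Rightarrow> ennreal"
  assumes d: "\<And>x. d x x = 0" "\<And>x y. d x y = d y x" "\<And>x y z. d x z \<le> d x y + d y z"
    and L: "0 \<le> L"
    and f: "\<And>p q. p \<in> B \<Longrightarrow> q \<in> B \<Longrightarrow> d p q \<noteq> top \<Longrightarrow> ennreal \<bar>f p - f q\<bar> \<le> ennreal L * d p q"
  shows "\<exists>F. (\<forall>p\<in>B. F p = f p) \<and> (\<forall>x y. d x y \<noteq> top \<longrightarrow> ennreal \<bar>F x - F y\<bar> \<le> ennreal L * d x y)"
proof -
  define e where "e x y = enn2real (d x y)" for x y
  have de: "d x y = ennreal (e x y)" if "d x y \<noteq> top" for x y
    unfolding e_def using that by (simp add: less_top)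
  have e0: "0 \<le> e x y" "e x x = 0" "e x y = e y x" for x y unfolding e_def using d by auto
  have fin: "d x z \<noteq> top" if "d x y \<noteq> top" "d y z \<noteq> top" for x y z
    using d(3)[of x z y] that by (metis ennreal_add_eq_top top.extremum_uniqueI)
  have tri: "e x z \<le> e x y + e y z" if "d x y \<noteq> top" "d y z \<noteq> top" for x y z
    using d(3)[of x z y] de[OF that(1)] de[OF that(2)] de[OF fin[OF that]] e0
    by (simp flip: ennreal_plus)
  have f': "\<bar>f p - f q\<bar> \<le> L * e p q" if "p \<in> B" "q \<in> B" "d p q \<noteq> top" for p q
    using f[OF that] de[OF that(3)] L e0 by (simp flip: ennreal_mult)
  define I where "I x = {q\<in>B. d q x \<noteq> top}" for x
  define F where "F x = (if I x = {} then 0 else INF q\<in>I x. f q + L * e q x)" for x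
  have bdd: "bdd_below ((\<lambda>q. f q + L * e q x) ` I x)" for x
  proof (cases "I x = {}")
    case False
    then obtain q0 where q0: "q0 \<in> B" "d q0 x \<noteq> top" unfolding I_def by blast
    have "f q0 - L * e q0 x \<le> f q + L * e q x" if "q \<in> I x" for q
    proof -
      have q: "q \<in> B" "d q x \<noteq> top" using that I_def by auto
      have "\<bar>f q0 - f q\<bar> \<le> L * e q0 q" using f'[OF q0(1) q(1)] fin[OF q0(2)] q(2) d(2) by metis
      also have "\<dots> \<le> L * (e q0 x + e q x)" using tri[OF q0(2), of q] q(2) d(2) e0(3) L
        by (metis mult_left_mono)
      finally show ?thesis by (simp add: distrib_left)
    qed
    then show ?thesis by (intro bdd_belowI2)
  qed simp
  have one: "F x \<le> F y + L * e x y" if xy: "d x y \<noteq> top" for x y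
  proof -
    have II: "I x = I y" unfolding I_def using xy fin d(2) by metis
    show ?thesis
    proof (cases "I x = {}")
      case True
      then show ?thesis using II L e0 unfolding F_def by simp
    next
      case False
      have "F x - L * e x y \<le> f q + L * e q y" if q: "q \<in> I y" for q
      proof -
        have "F x \<le> f q + L * e q x" unfolding F_def using False II q cINF_lower[OF bdd, of q x] by simp
        also have "e q x \<le> e q y + e x y" using tri[of q y x] q xy d(2) e0(3) unfolding I_def by auto
        finally show ?thesis using L by (simp add: distrib_left mult_left_mono)
      qed
      then have "F x - L * e x y \<le> F y" using False II unfolding F_def by (simp add: cINF_greatest)
      then show ?thesis by simp
    qed
  qed
  have "ennreal \<bar>F x - F y\<bar> \<le> ennreal L * d x y" if xy: "d x y \<noteq> top" for x y
  proof -
    have "\<bar>F x - F y\<bar> \<le> L * e x y" using one[OF xy] one[of y x] xy d(2) e0(3) by (auto simp: abs_le_iff)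
    then show ?thesis using de[OF xy] L e0 by (simp flip: ennreal_mult)
  qed
  moreover have "F p = f p" if p: "p \<in> B" for p
  proof -
    have pI: "p \<in> I p" unfolding I_def using p d(1) by simp
    have "F p \<le> f p + L * e p p" unfolding F_def using pI cINF_lower[OF bdd pI] by auto
    moreover have "f p \<le> f q + L * e q p" if "q \<in> I p" for q
      using f'[of q p] that p unfolding I_def by auto
    then have "f p \<le> F p" using pI unfolding F_def by (auto intro: cINF_greatest)
    ultimately show ?thesis using e0 by simp
  qed
  ultimately show ?thesis by blast
qed

section \<open>Charts and tangent norms\<close>

locale weak_uniform_manifold =
  fixes K :: real
    and \<A> :: "('m::t2_space, 'x::banach) chart set"
    and nrm :: "('m, 'x) tangent_vec \<Rightarrow> real"
  assumes K: "1 \<le> K"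
    and paracompact: "paracompact_space (euclidean :: 'm topology)"
    and atlas: "C1_structure \<A>"
    and finsler: "weak_uniform_finsler K \<A> nrm"
begin

abbreviation len :: "real \<Rightarrow> real \<Rightarrow> (real \<Rightarrow> 'm) \<Rightarrow> real" where
  "len \<equiv> curve_length \<A> nrm"

abbreviation speed :: "real \<Rightarrow> real \<Rightarrow> (real \<Rightarrow> 'm) \<Rightarrow> real \<Rightarrow> real" where
  "speed a b c t \<equiv> nrm (velocity \<A> a b c t)"

abbreviation dM :: "'m \<Rightarrow> 'm \<Rightarrow> ennreal" where
  "dM \<equiv> finsler_dist \<A> nrm"

lemma chartD:
  assumes "(U, \<phi>) \<in> \<A>"
  shows "open U" "open (\<phi> ` U)" "inj_on \<phi> U" "continuous_on U \<phi>" "continuous_on (\<phi> ` U) (inv_into U \<phi>)"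
proof -
  have "is_chart (U, \<phi>)" using atlas assms unfolding C1_structure_def by blast
  then show *: "open U" "open (\<phi> ` U)" "continuous_on U \<phi>" "continuous_on (\<phi> ` U) (inv_into U \<phi>)"
    and "inj_on \<phi> U"
    unfolding is_chart_def homeomorphism_def by (auto intro: inj_on_inverseI)
qed

lemma inv_chart: "(U, \<phi>) \<in> \<A> \<Longrightarrow> x \<in> U \<Longrightarrow> inv_into U \<phi> (\<phi> x) = x"
  using chartD(3) by (metis inv_into_f_f)

lemma open_chart_image:
  assumes "(U, \<phi>) \<in> \<A>" "open W" "W \<subseteq> U"
  shows "open (\<phi> ` W)"
proof -
  have "\<phi> ` W = \<phi> ` U \<inter> inv_into U \<phi> -` W"
    using inv_chart[OF assms(1)] assms(3) by force
  then show ?thesis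
    using continuous_open_preimage[OF chartD(5)[OF assms(1)] chartD(2)[OF assms(1)] assms(2)] by simp
qed

lemma open_chart_vimage:
  assumes "(U, \<phi>) \<in> \<A>" "open B"
  shows "open {x \<in> U. \<phi> x \<in> B}"
proof -
  have "{x \<in> U. \<phi> x \<in> B} = U \<inter> \<phi> -` B" by auto
  then show ?thesis using continuous_open_preimage[OF chartD(4,1)[OF assms(1)] assms(2)] by simp
qed

lemma chart_ex: "\<exists>U \<phi>. (U, \<phi>) \<in> \<A> \<and> x \<in> U"
proof -
  have "x \<in> \<Union>(fst ` \<A>)" using atlas unfolding C1_structure_def by simp
  then show ?thesis by fastforce
qed

section \<open>Changes of charts and tangent norms in coordinates\<close>

lemma transition:
  "(U, \<phi>) \<in> \<A> \<Longrightarrow> (V, \<psi>) \<in> \<A> \<Longrightarrow> C1_on (\<phi> ` (U \<inter> V)) (\<psi> \<circ> inv_into U \<phi>)"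
  using atlas unfolding C1_structure_def C1_compatible_def by fast

text \<open>Indexed by the point of \<open>M\<close> rather than by its coordinates, so that
  compositions of several changes of charts keep one base point.\<close>

definition trans :: "'m set \<Rightarrow> ('m \<Rightarrow> 'x) \<Rightarrow> ('m \<Rightarrow> 'x) \<Rightarrow> 'm \<Rightarrow> 'x \<Rightarrow> 'x" where
  "trans U \<phi> \<psi> x = frechet_derivative (\<psi> \<circ> inv_into U \<phi>) (at (\<phi> x))"

lemma has_derivative_trans:
  assumes "(U, \<phi>) \<in> \<A>" "(V, \<psi>) \<in> \<A>" "x \<in> U" "x \<in> V"
  shows "((\<psi> \<circ> inv_into U \<phi>) has_derivative trans U \<phi> \<psi> x) (at (\<phi> x))"
proof -
  have "\<phi> x \<in> \<phi> ` (U \<inter> V)" using assms by blast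
  then have "(\<psi> \<circ> inv_into U \<phi>) differentiable (at (\<phi> x))"
    using transition[OF assms(1,2)] unfolding C1_on_def differentiable_def by blast
  then show ?thesis unfolding trans_def by (simp add: frechet_derivative_works)
qed

lemma trans_linear:
  assumes "(U, \<phi>) \<in> \<A>" "(V, \<psi>) \<in> \<A>" "x \<in> U" "x \<in> V"
  shows "bounded_linear (trans U \<phi> \<psi> x)" "linear (trans U \<phi> \<psi> x)"
  using has_derivative_trans[OF assms] has_derivative_bounded_linear has_derivative_linear by blast+

text \<open>Chain rule; the composite agrees with the direct change of charts on the image of
  \<open>U \<inter> V\<close>, an open set around \<open>\<phi> x\<close>. This cocycle identity
  makes \<open>d_chart_inv\<close> give the same tangent vector in every chart.\<close>

lemma trans_trans:
  assumes U: "(U, \<phi>) \<in> \<A>" "x \<in> U" and V: "(V, \<psi>) \<in> \<A>" "x \<in> V" and W: "(W, \<theta>) \<in> \<A>" "x \<in> W"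
  shows "trans V \<psi> \<theta> x (trans U \<phi> \<psi> x v) = trans U \<phi> \<theta> x v"
proof -
  have "((\<theta> \<circ> inv_into V \<psi>) has_derivative trans V \<psi> \<theta> x) (at ((\<psi> \<circ> inv_into U \<phi>) (\<phi> x)))"
    using has_derivative_trans[OF V(1) W(1) V(2) W(2)] inv_chart[OF U] by simp
  from diff_chain_at[OF has_derivative_trans[OF U(1) V(1) U(2) V(2)] this]
  have "((\<theta> \<circ> inv_into V \<psi>) \<circ> (\<psi> \<circ> inv_into U \<phi>) has_derivative trans V \<psi> \<theta> x \<circ> trans U \<phi> \<psi> x) (at (\<phi> x))" .
  then have "((\<theta> \<circ> inv_into U \<phi>) has_derivative trans V \<psi> \<theta> x \<circ> trans U \<phi> \<psi> x) (at (\<phi> x))"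
  proof (rule has_derivative_transform_within_open)
    show "open (\<phi> ` (U \<inter> V))" using open_chart_image[OF U(1)] chartD(1) U V by (simp add: open_Int)
    show "\<phi> x \<in> \<phi> ` (U \<inter> V)" using U V by blast
    show "((\<theta> \<circ> inv_into V \<psi>) \<circ> (\<psi> \<circ> inv_into U \<phi>)) y = (\<theta> \<circ> inv_into U \<phi>) y" if "y \<in> \<phi> ` (U \<inter> V)" for y
      using that inv_chart[OF U(1)] inv_chart[OF V(1)] by auto
  qed
  from has_derivative_unique[OF this has_derivative_trans[OF U(1) W(1) U(2) W(2)]]
  show ?thesis by (metis comp_apply)
qed

lemma trans_self:
  assumes "(U, \<phi>) \<in> \<A>" "x \<in> U"
  shows "trans U \<phi> \<phi> x v = v"
proof -
  have "((\<phi> \<circ> inv_into U \<phi>) has_derivative (\<lambda>v. v)) (at (\<phi> x))"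
    by (rule has_derivative_transform_within_open[OF has_derivative_ident chartD(2)[OF assms(1)]])
      (use assms inv_chart in auto)
  from has_derivative_unique[OF this has_derivative_trans[OF assms(1,1,2,2)]]
  show ?thesis by metis
qed

lemma d_chart_inv_eq:
  assumes "(U, \<phi>) \<in> \<A>" "x \<in> U"
  shows "d_chart_inv \<A> (U, \<phi>) (\<phi> x) v = (x, \<lambda>(W, \<theta>). if (W, \<theta>) \<in> \<A> \<and> x \<in> W then trans U \<phi> \<theta> x v else 0)"
  using inv_chart[OF assms] unfolding d_chart_inv_def trans_def by simp

lemma d_chart_inv_trans:
  assumes "(U, \<phi>) \<in> \<A>" "x \<in> U" "(V, \<psi>) \<in> \<A>" "x \<in> V"
  shows "d_chart_inv \<A> (U, \<phi>) (\<phi> x) v = d_chart_inv \<A> (V, \<psi>) (\<psi> x) (trans U \<phi> \<psi> x v)"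
  unfolding d_chart_inv_eq[OF assms(1,2)] d_chart_inv_eq[OF assms(3,4)]
  using trans_trans[OF assms] by (auto simp: fun_eq_iff)

text \<open>The tangent norm at \<open>x\<close> transported to the model space. At the centre
  \<open>p\<close> of a chart ball it is the equivalent norm to which the approximation property is
  applied.\<close>

definition cnorm :: "'m set \<Rightarrow> ('m \<Rightarrow> 'x) \<Rightarrow> 'm \<Rightarrow> 'x \<Rightarrow> real" where
  "cnorm U \<phi> x v = nrm (d_chart_inv \<A> (U, \<phi>) (\<phi> x) v)"

lemma cnorm_equivalent: "(U, \<phi>) \<in> \<A> \<Longrightarrow> x \<in> U \<Longrightarrow> equivalent_norm (cnorm U \<phi> x)"
  using finsler unfolding weak_uniform_finsler_def property_P1_def cnorm_def[abs_def] by fast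

lemma cnorm_trans:
  assumes "(U, \<phi>) \<in> \<A>" "x \<in> U" "(V, \<psi>) \<in> \<A>" "x \<in> V"
  shows "cnorm U \<phi> x v = cnorm V \<psi> x (trans U \<phi> \<psi> x v)"
  unfolding cnorm_def d_chart_inv_trans[OF assms] ..

text \<open>The defining estimate is only assumed for one chart around each point; the continuity
  of the transition derivatives gives it for all charts, with \<open>2 K\<close> in place of \<open>K\<close>.\<close>

lemma cnorm_comparison:
  assumes U: "(U, \<phi>) \<in> \<A>" "p \<in> U"
  shows "\<exists>W. open W \<and> p \<in> W \<and> W \<subseteq> U \<and>
    (\<forall>x\<in>W. \<forall>v. cnorm U \<phi> p v \<le> 2 * K * cnorm U \<phi> x v \<and> cnorm U \<phi> x v \<le> 2 * K * cnorm U \<phi> p v)"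
proof -
  obtain V \<psi> where V: "(V, \<psi>) \<in> \<A>" "p \<in> V" and
    cmp: "\<And>x v. x \<in> V \<Longrightarrow> 1 / K * cnorm V \<psi> p v \<le> cnorm V \<psi> x v \<and> cnorm V \<psi> x v \<le> K * cnorm V \<psi> p v"
    using finsler unfolding weak_uniform_finsler_def cnorm_def by fast
  define \<mu> where "\<mu> = cnorm V \<psi> p"
  define \<nu> where "\<nu> = cnorm U \<phi> p"
  have "equivalent_norm \<mu>" "equivalent_norm \<nu>"
    unfolding \<mu>_def \<nu>_def using U V cnorm_equivalent by auto
  then obtain b a where b: "b > 0" "\<And>v. \<mu> v \<le> b * norm v" and a: "a > 0" "\<And>v. a * norm v \<le> \<nu> v"
    and \<mu>: "is_norm \<mu>" and \<nu>: "is_norm \<nu>"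
    unfolding equivalent_norm_def by metis
  \<comment> \<open>\<open>b * e / a = 1/2\<close>: once the transition derivatives differ by less
    than \<open>e\<close>, the vectors \<open>w\<close> and \<open>u\<close> below differ by at most
    half of \<open>\<nu> v\<close>. This is the origin of the extra factor 2.\<close>
  define e where "e = a / (2 * b)"
  have e: "e > 0" using a b by (simp add: e_def)
  obtain D where D: "continuous_on (\<phi> ` (U \<inter> V)) D"
    "\<And>y. y \<in> \<phi> ` (U \<inter> V) \<Longrightarrow> ((\<psi> \<circ> inv_into U \<phi>) has_derivative blinfun_apply (D y)) (at y)"
    using transition[OF U(1) V(1)] unfolding C1_on_def by blast
  have tD: "trans U \<phi> \<psi> x = blinfun_apply (D (\<phi> x))" if "x \<in> U" "x \<in> V" for x
    using has_derivative_unique[OF has_derivative_trans[OF U(1) V(1) that] D(2)] that by blast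
  have oi: "open (\<phi> ` (U \<inter> V))" using open_chart_image[OF U(1)] chartD(1) U V by (simp add: open_Int)
  then obtain d where d: "d > 0" "\<And>y. y \<in> \<phi> ` (U \<inter> V) \<Longrightarrow> dist y (\<phi> p) < d \<Longrightarrow> dist (D y) (D (\<phi> p)) < e"
    using D(1) U V e unfolding continuous_on_iff by blast
  define W where "W = {x\<in>U. \<phi> x \<in> ball (\<phi> p) d \<inter> \<phi> ` (U \<inter> V)}"
  have "open W" unfolding W_def by (intro open_chart_vimage U oi open_Int open_ball)
  moreover have "p \<in> W" unfolding W_def using U V d by auto
  moreover have "W \<subseteq> U" unfolding W_def by auto
  moreover have "cnorm U \<phi> p v \<le> 2 * K * cnorm U \<phi> x v \<and> cnorm U \<phi> x v \<le> 2 * K * cnorm U \<phi> p v"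
    if x: "x \<in> W" for x v
  proof -
    have xU: "x \<in> U" "x \<in> V" and dx: "dist (\<phi> x) (\<phi> p) < d"
      using x chartD(3)[OF U(1)] unfolding W_def by (auto simp: dist_commute inj_on_def)
    define w where "w = trans U \<phi> \<psi> x v"
    define u where "u = trans U \<phi> \<psi> p v"
    have \<nu>u: "\<nu> v = \<mu> u" unfolding \<nu>_def \<mu>_def u_def using cnorm_trans U V by blast
    have wx: "cnorm U \<phi> x v = cnorm V \<psi> x w" unfolding w_def using cnorm_trans[OF U(1) xU(1) V(1) xU(2)] .
    have "\<mu> (w - u) \<le> b * norm (w - u)" using b by blast
    also have "norm (w - u) \<le> norm (D (\<phi> x) - D (\<phi> p)) * norm v"
      unfolding w_def u_def tD[OF xU] tD[OF U(2) V(2)] using norm_blinfun[of "D (\<phi> x) - D (\<phi> p)" v]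
      by (simp add: blinfun.diff_left)
    also have "\<dots> \<le> e * norm v"
      using d(2)[OF _ dx] xU by (intro mult_right_mono) (auto simp: dist_norm)
    also have "norm v \<le> \<nu> v / a" using a by (simp add: field_simps)
    also have "b * (e * (\<nu> v / a)) = \<nu> v / 2" using a b by (simp add: e_def field_simps)
    finally have wu: "\<mu> (w - u) \<le> \<nu> v / 2" using b e by (simp add: mult_left_mono)
    have "\<mu> w \<le> \<mu> u + \<mu> (w - u)" "\<mu> u \<le> \<mu> w + \<mu> (w - u)"
      using is_normD(4)[OF \<mu>, of u "w - u"] is_normD(4)[OF \<mu>, of w "u - w"] is_normD(7)[OF \<mu>, of u w] by auto
    then have *: "\<mu> w \<le> 2 * \<nu> v" "\<nu> v \<le> 2 * \<mu> w" using wu \<nu>u is_normD(1)[OF \<nu>, of v] by linarith+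
    have "cnorm V \<psi> x w \<le> K * \<mu> w" "\<mu> w \<le> K * cnorm V \<psi> x w"
      using cmp[OF xU(2), of w] K unfolding \<mu>_def by (auto simp: field_simps)
    moreover have "K * \<mu> w \<le> K * (2 * \<nu> v)" using * K by (intro mult_left_mono) auto
    ultimately show ?thesis using * wx unfolding \<nu>_def by (simp add: algebra_simps)
  qed
  ultimately show ?thesis by blast
qed

section \<open>Curves\<close>

lemma tangent_norm: "is_tangent_norm \<A> x (\<lambda>\<xi>. nrm (x, \<xi>))"
  using finsler unfolding weak_uniform_finsler_def property_P1_def by blast

text \<open>Near \<open>t\<close> the curve stays in \<open>U\<close>, so there
  \<open>\<psi> \<circ> c\<close> is the change of charts applied to
  \<open>\<phi> \<circ> c\<close>. Hence the coordinates of the velocity in different charts fit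
  together to a tangent vector.\<close>

lemma curve_chain:
  assumes c: "C1_curve \<A> a b c" "a < b" "t \<in> {a..b}"
    and U: "(U, \<phi>) \<in> \<A>" "c t \<in> U" and V: "(V, \<psi>) \<in> \<A>" "c t \<in> V"
  shows "((\<psi> \<circ> c) has_vector_derivative
      trans U \<phi> \<psi> (c t) (vector_derivative (\<phi> \<circ> c) (at t within {a..b}))) (at t within {a..b})"
proof -
  obtain D where "continuous_on {t\<in>{a..b}. c t \<in> U} D" and
    D: "((\<phi> \<circ> c) has_vector_derivative D t) (at t within {a..b})"
    using c U unfolding C1_curve_def by blast
  have Dt: "vector_derivative (\<phi> \<circ> c) (at t within {a..b}) = D t"
    using vector_derivative_within_cbox[OF c(2)] D c(3) by (metis box_real(2))
  have F: "(((\<psi> \<circ> inv_into U \<phi>) \<circ> (\<phi> \<circ> c)) has_vector_derivative trans U \<phi> \<psi> (c t) (D t)) (at t within {a..b})"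
    by (rule vector_derivative_diff_chain_within[OF D, where g="\<psi> \<circ> inv_into U \<phi>"])
      (simp only: comp_apply has_derivative_at_withinI[OF has_derivative_trans[OF U(1) V(1) U(2) V(2)]])
  have cc: "continuous_on {a..b} c" using c unfolding C1_curve_def by blast
  obtain d where d: "d > 0" "\<And>s. s \<in> {a..b} \<Longrightarrow> dist s t < d \<Longrightarrow> c s \<in> U"
  proof -
    have "openin (top_of_set {a..b}) ({a..b} \<inter> c -` U)"
      using continuous_openin_preimage_gen[OF cc chartD(1)[OF U(1)]] .
    then obtain T where T: "open T" "{a..b} \<inter> c -` U = {a..b} \<inter> T" unfolding openin_open by blast
    then have "t \<in> T" using c(3) U(2) by blast
    then obtain d where d: "d > 0" "ball t d \<subseteq> T" using T(1) by (metis openE)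
    have "c s \<in> U" if "s \<in> {a..b}" "dist s t < d" for s
    proof -
      have "s \<in> T" using d(2) that(2) by (auto simp: dist_commute)
      then show ?thesis using T(2) that(1) by blast
    qed
    then show thesis using that d(1) by blast
  qed
  show ?thesis
    unfolding Dt by (rule has_vector_derivative_transform_within[OF F d(1) c(3)]) (simp add: d(2) inv_chart[OF U(1)])
qed

lemma has_vector_derivative_chart:
  assumes c: "C1_curve \<A> a b c" "a < b" "t \<in> {a..b}" and U: "(U, \<phi>) \<in> \<A>" "c t \<in> U"
  shows "((\<phi> \<circ> c) has_vector_derivative vector_derivative (\<phi> \<circ> c) (at t within {a..b})) (at t within {a..b})"
  using curve_chain[OF assms U] trans_self[OF U] by simp

lemma continuous_on_vector_derivative_chart:
  assumes c: "C1_curve \<A> a b c" "a < b" and U: "(U, \<phi>) \<in> \<A>"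
  shows "continuous_on {t\<in>{a..b}. c t \<in> U} (\<lambda>t. vector_derivative (\<phi> \<circ> c) (at t within {a..b}))"
proof -
  obtain D where D: "continuous_on {t\<in>{a..b}. c t \<in> U} D" and
    D': "\<And>t. t \<in> {a..b} \<Longrightarrow> c t \<in> U \<Longrightarrow> ((\<phi> \<circ> c) has_vector_derivative D t) (at t within {a..b})"
    using c U unfolding C1_curve_def by blast
  have "vector_derivative (\<phi> \<circ> c) (at t within {a..b}) = D t" if "t \<in> {a..b}" "c t \<in> U" for t
    using vector_derivative_within_cbox[OF c(2)] D'[OF that] that by (metis box_real(2))
  then show ?thesis using D by (auto intro: continuous_on_eq)
qed

lemma velocity_eq:
  assumes c: "C1_curve \<A> a b c" "a < b" "t \<in> {a..b}" and U: "(U, \<phi>) \<in> \<A>" "c t \<in> U"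
  shows "velocity \<A> a b c t = d_chart_inv \<A> (U, \<phi>) (\<phi> (c t)) (vector_derivative (\<phi> \<circ> c) (at t within {a..b}))"
proof -
  have "vector_derivative (\<psi> \<circ> c) (at t within {a..b}) =
      trans U \<phi> \<psi> (c t) (vector_derivative (\<phi> \<circ> c) (at t within {a..b}))"
    if "(V, \<psi>) \<in> \<A>" "c t \<in> V" for V \<psi>
    using vector_derivative_within_cbox[OF c(2)] curve_chain[OF assms that] c(3) by (metis box_real(2))
  then show ?thesis unfolding d_chart_inv_eq[OF U] velocity_def by (auto simp: fun_eq_iff)
qed

lemma nrm_velocity:
  assumes "C1_curve \<A> a b c" "a < b" "t \<in> {a..b}" "(U, \<phi>) \<in> \<A>" "c t \<in> U"
  shows "speed a b c t = cnorm U \<phi> (c t) (vector_derivative (\<phi> \<circ> c) (at t within {a..b}))"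
  unfolding velocity_eq[OF assms] cnorm_def ..

lemma velocity_in_tangent_space:
  assumes c: "C1_curve \<A> a b c" "a < b" "t \<in> {a..b}"
  shows "snd (velocity \<A> a b c t) \<in> tangent_space \<A> (c t)"
proof -
  have "vector_derivative (\<psi> \<circ> c) (at t within {a..b}) =
      trans U \<phi> \<psi> (c t) (vector_derivative (\<phi> \<circ> c) (at t within {a..b}))"
    if "(V, \<psi>) \<in> \<A>" "c t \<in> V" "(U, \<phi>) \<in> \<A>" "c t \<in> U" for U \<phi> V \<psi>
    using vector_derivative_within_cbox[OF c(2)] curve_chain[OF assms that(3,4,1,2)] c(3) by (metis box_real(2))
  then show ?thesis unfolding tangent_space_def velocity_def trans_def by auto
qed

lemma nrm_velocity_nonneg:
  assumes "C1_curve \<A> a b c" "a < b" "t \<in> {a..b}"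
  shows "0 \<le> speed a b c t"
  using velocity_in_tangent_space[OF assms] tangent_norm[of "c t"]
  unfolding is_tangent_norm_def velocity_def by auto

text \<open>The velocity is continuous into the tangent bundle, as tested on the generating sets of
  its topology, and \<open>nrm\<close> is continuous there. This makes the length a genuine integral
  and not a default value of \<open>integral\<close>.\<close>

lemma continuous_on_nrm_velocity:
  assumes c: "C1_curve \<A> a b c" "a < b"
  shows "continuous_on {a..b} (speed a b c)"
proof -
  have cc: "continuous_on {a..b} c" using c unfolding C1_curve_def by blast
  have "continuous_map (top_of_set {a..b}) (tangent_bundle_topology \<A>) (velocity \<A> a b c)"
    unfolding tangent_bundle_topology_def
  proof (rule continuous_on_generated_topo)
    fix S assume "S \<in> {{(x, \<xi>) \<in> tangent_bundle \<A>. x \<in> U \<and> (\<phi> x, \<xi> (U, \<phi>)) \<in> W} | U \<phi> W. (U, \<phi>) \<in> \<A> \<and> open W}"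
    then obtain U \<phi> W where S: "S = {(x, \<xi>) \<in> tangent_bundle \<A>. x \<in> U \<and> (\<phi> x, \<xi> (U, \<phi>)) \<in> W}"
      and U: "(U, \<phi>) \<in> \<A>" and W: "open W" by blast
    define T where "T = {t\<in>{a..b}. c t \<in> U}"
    define h where "h t = (\<phi> (c t), vector_derivative (\<phi> \<circ> c) (at t within {a..b}))" for t
    have "openin (top_of_set {a..b}) T"
    proof -
      have "T = {a..b} \<inter> c -` U" unfolding T_def by auto
      then show ?thesis using continuous_openin_preimage_gen[OF cc chartD(1)[OF U]] by simp
    qed
    moreover have "continuous_on T (\<lambda>t. \<phi> (c t))"
      by (rule continuous_on_compose2[OF chartD(4)[OF U] continuous_on_subset[OF cc]]) (auto simp: T_def)
    then have "continuous_on T h"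
      using continuous_on_vector_derivative_chart[OF c U] unfolding h_def T_def by (rule continuous_on_Pair)
    then have "openin (top_of_set T) (T \<inter> h -` W)" using W by (rule continuous_openin_preimage_gen)
    ultimately have "openin (top_of_set {a..b}) (T \<inter> h -` W)" using openin_trans by blast
    moreover have "velocity \<A> a b c -` S \<inter> topspace (top_of_set {a..b}) = T \<inter> h -` W"
      using velocity_in_tangent_space[OF c] U
      unfolding S T_def h_def tangent_bundle_def velocity_def by auto
    ultimately show "openin (top_of_set {a..b}) (velocity \<A> a b c -` S \<inter> topspace (top_of_set {a..b}))" by simp
  next
    show "velocity \<A> a b c ` topspace (top_of_set {a..b}) \<subseteq>
        \<Union>{{(x, \<xi>) \<in> tangent_bundle \<A>. x \<in> U \<and> (\<phi> x, \<xi> (U, \<phi>)) \<in> W} | U \<phi> W. (U, \<phi>) \<in> \<A> \<and> open W}"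
    proof
      fix z assume "z \<in> velocity \<A> a b c ` topspace (top_of_set {a..b})"
      then obtain t where t: "t \<in> {a..b}" "z = velocity \<A> a b c t" by auto
      obtain U \<phi> where U: "(U, \<phi>) \<in> \<A>" "c t \<in> U" using chart_ex by blast
      have "z \<in> {(x, \<xi>) \<in> tangent_bundle \<A>. x \<in> U \<and> (\<phi> x, \<xi> (U, \<phi>)) \<in> UNIV}"
        using velocity_in_tangent_space[OF c t(1)] U t unfolding tangent_bundle_def velocity_def by auto
      then show "z \<in> \<Union>{{(x, \<xi>) \<in> tangent_bundle \<A>. x \<in> U \<and> (\<phi> x, \<xi> (U, \<phi>)) \<in> W} | U \<phi> W. (U, \<phi>) \<in> \<A> \<and> open W}"
        using U open_UNIV by blast
    qed
  qed
  moreover have "continuous_map (tangent_bundle_topology \<A>) euclideanreal nrm"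
    using finsler unfolding weak_uniform_finsler_def by blast
  ultimately have "continuous_map (top_of_set {a..b}) euclideanreal (nrm \<circ> velocity \<A> a b c)"
    by (rule continuous_map_compose)
  then show ?thesis by (simp add: o_def)
qed

lemma integrable_nrm_velocity:
  "C1_curve \<A> a b c \<Longrightarrow> a < b \<Longrightarrow> speed a b c integrable_on {a..b}"
  by (intro integrable_continuous_interval continuous_on_nrm_velocity)

lemma len_nonneg: "C1_curve \<A> a b c \<Longrightarrow> a < b \<Longrightarrow> 0 \<le> len a b c"
  unfolding curve_length_def
  by (intro integral_nonneg integrable_nrm_velocity nrm_velocity_nonneg) auto

section \<open>Subintervals, subdivisions and reparametrisations of curves\<close>

lemma C1_curve_subinterval:
  assumes "C1_curve \<A> a b c" "a \<le> s" "t \<le> b"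
  shows "C1_curve \<A> s t c"
  unfolding C1_curve_def
proof (intro conjI ballI)
  show "continuous_on {s..t} c" using assms unfolding C1_curve_def by (auto intro: continuous_on_subset)
  fix z assume "z \<in> \<A>"
  then obtain U \<phi> where z: "z = (U, \<phi>)" "(U, \<phi>) \<in> \<A>" by (metis surj_pair)
  then obtain D where "continuous_on {t\<in>{a..b}. c t \<in> U} D"
    "\<And>t. t \<in> {a..b} \<Longrightarrow> c t \<in> U \<Longrightarrow> ((\<phi> \<circ> c) has_vector_derivative D t) (at t within {a..b})"
    using assms unfolding C1_curve_def by blast
  moreover have sub: "{s..t} \<subseteq> {a..b}" using assms by auto
  moreover have "{r\<in>{s..t}. c r \<in> U} \<subseteq> {r\<in>{a..b}. c r \<in> U}" using sub by blast
  ultimately have "continuous_on {r\<in>{s..t}. c r \<in> U} D \<and>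
    (\<forall>r\<in>{s..t}. c r \<in> U \<longrightarrow> ((\<phi> \<circ> c) has_vector_derivative D r) (at r within {s..t}))"
    using continuous_on_subset has_vector_derivative_within_subset[OF _ sub] by blast
  then show "case z of (U, \<phi>) \<Rightarrow> \<exists>D. continuous_on {r\<in>{s..t}. c r \<in> U} D \<and>
    (\<forall>r\<in>{s..t}. c r \<in> U \<longrightarrow> ((\<phi> \<circ> c) has_vector_derivative D r) (at r within {s..t}))"
    using z by auto
qed

lemma velocity_subinterval:
  assumes c: "C1_curve \<A> a b c" and st: "a \<le> s" "s < t" "t \<le> b" and r: "r \<in> {s..t}"
  shows "velocity \<A> s t c r = velocity \<A> a b c r"
proof -
  have "vector_derivative (\<phi> \<circ> c) (at r within {s..t}) = vector_derivative (\<phi> \<circ> c) (at r within {a..b})"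
    if "(U, \<phi>) \<in> \<A>" "c r \<in> U" for U \<phi>
  proof -
    have "((\<phi> \<circ> c) has_vector_derivative vector_derivative (\<phi> \<circ> c) (at r within {a..b})) (at r within {a..b})"
      using has_vector_derivative_chart[OF c _ _ that] st r by auto
    then have "((\<phi> \<circ> c) has_vector_derivative vector_derivative (\<phi> \<circ> c) (at r within {a..b})) (at r within {s..t})"
      by (rule has_vector_derivative_within_subset) (use st in auto)
    then show ?thesis using vector_derivative_within_cbox[OF st(2)] r by (metis box_real(2))
  qed
  then show ?thesis unfolding velocity_def by (auto simp: fun_eq_iff)
qed

lemma len_split:
  assumes c: "C1_curve \<A> a b c" and r: "a \<le> s" "s < r" "r < t" "t \<le> b"
  shows "len s t c = len s r c + len r t c"
proof -
  have "C1_curve \<A> s t c" using C1_curve_subinterval[OF c] r by auto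
  then have "speed s t c integrable_on {s..t}" using r integrable_nrm_velocity by simp
  then have "integral {s..r} (speed s t c) + integral {r..t} (speed s t c)
      = integral {s..t} (speed s t c)"
    using r by (intro Henstock_Kurzweil_Integration.integral_combine) auto
  moreover have "integral {s..r} (speed s t c) = len s r c"
    unfolding curve_length_def
    by (intro integral_cong) (use velocity_subinterval[OF C1_curve_subinterval[OF c, of s t], of s r] r in auto)
  moreover have "integral {r..t} (speed s t c) = len r t c"
    unfolding curve_length_def
    by (intro integral_cong) (use velocity_subinterval[OF C1_curve_subinterval[OF c, of s t], of r t] r in auto)
  ultimately show ?thesis unfolding curve_length_def by simp
qed

text \<open>Inside a piece, the derivatives within the piece and within the whole interval coincide;
  the break points are negligible. The interval from \<open>\<alpha>\<close> to
  \<open>\<beta>\<close> stays fixed during the induction because the speed is defined relative to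
  it, and \<open>s 0 \<le> s n\<close> is carried along to combine the integrals.\<close>

lemma has_integral_pieces:
  assumes "\<And>i. i < n \<Longrightarrow> s i < s (Suc i) \<and> C1_curve \<A> (s i) (s (Suc i)) c"
  shows "s 0 \<le> s n \<and> (\<alpha> \<le> s 0 \<longrightarrow> s n \<le> \<beta> \<longrightarrow>
    (speed \<alpha> \<beta> c has_integral (\<Sum>i<n. len (s i) (s (Suc i)) c)) {s 0..s n})"
  using assms
proof (induction n)
  case 0
  then show ?case using has_integral_refl(2)[of "speed \<alpha> \<beta> c" "s 0"] by simp
next
  case (Suc n)
  have IH: "s 0 \<le> s n" "\<alpha> \<le> s 0 \<Longrightarrow> s n \<le> \<beta> \<Longrightarrow>
    (speed \<alpha> \<beta> c has_integral (\<Sum>i<n. len (s i) (s (Suc i)) c)) {s 0..s n}"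
    using Suc by auto
  have n: "s n < s (Suc n)" "C1_curve \<A> (s n) (s (Suc n)) c" using Suc by auto
  have "(speed \<alpha> \<beta> c has_integral (\<Sum>i<Suc n. len (s i) (s (Suc i)) c)) {s 0..s (Suc n)}"
    if le: "\<alpha> \<le> s 0" "s (Suc n) \<le> \<beta>"
  proof -
    have I: "(speed (s n) (s (Suc n)) c has_integral len (s n) (s (Suc n)) c) {s n..s (Suc n)}"
      unfolding curve_length_def using integrable_nrm_velocity[OF n(2,1)] by (rule integrable_integral)
    have v: "velocity \<A> \<alpha> \<beta> c t = velocity \<A> (s n) (s (Suc n)) c t"
      if "t \<in> {s n..s (Suc n)} - {s n, s (Suc n)}" for t
    proof -
      have "at t within {\<alpha>..\<beta>} = at t" "at t within {s n..s (Suc n)} = at t"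
        using that le IH(1) by (auto intro!: at_within_Icc_at)
      then show ?thesis unfolding velocity_def by (simp only:)
    qed
    have "(speed \<alpha> \<beta> c has_integral len (s n) (s (Suc n)) c) {s n..s (Suc n)}"
      by (rule has_integral_spike_finite[OF _ _ I, of "{s n, s (Suc n)}"]) (auto simp: v)
    then show ?thesis using has_integral_combine[OF IH(1) _ IH(2)] n le by auto
  qed
  then show ?case using IH n by auto
qed

lemma len_pieces:
  assumes "\<And>i. i < n \<Longrightarrow> s i < s (Suc i) \<and> C1_curve \<A> (s i) (s (Suc i)) c"
  shows "len (s 0) (s n) c = (\<Sum>i<n. len (s i) (s (Suc i)) c)"
  unfolding curve_length_def[of _ _ "s 0" "s n"]
  using has_integral_pieces[of n s c "s 0" "s n", OF assms] by (intro integral_unique) auto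

lemma piecewise_C1_curve_single: "a < b \<Longrightarrow> C1_curve \<A> a b c \<Longrightarrow> piecewise_C1_curve \<A> a b c"
  unfolding piecewise_C1_curve_def
  by (intro conjI exI[of _ "1::nat"] exI[of _ "\<lambda>i. if i = 0 then a else b"]) auto

lemma C1_curve_cong:
  assumes "C1_curve \<A> a b c" "\<And>t. t \<in> {a..b} \<Longrightarrow> c t = c' t"
  shows "C1_curve \<A> a b c'"
  unfolding C1_curve_def
proof (intro conjI ballI)
  show "continuous_on {a..b} c'" using assms continuous_on_eq[of "{a..b}" c c'] unfolding C1_curve_def by blast
  fix z assume "z \<in> \<A>"
  then obtain U \<phi> where z: "z = (U, \<phi>)" "(U, \<phi>) \<in> \<A>" by (metis surj_pair)
  then obtain D where D: "continuous_on {t\<in>{a..b}. c t \<in> U} D"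
    "\<And>t. t \<in> {a..b} \<Longrightarrow> c t \<in> U \<Longrightarrow> ((\<phi> \<circ> c) has_vector_derivative D t) (at t within {a..b})"
    using assms unfolding C1_curve_def by blast
  have "{t\<in>{a..b}. c' t \<in> U} = {t\<in>{a..b}. c t \<in> U}" using assms(2) by auto
  moreover have "((\<phi> \<circ> c') has_vector_derivative D t) (at t within {a..b})" if "t \<in> {a..b}" "c' t \<in> U" for t
    using D(2)[of t] that assms(2) by (intro has_vector_derivative_transform[OF that(1), of "\<phi> \<circ> c'" "\<phi> \<circ> c"]) auto
  ultimately show "case z of (U, \<phi>) \<Rightarrow> \<exists>D. continuous_on {t\<in>{a..b}. c' t \<in> U} D \<and>
    (\<forall>t\<in>{a..b}. c' t \<in> U \<longrightarrow> ((\<phi> \<circ> c') has_vector_derivative D t) (at t within {a..b}))"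
    using z D(1) by auto
qed

lemma len_cong:
  assumes "\<And>t. t \<in> {a..b} \<Longrightarrow> c t = c' t"
  shows "len a b c = len a b c'"
  unfolding curve_length_def
proof (rule integral_cong)
  fix t assume t: "t \<in> {a..b}"
  have "vector_derivative (\<phi> \<circ> c) (at t within {a..b}) = vector_derivative (\<phi> \<circ> c') (at t within {a..b})" for \<phi> :: "'m \<Rightarrow> 'x"
    unfolding vector_derivative_def
    using has_vector_derivative_transform[OF t, of "\<phi> \<circ> c" "\<phi> \<circ> c'"] has_vector_derivative_transform[OF t, of "\<phi> \<circ> c'" "\<phi> \<circ> c"] assms
    by (intro arg_cong[where f=Eps] ext) auto
  then show "speed a b c t = speed a b c' t"
    unfolding velocity_def assms[OF t] by (simp only:)
qed

text \<open>Slope 1 gives the translations used for concatenation, slope -1 the reversal used for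
  symmetry of the metric; both leave the speed unchanged.\<close>

lemma curve_reparam:
  fixes e k :: real
  assumes c: "C1_curve \<A> a b c" "a < b" and e: "\<bar>e\<bar> = 1" and ab: "a' < b'" "(\<lambda>t. e * t + k) ` {a'..b'} = {a..b}"
  shows "C1_curve \<A> a' b' (\<lambda>t. c (e * t + k))" "len a' b' (\<lambda>t. c (e * t + k)) = len a b c"
proof -
  define r where "r t = e * t + k" for t
  have r: "r ` {a'..b'} = {a..b}" using ab unfolding r_def by simp
  have rin: "r t \<in> {a..b}" if "t \<in> {a'..b'}" for t using r that by blast
  have rc: "continuous_on S r" for S unfolding r_def by (intro continuous_intros)
  have der: "((\<phi> \<circ> (\<lambda>t. c (r t))) has_vector_derivative e *\<^sub>R vector_derivative (\<phi> \<circ> c) (at (r t) within {a..b})) (at t within {a'..b'})"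
    if "t \<in> {a'..b'}" "(U, \<phi>) \<in> \<A>" "c (r t) \<in> U" for t U \<phi>
  proof -
    have "(r has_vector_derivative e) (at t within {a'..b'})"
      unfolding r_def by (auto intro!: derivative_eq_intros simp: has_real_derivative_iff_has_vector_derivative[symmetric])
    moreover have "((\<phi> \<circ> c) has_vector_derivative vector_derivative (\<phi> \<circ> c) (at (r t) within {a..b})) (at (r t) within r ` {a'..b'})"
      unfolding r using has_vector_derivative_chart[OF c rin[OF that(1)] that(2,3)] .
    ultimately have "((\<phi> \<circ> c) \<circ> r has_vector_derivative e *\<^sub>R vector_derivative (\<phi> \<circ> c) (at (r t) within {a..b})) (at t within {a'..b'})"
      by (rule vector_diff_chain_within)
    then show ?thesis by (simp add: o_def)
  qed
  have C: "C1_curve \<A> a' b' (\<lambda>t. c (r t))"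
    unfolding C1_curve_def
  proof (intro conjI ballI)
    show "continuous_on {a'..b'} (\<lambda>t. c (r t))"
      using c r unfolding C1_curve_def by (intro continuous_on_compose2[OF _ rc]) auto
    fix z assume "z \<in> \<A>"
    then obtain U \<phi> where z: "z = (U, \<phi>)" "(U, \<phi>) \<in> \<A>" by (metis surj_pair)
    have "continuous_on {t\<in>{a'..b'}. c (r t) \<in> U} (\<lambda>t. e *\<^sub>R vector_derivative (\<phi> \<circ> c) (at (r t) within {a..b}))"
      by (intro continuous_intros continuous_on_compose2[OF continuous_on_vector_derivative_chart[OF c z(2)] rc])
        (use rin in auto)
    then show "case z of (U, \<phi>) \<Rightarrow> \<exists>D. continuous_on {t\<in>{a'..b'}. c (r t) \<in> U} D \<and>
      (\<forall>t\<in>{a'..b'}. c (r t) \<in> U \<longrightarrow> ((\<phi> \<circ> (\<lambda>t. c (r t))) has_vector_derivative D t) (at t within {a'..b'}))"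
      using z der by blast
  qed
  then show "C1_curve \<A> a' b' (\<lambda>t. c (e * t + k))" unfolding r_def .
  have vel: "speed a' b' (\<lambda>t. c (r t)) t = speed a b c (r t)" if t: "t \<in> {a'..b'}" for t
  proof -
    have "vector_derivative (\<phi> \<circ> (\<lambda>t. c (r t))) (at t within {a'..b'}) = e *\<^sub>R vector_derivative (\<phi> \<circ> c) (at (r t) within {a..b})"
      if "(U, \<phi>) \<in> \<A>" "c (r t) \<in> U" for U \<phi>
      using vector_derivative_within_cbox[OF ab(1)] der[OF t that] t by (metis box_real(2))
    then have "velocity \<A> a' b' (\<lambda>t. c (r t)) t = (c (r t), \<lambda>z. e *\<^sub>R snd (velocity \<A> a b c (r t)) z)"
      unfolding velocity_def by (auto simp: fun_eq_iff)
    then show ?thesis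
      using tangent_norm[of "c (r t)"] velocity_in_tangent_space[OF c rin[OF t]] e
      unfolding is_tangent_norm_def velocity_def by simp
  qed
  have e0: "e \<noteq> 0" using e by auto
  have "(speed a b c has_integral len a b c) (cbox a b)"
    unfolding curve_length_def using integrable_nrm_velocity[OF c] integrable_integral by auto
  from has_integral_affinity[OF this e0, of k]
  have "((\<lambda>t. speed a b c (r t)) has_integral len a b c) ((\<lambda>x. (1 / e) *\<^sub>R x + - ((1 / e) *\<^sub>R k)) ` cbox a b)"
    unfolding r_def using e by simp
  also have "(\<lambda>x. (1 / e) *\<^sub>R x + - ((1 / e) *\<^sub>R k)) ` cbox a b = {a'..b'}"
    unfolding box_real r[symmetric] r_def image_image using e0 by (simp add: field_simps)
  finally have "((\<lambda>t. speed a' b' (\<lambda>t. c (r t)) t) has_integral len a b c) {a'..b'}"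
    using has_integral_cong[OF vel, of "{a'..b'}" "\<lambda>t. t"] by simp
  then show "len a' b' (\<lambda>t. c (e * t + k)) = len a b c"
    unfolding curve_length_def[of _ _ a' b'] r_def by (rule integral_unique)
qed

end

context weak_uniform_manifold
begin

section \<open>Functions that are Lipschitz along curves\<close>

text \<open>Unlike Lipschitz continuity with respect to the Finsler metric, this is a local property
  (\<open>curve_lip_local\<close>), so that functions can be glued.\<close>

definition curve_lip :: "real \<Rightarrow> 'm set \<Rightarrow> ('m \<Rightarrow> real) \<Rightarrow> bool" where
  "curve_lip L U g \<longleftrightarrow>
    (\<forall>a b c. a < b \<longrightarrow> C1_curve \<A> a b c \<longrightarrow> c ` {a..b} \<subseteq> U \<longrightarrow> \<bar>g (c b) - g (c a)\<bar> \<le> L * len a b c)"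

lemma curve_lipD:
  "curve_lip L U g \<Longrightarrow> a < b \<Longrightarrow> C1_curve \<A> a b c \<Longrightarrow> c ` {a..b} \<subseteq> U \<Longrightarrow> \<bar>g (c b) - g (c a)\<bar> \<le> L * len a b c"
  unfolding curve_lip_def by blast

lemma curve_lip_mono:
  assumes "curve_lip L U g" "V \<subseteq> U" "L \<le> L'"
  shows "curve_lip L' V g"
  unfolding curve_lip_def
proof (intro allI impI)
  fix a b c assume *: "a < b" "C1_curve \<A> a b c" "c ` {a..b} \<subseteq> V"
  have "\<bar>g (c b) - g (c a)\<bar> \<le> L * len a b c" using curve_lipD[OF assms(1) *(1,2)] * assms(2) by blast
  also have "\<dots> \<le> L' * len a b c" using assms(3) len_nonneg[OF *(2,1)] by (rule mult_right_mono)
  finally show "\<bar>g (c b) - g (c a)\<bar> \<le> L' * len a b c" .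
qed

lemma curve_lip_cong:
  assumes "curve_lip L U g" "\<And>x. x \<in> U \<Longrightarrow> g x = g' x"
  shows "curve_lip L U g'"
  unfolding curve_lip_def
proof (intro allI impI)
  fix a b c assume *: "a < b" "C1_curve \<A> a b c" "c ` {a..b} \<subseteq> U"
  then have "c a \<in> U" "c b \<in> U" by auto
  then show "\<bar>g' (c b) - g' (c a)\<bar> \<le> L * len a b c" using curve_lipD[OF assms(1) *] assms(2) by simp
qed

lemma curve_lip_const: "0 \<le> L \<Longrightarrow> curve_lip L U (\<lambda>x. k)"
  unfolding curve_lip_def by (simp add: len_nonneg)

lemma curve_lip_compose:
  assumes "curve_lip L U g" "\<And>s t. \<bar>\<tau> s - \<tau> t\<bar> \<le> M * \<bar>s - t\<bar>" "0 \<le> M"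
  shows "curve_lip (M * L) U (\<lambda>x. \<tau> (g x))"
  unfolding curve_lip_def
proof (intro allI impI)
  fix a b c assume *: "a < b" "C1_curve \<A> a b c" "c ` {a..b} \<subseteq> U"
  have "\<bar>\<tau> (g (c b)) - \<tau> (g (c a))\<bar> \<le> M * \<bar>g (c b) - g (c a)\<bar>" using assms by blast
  also have "\<dots> \<le> M * (L * len a b c)" using curve_lipD[OF assms(1) *] assms(3) by (rule mult_left_mono)
  finally show "\<bar>\<tau> (g (c b)) - \<tau> (g (c a))\<bar> \<le> M * L * len a b c" by (simp add: mult.assoc)
qed

text \<open>For factors in the unit interval the product rule just adds the constants.\<close>

lemma curve_lip_mult_unit:
  assumes "curve_lip L U g" "curve_lip L' U g'"
    and "\<And>x. x \<in> U \<Longrightarrow> 0 \<le> g x \<and> g x \<le> 1" "\<And>x. x \<in> U \<Longrightarrow> 0 \<le> g' x \<and> g' x \<le> 1"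
  shows "curve_lip (L + L') U (\<lambda>x. g x * g' x)"
  unfolding curve_lip_def
proof (intro allI impI)
  fix a b c assume *: "a < b" "C1_curve \<A> a b c" "c ` {a..b} \<subseteq> U"
  then have in_U: "c a \<in> U" "c b \<in> U" by auto
  have "g (c b) * g' (c b) - g (c a) * g' (c a) = (g (c b) - g (c a)) * g' (c b) + g (c a) * (g' (c b) - g' (c a))"
    by (simp add: algebra_simps)
  also have "\<bar>\<dots>\<bar> \<le> \<bar>g (c b) - g (c a)\<bar> * \<bar>g' (c b)\<bar> + \<bar>g (c a)\<bar> * \<bar>g' (c b) - g' (c a)\<bar>"
    by (metis abs_mult abs_triangle_ineq)
  also have "\<dots> \<le> \<bar>g (c b) - g (c a)\<bar> * 1 + 1 * \<bar>g' (c b) - g' (c a)\<bar>"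
    using assms(3,4) in_U by (intro add_mono mult_left_mono mult_right_mono) auto
  also have "\<dots> \<le> (L + L') * len a b c"
    using curve_lipD[OF assms(1) *] curve_lipD[OF assms(2) *] by (simp add: distrib_right)
  finally show "\<bar>g (c b) * g' (c b) - g (c a) * g' (c a)\<bar> \<le> (L + L') * len a b c" .
qed

text \<open>An infimum over arbitrarily many functions keeps their common constant, whereas products
  add constants up. The lower bound \<open>B\<close> makes \<open>INF\<close> a true infimum on the
  reals.\<close>

lemma curve_lip_Inf:
  assumes "J \<noteq> {}" "\<And>i. i \<in> J \<Longrightarrow> curve_lip L U (w i)" "\<And>i x. i \<in> J \<Longrightarrow> B \<le> w i x"
  shows "curve_lip L U (\<lambda>x. INF i\<in>J. w i x)"
  unfolding curve_lip_def
proof (intro allI impI)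
  fix a b c assume *: "a < b" "C1_curve \<A> a b c" "c ` {a..b} \<subseteq> U"
  have "(INF i\<in>J. w i x) - L * len a b c \<le> (INF i\<in>J. w i y)"
    if "\<And>i. i \<in> J \<Longrightarrow> w i x \<le> w i y + L * len a b c" for x y
  proof (rule cINF_greatest[OF assms(1)])
    fix i assume i: "i \<in> J"
    have "(INF i\<in>J. w i x) \<le> w i x" using assms(3) i by (intro cINF_lower bdd_belowI2)
    then show "(INF i\<in>J. w i x) - L * len a b c \<le> w i y" using that[OF i] by linarith
  qed
  from this[of "c a" "c b"] this[of "c b" "c a"]
  show "\<bar>(INF i\<in>J. w i (c b)) - (INF i\<in>J. w i (c a))\<bar> \<le> L * len a b c"
    using curve_lipD[OF assms(2) *] by (smt (verit))
qed

text \<open>Lengths add under subdivision, and every sufficiently short piece of the curve lies in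
  one of the neighbourhoods, so bisection gives the global estimate.\<close>

lemma curve_lip_local:
  assumes "\<And>x. x \<in> U \<Longrightarrow> \<exists>W. open W \<and> x \<in> W \<and> curve_lip L W g"
  shows "curve_lip L U g"
  unfolding curve_lip_def
proof (intro allI impI)
  fix a b c assume *: "a < b" "C1_curve \<A> a b c" "c ` {a..b} \<subseteq> U"
  have cc: "continuous_on {a..b} c" using * unfolding C1_curve_def by blast
  have "a \<le> a \<and> a < b \<and> b \<le> b \<longrightarrow> \<bar>g (c b) - g (c a)\<bar> \<le> L * len a b c"
  \<comment> \<open>Bisection also meets degenerate intervals and intervals leaving
    \<open>{a..b}\<close>; for these the predicate is vacuous.\<close>
  proof (rule Bolzano[where P = "\<lambda>s t. a \<le> s \<and> s < t \<and> t \<le> b \<longrightarrow> \<bar>g (c t) - g (c s)\<bar> \<le> L * len s t c"])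
    show "a \<le> b" using * by simp
    fix s r t
    assume 1: "a \<le> s \<and> s < r \<and> r \<le> b \<longrightarrow> \<bar>g (c r) - g (c s)\<bar> \<le> L * len s r c"
      and 2: "a \<le> r \<and> r < t \<and> t \<le> b \<longrightarrow> \<bar>g (c t) - g (c r)\<bar> \<le> L * len r t c" and le: "s \<le> r" "r \<le> t"
    show "a \<le> s \<and> s < t \<and> t \<le> b \<longrightarrow> \<bar>g (c t) - g (c s)\<bar> \<le> L * len s t c"
    proof
      assume st: "a \<le> s \<and> s < t \<and> t \<le> b"
      show "\<bar>g (c t) - g (c s)\<bar> \<le> L * len s t c"
      proof (cases "s = r \<or> r = t")
        case True
        then show ?thesis using 1 2 st by auto
      next
        case False
        then have "len s t c = len s r c + len r t c" using len_split[OF *(2), of s r t] st le by simp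
        moreover have "\<bar>g (c r) - g (c s)\<bar> \<le> L * len s r c" "\<bar>g (c t) - g (c r)\<bar> \<le> L * len r t c"
          using 1 2 st le False by auto
        ultimately show ?thesis by (simp add: distrib_left)
      qed
    qed
  next
    fix r assume r: "a \<le> r" "r \<le> b"
    then have "c r \<in> U" using *(3) by auto
    then obtain W where W: "open W" "c r \<in> W" "curve_lip L W g" using assms by blast
    have "openin (top_of_set {a..b}) ({a..b} \<inter> c -` W)" using continuous_openin_preimage_gen[OF cc W(1)] .
    then obtain T where T: "open T" "{a..b} \<inter> c -` W = {a..b} \<inter> T" unfolding openin_open by blast
    have "r \<in> {a..b} \<inter> c -` W" using r W(2) by simp
    then have "r \<in> T" unfolding T(2) by blast
    then obtain d where d: "d > 0" "ball r d \<subseteq> T" using T(1) by (metis openE)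
    have "\<bar>g (c t) - g (c s)\<bar> \<le> L * len s t c" if st: "s \<le> r" "r \<le> t" "t - s < d" "a \<le> s" "s < t" "t \<le> b" for s t
    proof (rule curve_lipD[OF W(3) st(5)])
      show "C1_curve \<A> s t c" using C1_curve_subinterval[OF *(2)] st by simp
      have "u \<in> {a..b} \<inter> T" if "u \<in> {s..t}" for u
        using st that d(2) by (auto simp: dist_real_def subset_iff)
      then show "c ` {s..t} \<subseteq> W" using T(2) by blast
    qed
    then show "\<exists>d>0. \<forall>s t. s \<le> r \<and> r \<le> t \<and> t - s < d \<longrightarrow> a \<le> s \<and> s < t \<and> t \<le> b \<longrightarrow> \<bar>g (c t) - g (c s)\<bar> \<le> L * len s t c"
      using d(1) by blast
  qed
  then show "\<bar>g (c b) - g (c a)\<bar> \<le> L * len a b c" using * by simp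
qed

section \<open>The Finsler metric\<close>

lemma dM_le: "piecewise_C1_curve \<A> a b c \<Longrightarrow> dM (c a) (c b) \<le> ennreal (len a b c)"
  unfolding finsler_dist_def by (rule Inf_lower) blast

lemma dM_le_C1: "a < b \<Longrightarrow> C1_curve \<A> a b c \<Longrightarrow> dM (c a) (c b) \<le> ennreal (len a b c)"
  using dM_le piecewise_C1_curve_single by blast

lemma piecewise_curve_lip:
  assumes g: "curve_lip L UNIV g" and c: "piecewise_C1_curve \<A> a b c"
  shows "\<bar>g (c b) - g (c a)\<bar> \<le> L * len a b c"
proof -
  obtain n s where s: "s 0 = a" "s n = b" "\<And>i. i < n \<Longrightarrow> s i < s (Suc i) \<and> C1_curve \<A> (s i) (s (Suc i)) c"
    using c unfolding piecewise_C1_curve_def by blast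
  have "\<bar>g (c b) - g (c a)\<bar> = \<bar>\<Sum>i<n. g (c (s (Suc i))) - g (c (s i))\<bar>"
    using sum_lessThan_telescope[of "\<lambda>i. g (c (s i))" n] s by simp
  also have "\<dots> \<le> (\<Sum>i<n. \<bar>g (c (s (Suc i))) - g (c (s i))\<bar>)" by (rule sum_abs)
  also have "\<dots> \<le> (\<Sum>i<n. L * len (s i) (s (Suc i)) c)"
    using curve_lipD[OF g] s(3) by (intro sum_mono) auto
  also have "\<dots> = L * len a b c" using len_pieces[of n s c] s by (simp add: sum_distrib_left)
  finally show ?thesis .
qed

text \<open>For a constant function with constant 1, the preceding estimate reads
  \<open>0 \<le> len a b c\<close>.\<close>

lemma piecewise_len_nonneg: "piecewise_C1_curve \<A> a b c \<Longrightarrow> 0 \<le> len a b c"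
  using piecewise_curve_lip[OF curve_lip_const[of 1], of a b c] by simp

text \<open>Test with almost shortest curves. Infinite distance is excluded because for
  \<open>L = 0\<close> the right-hand side would be \<open>0 * top = 0\<close>.\<close>

lemma curve_lip_imp_lipschitz:
  assumes g: "curve_lip L UNIV g" and L: "0 \<le> L" and fin: "dM p q \<noteq> top"
  shows "ennreal \<bar>g p - g q\<bar> \<le> ennreal L * dM p q"
proof -
  obtain e where e: "dM p q = ennreal e" "0 \<le> e" using fin by (cases "dM p q") auto
  have "\<bar>g p - g q\<bar> \<le> L * e + \<delta>" if \<delta>: "\<delta> > 0" for \<delta>
  proof -
    \<comment> \<open>Division by \<open>L + 1\<close> gives
      \<open>L * \<eta> \<le> \<delta>\<close> and also covers \<open>L = 0\<close>.\<close>
    define \<eta> where "\<eta> = \<delta> / (L + 1)"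
    have \<eta>: "\<eta> > 0" using \<delta> L by (simp add: \<eta>_def)
    have "dM p q < ennreal (e + \<eta>)" unfolding e(1) using e(2) \<eta> by (simp add: ennreal_lessI)
    then obtain a b c where c: "piecewise_C1_curve \<A> a b c" "c a = p" "c b = q" "ennreal (len a b c) < ennreal (e + \<eta>)"
      unfolding finsler_dist_def Inf_less_iff by blast
    then have "len a b c < e + \<eta>" using ennreal_less_iff[OF piecewise_len_nonneg[OF c(1)]] by blast
    then have "\<bar>g q - g p\<bar> \<le> L * (e + \<eta>)"
      using piecewise_curve_lip[OF g c(1)] c(2,3) L by (smt (verit) mult_left_mono)
    also have "\<dots> \<le> L * e + \<delta>" using L \<delta> by (simp add: \<eta>_def field_simps)
    finally show ?thesis by (simp add: abs_minus_commute)
  qed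
  then have "\<bar>g p - g q\<bar> \<le> L * e" by (rule field_le_epsilon)
  then show ?thesis unfolding e(1) using L e(2) by (simp flip: ennreal_mult)
qed

lemma lipschitz_imp_curve_lip:
  assumes "\<And>p q. dM p q \<noteq> top \<Longrightarrow> ennreal \<bar>g p - g q\<bar> \<le> ennreal L * dM p q" "0 \<le> L"
  shows "curve_lip L UNIV g"
  unfolding curve_lip_def
proof (intro allI impI)
  fix a b c assume *: "a < b" "C1_curve \<A> a b c"
  have d: "dM (c a) (c b) \<le> ennreal (len a b c)" using dM_le_C1[OF *] .
  then have "dM (c a) (c b) \<noteq> top" by (metis ennreal_neq_top top.extremum_uniqueI)
  from assms(1)[OF this] have "ennreal \<bar>g (c a) - g (c b)\<bar> \<le> ennreal L * ennreal (len a b c)"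
    using d by (meson mult_left_mono order_trans zero_le)
  then show "\<bar>g (c b) - g (c a)\<bar> \<le> L * len a b c"
    using assms(2) len_nonneg[OF *(2,1)] by (simp add: abs_minus_commute flip: ennreal_mult)
qed

lemma dM_self: "dM p p = 0"
proof -
  have "C1_curve \<A> 0 1 (\<lambda>t. p)"
    unfolding C1_curve_def by (force intro: exI[of _ "\<lambda>t. 0"] simp: o_def)
  then have "dM p p \<le> ennreal (len 0 1 (\<lambda>t. p))" using dM_le_C1[of 0 1] by simp
  moreover have "velocity \<A> 0 1 (\<lambda>t. p) t = (p, \<lambda>z. 0)" if "t \<in> {0..1}" for t :: real
  proof -
    have "vector_derivative (\<phi> \<circ> (\<lambda>t. p)) (at t within {0..1}) = 0" for \<phi> :: "'m \<Rightarrow> 'x"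
      using vector_derivative_within_cbox[of 0 1 t "\<lambda>t. \<phi> p" 0] that by (simp add: o_def)
    then show ?thesis unfolding velocity_def by (auto simp: fun_eq_iff)
  qed
  moreover have "nrm (p, \<lambda>z. 0) = 0"
  proof -
    have "(\<lambda>z. 0) \<in> tangent_space \<A> p"
      using linear_0[OF trans_linear(2)] unfolding tangent_space_def trans_def by auto
    then show ?thesis using tangent_norm[of p] unfolding is_tangent_norm_def by blast
  qed
  ultimately have "len 0 1 (\<lambda>t. p) = integral {0..1} (\<lambda>t::real. 0::real)"
    unfolding curve_length_def by (intro integral_cong) auto
  then show ?thesis using \<open>dM p p \<le> _\<close> by simp
qed

section \<open>Concatenation, symmetry and the triangle inequality\<close>

lemma piecewise_append:
  assumes c1: "piecewise_C1_curve \<A> a b c1" and c2: "C1_curve \<A> a2 b2 c2" "a2 < b2" and eq: "c1 b = c2 a2"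
  shows "dM (c1 a) (c2 b2) \<le> ennreal (len a b c1 + len a2 b2 c2)"
proof -
  obtain n s where s: "s 0 = a" "s n = b" "\<And>i. i < n \<Longrightarrow> s i < s (Suc i) \<and> C1_curve \<A> (s i) (s (Suc i)) c1"
    using c1 unfolding piecewise_C1_curve_def by blast
  have ab: "a < b" using c1 unfolding piecewise_C1_curve_def by blast
  define b' where "b' = b + (b2 - a2)"
  define k where "k = a2 - b"
  have b': "b < b'" using c2 by (simp add: b'_def)
  have "(\<lambda>t. 1 * t + k) ` {b..b'} = {a2..b2}"
    using image_add_atLeastAtMost[of k b b'] by (simp add: k_def b'_def add.commute)
  from curve_reparam[OF c2 _ b' this]
  have c2': "C1_curve \<A> b b' (\<lambda>t. c2 (t + k))" "len b b' (\<lambda>t. c2 (t + k)) = len a2 b2 c2" by auto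
  \<comment> \<open>At \<open>b\<close> both formulas agree by \<open>eq\<close>, so on each closed
    interval of the new subdivision \<open>c\<close> coincides with one of the given curves.\<close>
  define c where "c t = (if t \<le> b then c1 t else c2 (t + k))" for t
  define s' where "s' i = (if i \<le> n then s i else b')" for i
  have sb: "s i \<le> b" if "i \<le> n" for i
    using that
  proof (induction i rule: inc_induct)
    case base then show ?case using s by simp
  next
    case (step m) then show ?case using s(3)[of m] by simp
  qed
  have cc1: "c1 t = c t" if "i < n" "t \<in> {s i..s (Suc i)}" for i t
    using sb[of "Suc i"] that by (simp add: c_def)
  have cc2: "c2 (t + k) = c t" if "t \<in> {b..b'}" for t
    using eq that by (auto simp: c_def k_def)
  have s': "s' i < s' (Suc i) \<and> C1_curve \<A> (s' i) (s' (Suc i)) c" if "i < Suc n" for i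
  proof (cases "i = n")
    case True
    then show ?thesis using s b' C1_curve_cong[OF c2'(1) cc2] by (simp add: s'_def)
  next
    case False
    then have i: "i < n" using that by simp
    then show ?thesis using s(3)[OF i] C1_curve_cong[OF _ cc1[OF i]] by (simp add: s'_def)
  qed
  have "piecewise_C1_curve \<A> a b' c"
    unfolding piecewise_C1_curve_def
  proof (intro conjI exI[of _ "Suc n"] exI[of _ s'] allI impI)
    show "a < b'" using ab b' by simp
    show "s' 0 = a" "s' (Suc n) = b'" using s by (auto simp: s'_def)
  qed (use s' in blast)+
  then have "dM (c a) (c b') \<le> ennreal (len a b' c)" by (rule dM_le)
  moreover have "len a b' c = (\<Sum>i<Suc n. len (s' i) (s' (Suc i)) c)"
    using len_pieces[of "Suc n" s' c, OF s'] s by (simp add: s'_def)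
  moreover have "(\<Sum>i<n. len (s' i) (s' (Suc i)) c) = (\<Sum>i<n. len (s i) (s (Suc i)) c1)"
    using len_cong[OF cc1] by (intro sum.cong) (auto simp: s'_def)
  moreover have "\<dots> = len a b c1" using len_pieces[of n s c1, OF s(3)] s by simp
  moreover have "len (s' n) (s' (Suc n)) c = len a2 b2 c2"
    using len_cong[OF cc2] c2'(2) s by (simp add: s'_def)
  moreover have "c a = c1 a" "c b' = c2 b2" using ab b' by (auto simp: c_def k_def b'_def)
  ultimately show ?thesis by simp
qed

lemma dM_append:
  assumes c: "C1_curve \<A> a b c" "a < b"
  shows "dM q (c b) \<le> dM q (c a) + ennreal (len a b c)"
proof -
  have "dM q (c b) - ennreal (len a b c) \<le> dM q (c a)"
    unfolding finsler_dist_def[of _ _ q "c a"]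
  proof (rule Inf_greatest, safe)
    fix a1 b1 c1 assume c1: "piecewise_C1_curve \<A> a1 b1 c1" "c1 b1 = c a" "q = c1 a1"
    have "dM (c1 a1) (c b) \<le> ennreal (len a1 b1 c1) + ennreal (len a b c)"
      using piecewise_append[OF c1(1) c c1(2)] len_nonneg[OF c] piecewise_len_nonneg[OF c1(1)] by simp
    then show "dM (c1 a1) (c b) - ennreal (len a b c) \<le> ennreal (len a1 b1 c1)"
      by (simp add: ennreal_minus_le_iff add.commute)
  qed
  then show ?thesis by (simp add: ennreal_minus_le_iff add.commute)
qed

lemma dM_append_reverse:
  assumes c: "C1_curve \<A> a b c" "a < b"
  shows "dM q (c a) \<le> dM q (c b) + ennreal (len a b c)"
proof -
  have "(\<lambda>t. (-1) * t + 0) ` {-b..-a} = {a..b}" by simp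
  from curve_reparam[OF c _ _ this] c(2)
  have "C1_curve \<A> (-b) (-a) (\<lambda>t. c (- t))" "len (-b) (-a) (\<lambda>t. c (- t)) = len a b c" by auto
  with dM_append[of "-b" "-a" "\<lambda>t. c (- t)" q] c(2) show ?thesis by simp
qed

text \<open>Truncation at \<open>m\<close> makes the distance from \<open>q\<close> real-valued on
  every component; the Lipschitz bound comes from appending the curve or its reversal.\<close>

lemma curve_lip_dM: "curve_lip 1 UNIV (\<lambda>x. enn2real (min (ennreal m) (dM q x)))"
  unfolding curve_lip_def
proof (intro allI impI)
  fix a b c assume *: "a < b" "C1_curve \<A> a b c"
  have l: "0 \<le> len a b c" using len_nonneg * by blast
  have "enn2real (min (ennreal m) x) \<le> enn2real (min (ennreal m) y) + len a b c"
    if "x \<le> y + ennreal (len a b c)" for x y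
  proof -
    have "min (ennreal m) x \<le> min (ennreal m) y + ennreal (len a b c)"
      using that by (auto simp: min_def not_le add_increasing2 intro: order_trans)
    moreover have "min (ennreal m) y + ennreal (len a b c) < top"
      by (simp add: min_less_iff_disj)
    ultimately have "enn2real (min (ennreal m) x) \<le> enn2real (min (ennreal m) y + ennreal (len a b c))"
      by (rule enn2real_mono)
    also have "\<dots> = enn2real (min (ennreal m) y) + len a b c"
      using l by (subst enn2real_plus) (auto simp: min_less_iff_disj)
    finally show ?thesis .
  qed
  from this[OF dM_append[OF *(2,1), of q]] this[OF dM_append_reverse[OF *(2,1), of q]]
  show "\<bar>enn2real (min (ennreal m) (dM q (c b))) - enn2real (min (ennreal m) (dM q (c a)))\<bar> \<le> 1 * len a b c"
    by (simp add: abs_le_iff)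
qed

text \<open>Instead of joining two piecewise curves, \<open>curve_lip_imp_lipschitz\<close> is
  applied to the truncated distance from \<open>q\<close>. Symmetry is not yet available, so both
  bounds keep the same \<open>dM x y\<close>; the second one with \<open>q\<close> equal to
  \<open>y\<close> then yields symmetry.\<close>

lemma dM_triangle_aux: "dM q y \<le> dM q x + dM x y" "dM q x \<le> dM q y + dM x y"
proof -
  have *: "u \<le> v + dM x y"
    if "dM x y \<noteq> top" "\<And>m. 0 \<le> m \<Longrightarrow> \<bar>enn2real (min (ennreal m) u) - enn2real (min (ennreal m) v)\<bar> \<le> enn2real (dM x y)" for u v
  proof (cases "v = top")
    case False
    \<comment> \<open>\<open>l\<close> exceeds \<open>v\<close> plus the distance of
      \<open>x\<close> and \<open>y\<close>, so the truncation of \<open>u\<close> at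
      \<open>l\<close> is not active.\<close>
    define l where "l = enn2real v + enn2real (dM x y) + 1"
    have l0: "0 \<le> l" unfolding l_def by (intro add_nonneg_nonneg) auto
    have vl: "v \<le> ennreal l" using False unfolding l_def
      by (metis add.assoc add_increasing2 enn2real_nonneg ennreal_enn2real ennreal_leI less_top order_refl zero_le_one add_nonneg_nonneg)
    then have "enn2real (min (ennreal l) u) \<le> enn2real v + enn2real (dM x y)"
      using that(2)[OF l0] by (simp add: min_absorb2)
    then have "enn2real (min (ennreal l) u) < l" unfolding l_def by simp
    then have u: "u < ennreal l" using l0 by (metis enn2real_ennreal min.absorb1 not_le order_less_irrefl)
    then have "enn2real u \<le> enn2real v + enn2real (dM x y)"
      using \<open>enn2real (min (ennreal l) u) \<le> enn2real v + enn2real (dM x y)\<close> by (simp add: min_absorb2)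
    then have "ennreal (enn2real u) \<le> ennreal (enn2real v) + ennreal (enn2real (dM x y))"
      by (metis enn2real_nonneg ennreal_leI ennreal_plus)
    moreover have "ennreal (enn2real u) = u" using u ennreal_less_top order.strict_trans ennreal_enn2real by metis
    ultimately show ?thesis using False that(1) by (simp add: less_top)
  qed simp
  have **: "\<bar>enn2real (min (ennreal m) (dM q x)) - enn2real (min (ennreal m) (dM q y))\<bar> \<le> enn2real (dM x y)"
    if "dM x y \<noteq> top" for m
    using curve_lip_imp_lipschitz[OF curve_lip_dM[of m q] _ that] that
    by (cases "dM x y") auto
  show "dM q y \<le> dM q x + dM x y" "dM q x \<le> dM q y + dM x y"
    using *[of "dM q y" "dM q x"] *[of "dM q x" "dM q y"] ** by (cases "dM x y = top"; force simp: abs_minus_commute)+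
qed

lemma dM_commute: "dM x y = dM y x"
  using dM_triangle_aux(2)[of y x y] dM_triangle_aux(2)[of x y x] by (simp add: dM_self antisym)

lemma dM_triangle: "dM x z \<le> dM x y + dM y z"
  by (rule dM_triangle_aux(1))

lemma curve_lip_extension:
  assumes "0 \<le> L" "\<And>p q. p \<in> N \<Longrightarrow> q \<in> N \<Longrightarrow> dM p q \<noteq> top \<Longrightarrow> ennreal \<bar>f p - f q\<bar> \<le> ennreal L * dM p q"
  shows "\<exists>F. (\<forall>p\<in>N. F p = f p) \<and> curve_lip L UNIV F"
  using McShane_extension[of dM L N f, OF dM_self dM_commute dM_triangle assms] lipschitz_imp_curve_lip assms(1)
  by blast

end

section \<open>Smooth functions on open subsets of a manifold\<close>

text \<open>Refine the cover by \<open>U\<close> and all open sets whose closure misses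
  \<open>p\<close>. The members of the refinement not contained in \<open>U\<close> have closures
  missing \<open>p\<close>, and by local finiteness the union of these closures is closed; its
  complement is the desired neighbourhood.\<close>

lemma paracompact_regular:
  fixes p :: "'m::t2_space"
  assumes para: "paracompact_space (euclidean :: 'm topology)" and U: "open U" "p \<in> U"
  shows "\<exists>W. open W \<and> p \<in> W \<and> closure W \<subseteq> U"
proof -
  define \<U> where "\<U> = insert U {V. open V \<and> p \<notin> closure V}"
  have "\<Union>\<U> = UNIV"
  proof -
    have "\<exists>V\<in>\<U>. q \<in> V" for q
    proof (cases "q = p")
      case False
      then obtain V O' where *: "open V" "open O'" "q \<in> V" "p \<in> O'" "V \<inter> O' = {}"
        using hausdorff[OF False] by blast
      then have "p \<notin> closure V" using open_Int_closure_eq_empty[OF *(2), of V] by blast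
      then have "V \<in> \<U>" unfolding \<U>_def using *(1) by simp
      then show ?thesis using *(3) by blast
    qed (use U in \<open>auto simp: \<U>_def\<close>)
    then show ?thesis by blast
  qed
  moreover have "\<forall>V\<in>\<U>. open V" using U unfolding \<U>_def by auto
  ultimately obtain \<V> where \<V>: "\<forall>V\<in>\<V>. open V" "\<Union>\<V> = UNIV" "\<forall>V\<in>\<V>. \<exists>V'\<in>\<U>. V \<subseteq> V'"
    and fin: "locally_finite_in euclidean \<V>"
    using para[unfolded paracompact_space_def, rule_format, of \<U>] by auto
  define \<V>' where "\<V>' = {V\<in>\<V>. \<not> V \<subseteq> U}"
  define C where "C = \<Union>(closure ` \<V>')"
  have "closedin euclidean (\<Union>((\<lambda>S. euclidean closure_of S) ` \<V>'))"
    by (intro closedin_Union_locally_finite_closure locally_finite_in_subset[OF fin]) (auto simp: \<V>'_def)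
  then have "closed C" unfolding C_def by simp
  moreover have "p \<notin> C"
  proof -
    have "p \<notin> closure V" if "V \<in> \<V>'" for V
    proof -
      have V: "V \<in> \<V>" "\<not> V \<subseteq> U" using that unfolding \<V>'_def by auto
      then obtain V' where V': "V' \<in> \<U>" "V \<subseteq> V'" using \<V>(3) by blast
      then have "p \<notin> closure V'" using V(2) unfolding \<U>_def by blast
      with V'(2) show ?thesis using closure_mono by blast
    qed
    then show ?thesis unfolding C_def by blast
  qed
  moreover have "closure (- C) \<subseteq> U"
  proof
    fix q assume q: "q \<in> closure (- C)"
    show "q \<in> U"
    proof (rule ccontr)
      assume qU: "q \<notin> U"
      have "q \<in> \<Union>\<V>" using \<V>(2) by simp
      then obtain V where V: "V \<in> \<V>" "q \<in> V" by (elim UnionE)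
      then have "V \<in> \<V>'" using qU unfolding \<V>'_def by (simp add: subset_iff) (rule exI[of _ q], simp)
      then have "closure V \<subseteq> C" unfolding C_def by (rule UN_upper)
      then have "V \<inter> - C = {}" using closure_subset[of V] by (simp add: disjoint_eq_subset_Compl)
      then have "V \<inter> closure (- C) = {}" using open_Int_closure_eq_empty[of V "- C"] \<V>(1) V(1) by blast
      then show False using V(2) q by blast
    qed
  qed
  ultimately show ?thesis by (intro exI[of _ "- C"]) auto
qed

context weak_uniform_manifold
begin

definition smooth_on :: "'m set \<Rightarrow> ('m \<Rightarrow> real) \<Rightarrow> bool" where
  "smooth_on U g \<longleftrightarrow> (\<forall>V \<psi>. (V, \<psi>) \<in> \<A> \<longrightarrow> C1_on (\<psi> ` (V \<inter> U)) (g \<circ> inv_into V \<psi>))"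

lemma smooth_on_UNIV: "smooth_on UNIV g \<longleftrightarrow> C1_function \<A> g"
  unfolding smooth_on_def C1_function_def by auto

lemma smooth_on_subset: "smooth_on U g \<Longrightarrow> W \<subseteq> U \<Longrightarrow> smooth_on W g"
  unfolding smooth_on_def by (meson C1_on_subset Int_mono image_mono order_refl)

lemma smooth_on_local:
  assumes "\<And>x. x \<in> U \<Longrightarrow> \<exists>W. open W \<and> x \<in> W \<and> smooth_on W g"
  shows "smooth_on U g"
  unfolding smooth_on_def
proof (intro allI impI C1_on_local)
  fix V \<psi> y assume V: "(V, \<psi>) \<in> \<A>" and "y \<in> \<psi> ` (V \<inter> U)"
  then obtain x where x: "x \<in> V" "x \<in> U" "y = \<psi> x" by blast
  then obtain W where W: "open W" "x \<in> W" "smooth_on W g" using assms by blast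
  then have "open (\<psi> ` (V \<inter> W))" using open_chart_image[OF V] chartD(1)[OF V] by (simp add: open_Int)
  moreover have "C1_on (\<psi> ` (V \<inter> W)) (g \<circ> inv_into V \<psi>)" using W(3) V unfolding smooth_on_def by blast
  ultimately show "\<exists>T. open T \<and> y \<in> T \<and> C1_on T (g \<circ> inv_into V \<psi>)" using W x by blast
qed

lemma smooth_on_cong:
  assumes "smooth_on U g" "open U" "\<And>x. x \<in> U \<Longrightarrow> g x = g' x"
  shows "smooth_on U g'"
  unfolding smooth_on_def
proof (intro allI impI)
  fix V \<psi> assume V: "(V, \<psi>) \<in> \<A>"
  show "C1_on (\<psi> ` (V \<inter> U)) (g' \<circ> inv_into V \<psi>)"
  proof (rule C1_on_cong)
    show "C1_on (\<psi> ` (V \<inter> U)) (g \<circ> inv_into V \<psi>)" using assms(1) V unfolding smooth_on_def by blast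
    show "open (\<psi> ` (V \<inter> U))" using open_chart_image[OF V] chartD(1)[OF V] assms(2) by (simp add: open_Int)
  qed (use inv_chart[OF V] assms(3) in auto)
qed

lemma smooth_on_const: "smooth_on U (\<lambda>x. k)"
  unfolding smooth_on_def by (simp add: o_def C1_on_const)

lemma smooth_on_add: "smooth_on U g \<Longrightarrow> smooth_on U h \<Longrightarrow> smooth_on U (\<lambda>x. g x + h x)"
  using C1_on_add unfolding smooth_on_def comp_def by fast

lemma smooth_on_diff: "smooth_on U g \<Longrightarrow> smooth_on U h \<Longrightarrow> smooth_on U (\<lambda>x. g x - h x)"
  using C1_on_diff unfolding smooth_on_def comp_def by fast

lemma smooth_on_mult: "smooth_on U g \<Longrightarrow> smooth_on U h \<Longrightarrow> smooth_on U (\<lambda>x. g x * h x)"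
  using C1_on_mult unfolding smooth_on_def comp_def by fast

lemma smooth_on_sum: "finite J \<Longrightarrow> (\<And>i. i \<in> J \<Longrightarrow> smooth_on U (g i)) \<Longrightarrow> smooth_on U (\<lambda>x. \<Sum>i\<in>J. g i x)"
  by (induction J rule: finite_induct) (auto intro: smooth_on_const smooth_on_add)

lemma smooth_on_compose:
  assumes "C1_on UNIV \<tau>" "smooth_on U g"
  shows "smooth_on U (\<lambda>x. \<tau> (g x))"
  using C1_on_compose[OF _ assms(1)] assms(2) unfolding smooth_on_def comp_def by fast

text \<open>Composition with the C1 changes of charts transfers smoothness from one chart to
  all.\<close>

lemma smooth_on_chart:
  assumes U: "(U, \<phi>) \<in> \<A>" and W: "W \<subseteq> U" and g: "C1_on (\<phi> ` W) (g \<circ> inv_into U \<phi>)" and "open W"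
  shows "smooth_on W g"
  unfolding smooth_on_def
proof (intro allI impI)
  fix V \<psi> assume V: "(V, \<psi>) \<in> \<A>"
  have "C1_on (\<psi> ` (V \<inter> W)) ((g \<circ> inv_into U \<phi>) \<circ> (\<phi> \<circ> inv_into V \<psi>))"
  proof (rule C1_on_compose[OF _ g])
    show "C1_on (\<psi> ` (V \<inter> W)) (\<phi> \<circ> inv_into V \<psi>)"
      using transition[OF V U] W by (auto elim!: C1_on_subset)
  qed (use inv_chart[OF V] in auto)
  then show "C1_on (\<psi> ` (V \<inter> W)) (g \<circ> inv_into V \<psi>)"
  proof (rule C1_on_cong)
    show "open (\<psi> ` (V \<inter> W))" using open_chart_image[OF V] chartD(1)[OF V] assms(4) by (simp add: open_Int)
  qed (use inv_chart[OF V] inv_chart[OF U] W in auto)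
qed

section \<open>Charts compare the Finsler metric with a norm\<close>

text \<open>The half ball has to be closed in \<open>M\<close>, not only in \<open>U\<close>, so
  that functions supported in it extend by 0. In infinite dimensions this is not automatic, as
  closed balls are not compact. The last clause allows the fixed norm at \<open>p\<close> to replace
  the varying tangent norms.\<close>

definition good_radius :: "'m set \<Rightarrow> ('m \<Rightarrow> 'x) \<Rightarrow> 'm \<Rightarrow> real \<Rightarrow> bool" where
  "good_radius U \<phi> p r \<longleftrightarrow> 0 < r \<and> (\<forall>y. cnorm U \<phi> p (y - \<phi> p) < r \<longrightarrow> y \<in> \<phi> ` U) \<and>
    closed {x\<in>U. cnorm U \<phi> p (\<phi> x - \<phi> p) \<le> r / 2} \<and>
    (\<forall>x\<in>U. cnorm U \<phi> p (\<phi> x - \<phi> p) < r \<longrightarrow>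
      (\<forall>v. cnorm U \<phi> p v \<le> 2 * K * cnorm U \<phi> x v \<and> cnorm U \<phi> x v \<le> 2 * K * cnorm U \<phi> p v))"

definition cdom :: "'m set \<Rightarrow> ('m \<Rightarrow> 'x) \<Rightarrow> 'm \<Rightarrow> real \<Rightarrow> 'm set" where
  "cdom U \<phi> p r = {x\<in>U. cnorm U \<phi> p (\<phi> x - \<phi> p) < r}"

lemma good_radiusD:
  assumes "good_radius U \<phi> p r" "x \<in> cdom U \<phi> p r"
  shows "cnorm U \<phi> p v \<le> 2 * K * cnorm U \<phi> x v" "cnorm U \<phi> x v \<le> 2 * K * cnorm U \<phi> p v"
  using assms unfolding good_radius_def cdom_def by blast+

lemma continuous_on_equivalent_norm:
  assumes "equivalent_norm \<nu>"
  shows "continuous_on S (\<lambda>y. \<nu> (y - z))"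
proof -
  obtain b where b: "b > 0" "\<And>v. \<nu> v \<le> b * norm v" and \<nu>: "is_norm \<nu>"
    using assms unfolding equivalent_norm_def by blast
  have "dist (\<nu> (x - z)) (\<nu> (y - z)) \<le> b * dist x y" for x y
    using is_normD(8)[OF \<nu>, of x z y] is_normD(8)[OF \<nu>, of y z x] is_normD(7)[OF \<nu>, of x y] b(2)[of "x - y"]
    unfolding dist_real_def dist_norm by (simp add: abs_le_iff)
  then show ?thesis
    using b(1) by (intro continuous_onI) (metis (no_types, lifting) dist_commute mult.commute mult_imp_le_div_pos order.refl order_le_less_trans divide_pos_pos less_eq_real_def pos_less_divide_eq)
qed

lemma open_cdom:
  assumes "(U, \<phi>) \<in> \<A>" "p \<in> U"
  shows "open (cdom U \<phi> p r)"
proof -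
  have "open {y. cnorm U \<phi> p (y - \<phi> p) < r}"
    using continuous_on_equivalent_norm[OF cnorm_equivalent[OF assms]] by (intro open_Collect_less continuous_intros)
  from open_chart_vimage[OF assms(1) this] show ?thesis unfolding cdom_def by simp
qed

lemma cnorm_is_norm: "(U, \<phi>) \<in> \<A> \<Longrightarrow> p \<in> U \<Longrightarrow> is_norm (cnorm U \<phi> p)"
  using cnorm_equivalent unfolding equivalent_norm_def by blast

lemma center_in_cdom: "(U, \<phi>) \<in> \<A> \<Longrightarrow> p \<in> U \<Longrightarrow> 0 < r \<Longrightarrow> p \<in> cdom U \<phi> p r"
  unfolding cdom_def using is_normD(2)[OF cnorm_is_norm] by simp

lemma cdom_image:
  assumes "(U, \<phi>) \<in> \<A>" "good_radius U \<phi> p r"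
  shows "\<phi> ` cdom U \<phi> p r = {y. cnorm U \<phi> p (y - \<phi> p) < r}"
  using assms(2) unfolding good_radius_def cdom_def by blast

lemma cnorm_ball:
  assumes U: "(U, \<phi>) \<in> \<A>" "p \<in> U" and S: "open S" "\<phi> p \<in> S"
  shows "\<exists>\<rho>>0. \<forall>y. cnorm U \<phi> p (y - \<phi> p) < \<rho> \<longrightarrow> y \<in> S"
proof -
  obtain e where e: "e > 0" "ball (\<phi> p) e \<subseteq> S" using S by (metis openE)
  obtain a where a: "a > 0" "\<And>v. a * norm v \<le> cnorm U \<phi> p v"
    using cnorm_equivalent[OF U] unfolding equivalent_norm_def by blast
  have "y \<in> S" if "cnorm U \<phi> p (y - \<phi> p) < a * e" for y
  proof -
    have "a * norm (y - \<phi> p) < a * e" using a(2)[of "y - \<phi> p"] that by simp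
    then have "y \<in> ball (\<phi> p) e" using a(1) by (simp add: dist_norm norm_minus_commute)
    then show ?thesis using e by blast
  qed
  then show ?thesis using a e by (intro exI[of _ "a * e"]) auto
qed

lemma good_radius_ex:
  assumes U: "(U, \<phi>) \<in> \<A>" "p \<in> U"
  shows "\<exists>\<rho>>0. \<forall>r. 0 < r \<and> r \<le> \<rho> \<longrightarrow> good_radius U \<phi> p r"
proof -
  let ?\<nu> = "cnorm U \<phi> p"
  obtain W where W: "open W" "p \<in> W" "W \<subseteq> U"
    "\<And>x v. x \<in> W \<Longrightarrow> ?\<nu> v \<le> 2 * K * cnorm U \<phi> x v \<and> cnorm U \<phi> x v \<le> 2 * K * ?\<nu> v"
    using cnorm_comparison[OF U] by metis
  obtain W1 where W1: "open W1" "p \<in> W1" "closure W1 \<subseteq> W"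
    using paracompact_regular[OF paracompact W(1,2)] by blast
  have W1U: "W1 \<subseteq> W" "W1 \<subseteq> U" using W1 W closure_subset by blast+
  obtain \<rho> where \<rho>: "\<rho> > 0" "\<And>y. ?\<nu> (y - \<phi> p) < \<rho> \<Longrightarrow> y \<in> \<phi> ` W1"
    using cnorm_ball[OF U open_chart_image[OF U(1) W1(1) W1U(2)]] W1(2) by blast
  have in_W1: "x \<in> W1" if "x \<in> U" "?\<nu> (\<phi> x - \<phi> p) < \<rho>" for x
    using \<rho>(2)[OF that(2)] that(1) W1U(2) chartD(3)[OF U(1)] by (auto simp: inj_on_def)
  have "good_radius U \<phi> p r" if r: "0 < r" "r \<le> \<rho>" for r
    unfolding good_radius_def
  proof (intro conjI allI impI ballI)
    show "y \<in> \<phi> ` U" if "?\<nu> (y - \<phi> p) < r" for y using \<rho>(2)[of y] that r W1U(2) by auto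
    let ?C = "{x\<in>U. ?\<nu> (\<phi> x - \<phi> p) \<le> r / 2}"
    let ?E = "{y. r / 2 < ?\<nu> (y - \<phi> p)}"
    have "open ?E" using continuous_on_equivalent_norm[OF cnorm_equivalent[OF U]]
      by (intro open_Collect_less continuous_intros)
    then have "open (- closure W1 \<union> {x\<in>U. \<phi> x \<in> ?E})"
      by (intro open_Un open_chart_vimage U) (auto simp: open_Compl)
    moreover have "?C \<subseteq> W1" using in_W1 r by auto
    \<comment> \<open>Uses that \<open>closure W1\<close> lies in \<open>U\<close>: a point outside
      \<open>U\<close> is already outside \<open>closure W1\<close>.\<close>
    then have "- ?C = - closure W1 \<union> {x\<in>U. \<phi> x \<in> ?E}"
      using W1(3) W(3) closure_subset[of W1] by (auto simp: not_le)
    ultimately show "closed ?C" by (metis closed_def)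
    show "?\<nu> v \<le> 2 * K * cnorm U \<phi> x v" "cnorm U \<phi> x v \<le> 2 * K * ?\<nu> v"
      if "x \<in> U" "?\<nu> (\<phi> x - \<phi> p) < r" for x v
      using W(4)[of x v] in_W1[of x] that r W1U by auto
  qed (use r in auto)
  then show ?thesis using \<rho>(1) by blast
qed

text \<open>The increment of \<open>\<phi> \<circ> c\<close> is at most the integral of the norm of
  its derivative, which is at most \<open>2 * K\<close> times the speed. The norming functional of
  the increment makes this a comparison of real integrals.\<close>

lemma curve_lip_of_chart:
  assumes U: "(U, \<phi>) \<in> \<A>" "p \<in> U" and r: "good_radius U \<phi> p r" and L: "0 \<le> L"
    and g: "\<And>x y. x \<in> cdom U \<phi> p r \<Longrightarrow> y \<in> cdom U \<phi> p r \<Longrightarrow> \<bar>g x - g y\<bar> \<le> L * cnorm U \<phi> p (\<phi> x - \<phi> y)"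
  shows "curve_lip (2 * K * L) (cdom U \<phi> p r) g"
  unfolding curve_lip_def
proof (intro allI impI)
  fix a b c assume *: "a < b" "C1_curve \<A> a b c" "c ` {a..b} \<subseteq> cdom U \<phi> p r"
  let ?\<nu> = "cnorm U \<phi> p"
  let ?D = "\<lambda>t. vector_derivative (\<phi> \<circ> c) (at t within {a..b})"
  have cU: "c t \<in> cdom U \<phi> p r" "c t \<in> U" if "t \<in> {a..b}" for t
  proof -
    show "c t \<in> cdom U \<phi> p r" using *(3) that by blast
    then show "c t \<in> U" unfolding cdom_def by blast
  qed
  have \<nu>: "is_norm ?\<nu>" using cnorm_is_norm[OF U] .
  obtain T where T: "linear T" "T (\<phi> (c b) - \<phi> (c a)) = ?\<nu> (\<phi> (c b) - \<phi> (c a))" "\<And>v. \<bar>T v\<bar> \<le> ?\<nu> v"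
    using norming_functional[OF \<nu>] by metis
  obtain B where B: "\<And>v. ?\<nu> v \<le> B * norm v"
    using cnorm_equivalent[OF U] unfolding equivalent_norm_def by blast
  have bT: "bounded_linear T"
    using T(1,3) B by (intro bounded_linear_intro[where K=B]) (auto simp: linear_add linear_scale mult.commute intro: order_trans)
  have "((\<lambda>t. T (?D t)) has_integral (T (\<phi> (c b)) - T (\<phi> (c a)))) {a..b}"
  proof (rule fundamental_theorem_of_calculus)
    fix t assume t: "t \<in> {a..b}"
    have "((\<phi> \<circ> c) has_vector_derivative ?D t) (at t within {a..b})"
      using has_vector_derivative_chart[OF *(2,1) t U(1) cU(2)[OF t]] .
    from bounded_linear.has_vector_derivative[OF bT this]
    show "((\<lambda>t. T (\<phi> (c t))) has_vector_derivative T (?D t)) (at t within {a..b})" by (simp add: o_def)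
  qed (use * in simp)
  moreover have "((\<lambda>t. 2 * K * speed a b c t) has_integral 2 * K * len a b c) {a..b}"
    unfolding curve_length_def using integrable_integral[OF integrable_nrm_velocity[OF *(2,1)]] by (rule has_integral_mult_right)
  moreover have "T (?D t) \<le> 2 * K * speed a b c t" if t: "t \<in> {a..b}" for t
  proof -
    have "T (?D t) \<le> ?\<nu> (?D t)" using T(3) abs_le_D1 by blast
    also have "\<dots> \<le> 2 * K * cnorm U \<phi> (c t) (?D t)"
      using good_radiusD(1)[OF r cU(1)[OF t]] .
    finally show ?thesis unfolding nrm_velocity[OF *(2,1) t U(1) cU(2)[OF t]] .
  qed
  ultimately have "T (\<phi> (c b)) - T (\<phi> (c a)) \<le> 2 * K * len a b c" by (rule has_integral_le)
  then have le: "?\<nu> (\<phi> (c b) - \<phi> (c a)) \<le> 2 * K * len a b c" using T(1,2) by (simp add: linear_diff)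
  have "\<bar>g (c b) - g (c a)\<bar> \<le> L * ?\<nu> (\<phi> (c b) - \<phi> (c a))" using g cU(1) * by simp
  also have "\<dots> \<le> L * (2 * K * len a b c)" using le L by (rule mult_left_mono)
  finally show "\<bar>g (c b) - g (c a)\<bar> \<le> 2 * K * L * len a b c" by (simp add: mult_ac)
qed

text \<open>The ball is convex, so the straight segment stays in it; its coordinate velocity is the
  constant vector \<open>y - z\<close>, measured by the norm at the moving point.\<close>

lemma segment_curve:
  assumes U: "(U, \<phi>) \<in> \<A>" "p \<in> U" and r: "good_radius U \<phi> p r"
    and y: "cnorm U \<phi> p (y - \<phi> p) < r" and z: "cnorm U \<phi> p (z - \<phi> p) < r"
  defines "c \<equiv> \<lambda>t. inv_into U \<phi> (z + t *\<^sub>R (y - z))"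
  shows "C1_curve \<A> 0 1 c" "c ` {0..1} \<subseteq> cdom U \<phi> p r" "len 0 1 c \<le> 2 * K * cnorm U \<phi> p (y - z)"
proof -
  let ?\<nu> = "cnorm U \<phi> p"
  let ?s = "\<lambda>t. z + t *\<^sub>R (y - z)"
  have \<nu>: "is_norm ?\<nu>" using cnorm_is_norm[OF U] .
  have s: "?\<nu> (?s t - \<phi> p) < r" if t: "t \<in> {0..1}" for t
  proof -
    have "?s t - \<phi> p = t *\<^sub>R (y - \<phi> p) + (1 - t) *\<^sub>R (z - \<phi> p)" by (simp add: algebra_simps)
    then have "?\<nu> (?s t - \<phi> p) \<le> t * ?\<nu> (y - \<phi> p) + (1 - t) * ?\<nu> (z - \<phi> p)"
      using is_normD(4)[OF \<nu>, of "t *\<^sub>R (y - \<phi> p)" "(1 - t) *\<^sub>R (z - \<phi> p)"] is_normD(5)[OF \<nu>] t by simp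
    also have "\<dots> < r"
      using convex_bound_lt[OF y z, of t "1 - t"] t by simp
    finally show ?thesis .
  qed
  have sU: "?s t \<in> \<phi> ` U" if "t \<in> {0..1}" for t using s[OF that] r unfolding good_radius_def by blast
  have c: "c t \<in> U" "\<phi> (c t) = ?s t" if "t \<in> {0..1}" for t
    unfolding c_def using sU[OF that] by (auto intro: inv_into_into f_inv_into_f)
  show img: "c ` {0..1} \<subseteq> cdom U \<phi> p r" unfolding cdom_def using c s by auto
  have sc: "continuous_on T ?s" for T by (intro continuous_intros)
  have der: "((\<psi> \<circ> c) has_vector_derivative trans U \<phi> \<psi> (c t) (y - z)) (at t within {0..1})"
    if t: "t \<in> {0..1}" and V: "(V, \<psi>) \<in> \<A>" "c t \<in> V" for t V \<psi>
  proof -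
    have "(?s has_vector_derivative (y - z)) (at t within {0..1})"
      by (auto intro!: derivative_eq_intros)
    moreover have "((\<psi> \<circ> inv_into U \<phi>) has_derivative trans U \<phi> \<psi> (c t)) (at (?s t) within ?s ` {0..1})"
      using has_derivative_trans[OF U(1) V(1) c(1)[OF t] V(2)] c(2)[OF t] by (simp add: has_derivative_at_withinI)
    ultimately have "((\<psi> \<circ> inv_into U \<phi>) \<circ> ?s has_vector_derivative trans U \<phi> \<psi> (c t) (y - z)) (at t within {0..1})"
      by (rule vector_derivative_diff_chain_within)
    then show ?thesis unfolding c_def by (simp add: o_def)
  qed
  show C: "C1_curve \<A> 0 1 c"
    unfolding C1_curve_def
  proof (intro conjI ballI)
    show "continuous_on {0..1} c"
      unfolding c_def by (rule continuous_on_compose2[OF chartD(5)[OF U(1)] sc]) (use sU in auto)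
    fix w assume "w \<in> \<A>"
    then obtain V \<psi> where w: "w = (V, \<psi>)" and V: "(V, \<psi>) \<in> \<A>" by (metis surj_pair)
    obtain D where D: "continuous_on (\<phi> ` (U \<inter> V)) D"
      "\<And>y. y \<in> \<phi> ` (U \<inter> V) \<Longrightarrow> ((\<psi> \<circ> inv_into U \<phi>) has_derivative blinfun_apply (D y)) (at y)"
      using transition[OF U(1) V] unfolding C1_on_def by blast
    have in_UV: "?s t \<in> \<phi> ` (U \<inter> V)" if "t \<in> {0..1}" "c t \<in> V" for t
      using c[OF that(1)] that(2) by (intro image_eqI[of _ _ "c t"]) auto
    have "trans U \<phi> \<psi> (c t) (y - z) = blinfun_apply (D (?s t)) (y - z)" if t: "t \<in> {0..1}" "c t \<in> V" for t
      using has_derivative_unique[OF has_derivative_trans[OF U(1) V c(1)[OF t(1)] t(2), unfolded c(2)[OF t(1)]] D(2)[OF in_UV[OF t]]]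
      by simp
    moreover have "continuous_on {t\<in>{0..1}. c t \<in> V} (\<lambda>t. blinfun_apply (D (?s t)) (y - z))"
      by (intro continuous_on_compose2[OF D(1) sc] blinfun.continuous_on continuous_intros) (use in_UV in auto)
    ultimately have "continuous_on {t\<in>{0..1}. c t \<in> V} (\<lambda>t. trans U \<phi> \<psi> (c t) (y - z))"
      using continuous_on_eq by (metis (mono_tags, lifting) mem_Collect_eq)
    then show "case w of (V, \<psi>) \<Rightarrow> \<exists>D. continuous_on {t\<in>{0..1}. c t \<in> V} D \<and>
        (\<forall>t\<in>{0..1}. c t \<in> V \<longrightarrow> ((\<psi> \<circ> c) has_vector_derivative D t) (at t within {0..1}))"
      using w der V by auto
  qed
  have "speed 0 1 c t \<le> 2 * K * ?\<nu> (y - z)" if t: "t \<in> {0..1}" for t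
  proof -
    have "vector_derivative (\<phi> \<circ> c) (at t within {0..1}) = y - z"
      using vector_derivative_within_cbox[of 0 1 t "\<phi> \<circ> c"] der[OF t U(1) c(1)[OF t]] t trans_self[OF U(1) c(1)[OF t]]
      by (metis box_real(2) zero_less_one)
    then have "speed 0 1 c t = cnorm U \<phi> (c t) (y - z)"
      using nrm_velocity[OF C _ t U(1) c(1)[OF t]] by simp
    then show ?thesis using good_radiusD(2)[OF r, of "c t" "y - z"] img t by (simp add: image_subset_iff)
  qed
  then have "len 0 1 c \<le> integral {0..1} (\<lambda>t::real. 2 * K * ?\<nu> (y - z))"
    unfolding curve_length_def using integrable_nrm_velocity[OF C] by (intro integral_le) auto
  then show "len 0 1 c \<le> 2 * K * ?\<nu> (y - z)" by simp
qed

text \<open>Test along the straight segment. With \<open>curve_lip_of_chart\<close>, Lipschitz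
  constants along curves and in the chart agree up to a factor \<open>2 * K\<close> in each
  direction.\<close>

lemma chart_lip_of_curve_lip:
  assumes U: "(U, \<phi>) \<in> \<A>" "p \<in> U" and r: "good_radius U \<phi> p r" and L: "0 \<le> L"
    and g: "curve_lip L (cdom U \<phi> p r) g" and xy: "x \<in> cdom U \<phi> p r" "y \<in> cdom U \<phi> p r"
  shows "\<bar>g x - g y\<bar> \<le> 2 * K * L * cnorm U \<phi> p (\<phi> x - \<phi> y)"
proof -
  have *: "cnorm U \<phi> p (\<phi> x - \<phi> p) < r" "cnorm U \<phi> p (\<phi> y - \<phi> p) < r" "x \<in> U" "y \<in> U"
    using xy unfolding cdom_def by auto
  let ?c = "\<lambda>t. inv_into U \<phi> (\<phi> y + t *\<^sub>R (\<phi> x - \<phi> y))"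
  note c = segment_curve[OF U r *(1,2)]
  have "\<bar>g (?c 1) - g (?c 0)\<bar> \<le> L * len 0 1 ?c" using curve_lipD[OF g _ c(1,2)] by simp
  also have "\<dots> \<le> L * (2 * K * cnorm U \<phi> p (\<phi> x - \<phi> y))" using c(3) L by (rule mult_left_mono)
  finally show ?thesis using inv_chart[OF U(1)] * by (simp add: mult_ac)
qed

section \<open>Equicontinuity and Lipschitz bump functions\<close>

text \<open>A chart ball of radius at most \<open>e / (2 * K)\<close> serves all \<open>g\<close> at
  once. This uniformity later controls an infinite family of bumps near one point.\<close>

lemma curve_lip_equicontinuous:
  assumes "0 < e"
  shows "\<exists>W. open W \<and> x \<in> W \<and> (\<forall>g. curve_lip 1 UNIV g \<longrightarrow> (\<forall>y\<in>W. \<bar>g y - g x\<bar> < e))"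
proof -
  obtain U \<phi> where U: "(U, \<phi>) \<in> \<A>" "x \<in> U" using chart_ex by blast
  obtain \<rho> where \<rho>: "\<rho> > 0" "\<And>r. 0 < r \<Longrightarrow> r \<le> \<rho> \<Longrightarrow> good_radius U \<phi> x r" using good_radius_ex[OF U] by blast
  define r where "r = min \<rho> (e / (2 * K))"
  have r: "0 < r" "r \<le> e / (2 * K)" "good_radius U \<phi> x r" using \<rho> assms K unfolding r_def by auto
  have "\<bar>g y - g x\<bar> < e" if g: "curve_lip 1 UNIV g" and y: "y \<in> cdom U \<phi> x r" for g y
  proof -
    have "\<bar>g y - g x\<bar> \<le> 2 * K * 1 * cnorm U \<phi> x (\<phi> y - \<phi> x)"
      by (rule chart_lip_of_curve_lip[OF U r(3) _ curve_lip_mono[OF g] y center_in_cdom[OF U r(1)]]) auto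
    also have "\<dots> < 2 * K * r" using y K unfolding cdom_def by simp
    also have "\<dots> \<le> e" using r(2) K by (simp add: field_simps)
    finally show ?thesis .
  qed
  then show ?thesis using open_cdom[OF U] center_in_cdom[OF U r(1)] by blast
qed

lemma curve_lip_open_less:
  assumes "curve_lip 1 UNIV g"
  shows "open {x. g x < k}" "open {x. k < g x}"
proof -
  have "\<exists>W. open W \<and> x \<in> W \<and> W \<subseteq> {x. g x < k}" if x: "g x < k" for x
  proof -
    obtain W where W: "open W" "x \<in> W" "\<forall>y\<in>W. \<bar>g y - g x\<bar> < k - g x"
      using curve_lip_equicontinuous[of "k - g x" x] x assms by auto
    then have "W \<subseteq> {x. g x < k}" by (auto simp: abs_less_iff)
    then show ?thesis using W by blast
  qed
  then show "open {x. g x < k}" by (subst open_subopen) simp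
  have "\<exists>W. open W \<and> x \<in> W \<and> W \<subseteq> {x. k < g x}" if x: "k < g x" for x
  proof -
    obtain W where W: "open W" "x \<in> W" "\<forall>y\<in>W. \<bar>g y - g x\<bar> < g x - k"
      using curve_lip_equicontinuous[of "g x - k" x] x assms by auto
    then have "W \<subseteq> {x. k < g x}" by (auto simp: abs_less_iff)
    then show ?thesis using W by blast
  qed
  then show "open {x. k < g x}" by (subst open_subopen) simp
qed

text \<open>The chart domain and the complement of the closed half ball are open and cover
  \<open>M\<close>. The function is Lipschitz on the first and zero on the second, so
  \<open>curve_lip_local\<close> joins the estimates.\<close>

lemma curve_lip_bump:
  assumes U: "(U, \<phi>) \<in> \<A>" "p \<in> U" and r: "good_radius U \<phi> p r"
  shows "\<exists>u. curve_lip 1 UNIV u \<and> (\<forall>x. 0 \<le> u x \<and> u x \<le> 1) \<and> 0 < u p \<and> (\<forall>x. 0 < u x \<longrightarrow> x \<in> cdom U \<phi> p r)"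
proof -
  let ?\<nu> = "cnorm U \<phi> p"
  have \<nu>: "is_norm ?\<nu>" using cnorm_is_norm[OF U] .
  have r0: "0 < r" using r unfolding good_radius_def by blast
  \<comment> \<open>Division by \<open>2 * K\<close> pays for the passage from the chart norm to
    curves, so that the constant becomes 1.\<close>
  define w where "w x = min 1 (max 0 (r / 2 - ?\<nu> (\<phi> x - \<phi> p)) / (2 * K))" for x
  define u where "u x = (if x \<in> cdom U \<phi> p r then w x else 0)" for x
  have clip: "\<bar>min 1 (max 0 s / (2 * K)) - min 1 (max 0 t / (2 * K))\<bar> \<le> \<bar>s - t\<bar> / (2 * K)" for s t
  proof -
    have "\<bar>min 1 (max 0 s / (2 * K)) - min 1 (max 0 t / (2 * K))\<bar> \<le> \<bar>max 0 s / (2 * K) - max 0 t / (2 * K)\<bar>"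
      by linarith
    also have "\<dots> = \<bar>max 0 s - max 0 t\<bar> / (2 * K)" using K by (simp flip: diff_divide_distrib)
    also have "\<dots> \<le> \<bar>s - t\<bar> / (2 * K)" using K by (intro divide_right_mono) (auto simp: max_def)
    finally show ?thesis .
  qed
  have "curve_lip (2 * K * (1 / (2 * K))) (cdom U \<phi> p r) w"
  proof (rule curve_lip_of_chart[OF U r])
    fix x y
    have "\<bar>w x - w y\<bar> \<le> \<bar>?\<nu> (\<phi> x - \<phi> p) - ?\<nu> (\<phi> y - \<phi> p)\<bar> / (2 * K)"
      unfolding w_def using clip[of "r / 2 - ?\<nu> (\<phi> x - \<phi> p)" "r / 2 - ?\<nu> (\<phi> y - \<phi> p)"] by (simp add: abs_minus_commute)
    also have "\<dots> \<le> ?\<nu> (\<phi> x - \<phi> y) / (2 * K)"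
      using is_normD(8)[OF \<nu>, of "\<phi> x" "\<phi> p" "\<phi> y"] is_normD(8)[OF \<nu>, of "\<phi> y" "\<phi> p" "\<phi> x"] is_normD(7)[OF \<nu>, of "\<phi> x" "\<phi> y"] K
      by (intro divide_right_mono) (auto simp: abs_le_iff)
    finally show "\<bar>w x - w y\<bar> \<le> 1 / (2 * K) * ?\<nu> (\<phi> x - \<phi> y)" by simp
  qed (use K in auto)
  then have "curve_lip 1 (cdom U \<phi> p r) w" using K by simp
  then have in_dom: "curve_lip 1 (cdom U \<phi> p r) u" by (rule curve_lip_cong) (simp add: u_def)
  let ?C = "{x\<in>U. ?\<nu> (\<phi> x - \<phi> p) \<le> r / 2}"
  have "w x = 0" if "x \<notin> ?C" "x \<in> U" for x using that unfolding w_def by (simp add: max_def)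
  then have "u x = 0" if "x \<in> - ?C" for x using that unfolding u_def cdom_def by auto
  then have out_dom: "curve_lip 1 (- ?C) u" by (intro curve_lip_cong[OF curve_lip_const[of 1 "- ?C" 0]]) auto
  have "open (- ?C)" using r unfolding good_radius_def by (simp add: closed_def)
  then have "curve_lip 1 UNIV u"
  proof (intro curve_lip_local)
    fix x assume "open (- ?C)"
    show "\<exists>W. open W \<and> x \<in> W \<and> curve_lip 1 W u"
    proof (cases "x \<in> cdom U \<phi> p r")
      case True
      then show ?thesis using open_cdom[OF U] in_dom by blast
    next
      case False
      then have "x \<in> - ?C" using r0 unfolding cdom_def by auto
      then show ?thesis using \<open>open (- ?C)\<close> out_dom by blast
    qed
  qed
  moreover have "0 \<le> w x" "w x \<le> 1" for x unfolding w_def using K by auto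
  then have "0 \<le> u x \<and> u x \<le> 1" for x unfolding u_def by simp
  moreover have "0 < u p"
    unfolding u_def w_def using center_in_cdom[OF U r0] is_normD(2)[OF \<nu>] r0 K by simp
  moreover have "x \<in> cdom U \<phi> p r" if "0 < u x" for x using that unfolding u_def by (metis less_irrefl)
  ultimately show ?thesis by blast
qed

end

section \<open>Strict differentiability along a subspace\<close>

text \<open>The last clause says that on \<open>Y\<close> near \<open>y0\<close> the function
  \<open>w - T\<close> has arbitrarily small Lipschitz constant. Differentiability at
  \<open>y0\<close> alone would not give this, and only values of \<open>w\<close> on
  \<open>Y\<close> enter.\<close>

definition has_strict_derivative_along :: "'x::real_normed_vector set \<Rightarrow> ('x \<Rightarrow> real) \<Rightarrow> ('x \<Rightarrow> real) \<Rightarrow> 'x \<Rightarrow> bool" where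
  "has_strict_derivative_along Y w T y0 \<longleftrightarrow>
     (\<forall>u\<in>Y. \<forall>v\<in>Y. T (u + v) = T u + T v) \<and> (\<forall>a. \<forall>v\<in>Y. T (a *\<^sub>R v) = a * T v) \<and>
     (\<forall>e>0. \<exists>d>0. \<forall>y\<in>Y. \<forall>z\<in>Y. norm (y - y0) < d \<longrightarrow> norm (z - y0) < d \<longrightarrow>
        \<bar>w y - w z - T (y - z)\<bar> \<le> e * norm (y - z))"

definition strictly_diff :: "'x::real_normed_vector set \<Rightarrow> ('x \<Rightarrow> real) \<Rightarrow> 'x \<Rightarrow> bool" where
  "strictly_diff Y w y0 \<longleftrightarrow> (\<exists>T. has_strict_derivative_along Y w T y0)"

lemma has_strict_derivative_alongD:
  assumes "has_strict_derivative_along Y w T y0"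
  shows "u \<in> Y \<Longrightarrow> v \<in> Y \<Longrightarrow> T (u + v) = T u + T v" "v \<in> Y \<Longrightarrow> T (a *\<^sub>R v) = a * T v"
    and "0 < e \<Longrightarrow> \<exists>d>0. \<forall>y\<in>Y. \<forall>z\<in>Y. norm (y - y0) < d \<longrightarrow> norm (z - y0) < d \<longrightarrow> \<bar>w y - w z - T (y - z)\<bar> \<le> e * norm (y - z)"
  using assms unfolding has_strict_derivative_along_def by blast+

text \<open>Mean value inequality along the segment from \<open>z\<close> to \<open>y\<close>, which
  stays in \<open>A \<inter> Y\<close>, where the derivative is close to
  \<open>D y0\<close>.\<close>

lemma strictly_diff_of_C1_on_subspace:
  assumes w: "C1_on_subspace Y (A \<inter> Y) w" and A: "open A" "y0 \<in> A \<inter> Y" and Y: "subspace Y"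
  shows "strictly_diff Y w y0"
proof -
  obtain D where "\<forall>y\<in>A \<inter> Y.
     (\<forall>u\<in>Y. \<forall>v\<in>Y. D y (u + v) = D y u + D y v) \<and> (\<forall>a. \<forall>v\<in>Y. D y (a *\<^sub>R v) = a * D y v) \<and>
     (\<exists>B. \<forall>v\<in>Y. \<bar>D y v\<bar> \<le> B * norm v) \<and>
     ((\<lambda>z. (w z - w y - D y (z - y)) / norm (z - y)) \<longlongrightarrow> 0) (at y within A \<inter> Y) \<and>
     (\<forall>e>0. \<exists>d>0. \<forall>z\<in>A \<inter> Y. dist z y < d \<longrightarrow> (\<forall>v\<in>Y. \<bar>D z v - D y v\<bar> \<le> e * norm v))"
    using w unfolding C1_on_subspace_def by (elim exE)
  then have D: "\<And>y u v. y \<in> A \<inter> Y \<Longrightarrow> u \<in> Y \<Longrightarrow> v \<in> Y \<Longrightarrow> D y (u + v) = D y u + D y v"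
      "\<And>y a v. y \<in> A \<inter> Y \<Longrightarrow> v \<in> Y \<Longrightarrow> D y (a *\<^sub>R v) = a * D y v"
      "\<And>y. y \<in> A \<inter> Y \<Longrightarrow> ((\<lambda>z. (w z - w y - D y (z - y)) / norm (z - y)) \<longlongrightarrow> 0) (at y within A \<inter> Y)"
      "\<And>y e. y \<in> A \<inter> Y \<Longrightarrow> 0 < e \<Longrightarrow> \<exists>d>0. \<forall>z\<in>A \<inter> Y. dist z y < d \<longrightarrow> (\<forall>v\<in>Y. \<bar>D z v - D y v\<bar> \<le> e * norm v)"
    by simp_all
  have "\<exists>d>0. \<forall>y\<in>Y. \<forall>z\<in>Y. norm (y - y0) < d \<longrightarrow> norm (z - y0) < d \<longrightarrow>
        \<bar>w y - w z - D y0 (y - z)\<bar> \<le> e * norm (y - z)" if e: "e > 0" for e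
  proof -
    obtain d1 where d1: "d1 > 0" "\<And>z v. z \<in> A \<inter> Y \<Longrightarrow> dist z y0 < d1 \<Longrightarrow> v \<in> Y \<Longrightarrow> \<bar>D z v - D y0 v\<bar> \<le> e * norm v"
      using D(4)[OF A(2) e] by blast
    obtain d2 where d2: "d2 > 0" "ball y0 d2 \<subseteq> A" using A by (metis IntD1 openE)
    define d where "d = min d1 d2"
    have "\<bar>w y - w z - D y0 (y - z)\<bar> \<le> e * norm (y - z)"
      if y: "y \<in> Y" "norm (y - y0) < d" and z: "z \<in> Y" "norm (z - y0) < d" for y z
    proof (cases "y = z")
      case True
      then show ?thesis using D(2)[OF A(2), of 0 0] subspace_0[OF Y] by simp
    next
      case False
      define s where "s t = z + t *\<^sub>R (y - z)" for t
      have yz: "y - z \<in> Y" using Y y z by (simp add: subspace_diff)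
      have n: "norm (y - z) > 0" using False by simp
      have sY: "s t \<in> Y" for t unfolding s_def using Y z yz by (simp add: subspace_add subspace_scale)
      have sd: "s t \<in> ball y0 d" if "t \<in> {0..1}" for t
      proof -
        have "closed_segment z y \<subseteq> ball y0 d"
          using y z by (intro closed_segment_subset) (auto simp: dist_norm norm_minus_commute)
        moreover have "s t \<in> closed_segment z y"
          unfolding in_segment s_def using that by (intro exI[of _ t]) (simp add: algebra_simps)
        ultimately show ?thesis by blast
      qed
      have sA: "s t \<in> A \<inter> Y" if "t \<in> {0..1}" for t
        using sd[OF that] d2(2) sY[of t] unfolding d_def by auto
      have ss: "s a - s t = (a - t) *\<^sub>R (y - z)" for a t unfolding s_def by (simp add: algebra_simps)
      \<comment> \<open>Along the segment \<open>s t\<close> is approached within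
        \<open>A \<inter> Y\<close>, so the relative limit of the hypothesis applies; multiplication
        by \<open>norm (y - z)\<close> turns its quotient into one by the parameter.\<close>
      have der: "((\<lambda>t. w (s t)) has_real_derivative D (s t) (y - z)) (at t within {0..1})" if t: "t \<in> {0..1}" for t
      proof -
        define q where "q x = (w x - w (s t) - D (s t) (x - s t)) / norm (x - s t)" for x
        have "filterlim s (at (s t) within A \<inter> Y) (at t within {0..1})"
          unfolding filterlim_at
        proof
          show "\<forall>\<^sub>F a in at t within {0..1}. s a \<in> A \<inter> Y \<and> s a \<noteq> s t"
            unfolding eventually_at_filter
          proof (intro always_eventually allI impI)
            fix a assume "a \<noteq> t" "a \<in> {0..1}"
            then show "s a \<in> A \<inter> Y \<and> s a \<noteq> s t" using sA[of a] ss[of a t] n by (metis norm_zero order_less_irrefl right_minus_eq scaleR_eq_0_iff)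
          qed
          show "(s \<longlongrightarrow> s t) (at t within {0..1})" unfolding s_def by (intro tendsto_intros)
        qed
        from filterlim_compose[OF D(3)[OF sA[OF t], folded q_def] this]
        have "((\<lambda>a. q (s a)) \<longlongrightarrow> 0) (at t within {0..1})" .
        then have lim: "((\<lambda>a. \<bar>q (s a)\<bar> * norm (y - z)) \<longlongrightarrow> 0) (at t within {0..1})"
          by (intro tendsto_mult_left_zero tendsto_rabs_zero)
        have "((\<lambda>a. (w (s a) - w (s t)) / (a - t) - D (s t) (y - z)) \<longlongrightarrow> 0) (at t within {0..1})"
        proof (rule Lim_null_comparison[OF _ lim])
          have "norm ((w (s a) - w (s t)) / (a - t) - D (s t) (y - z)) \<le> \<bar>q (s a)\<bar> * norm (y - z)" if a: "a \<noteq> t" for a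
          proof -
            have q: "q (s a) = (w (s a) - w (s t) - (a - t) * D (s t) (y - z)) / (\<bar>a - t\<bar> * norm (y - z))"
              unfolding q_def ss using D(2)[OF sA[OF t] yz] by simp
            have "(w (s a) - w (s t)) / (a - t) - D (s t) (y - z) = (w (s a) - w (s t) - (a - t) * D (s t) (y - z)) / (a - t)"
              using a by (simp add: field_simps)
            then show ?thesis unfolding q using n a by (simp add: abs_mult)
          qed
          then show "\<forall>\<^sub>F a in at t within {0..1}. norm ((w (s a) - w (s t)) / (a - t) - D (s t) (y - z)) \<le> \<bar>q (s a)\<bar> * norm (y - z)"
            unfolding eventually_at_filter by (intro always_eventually) auto
        qed
        then show ?thesis unfolding has_field_derivative_iff by (rule LIM_zero_cancel)
      qed
      have "norm ((w (s 1) - 1 * D y0 (y - z)) - (w (s 0) - 0 * D y0 (y - z))) \<le> (e * norm (y - z)) * norm (1 - 0 :: real)"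
      proof (rule field_differentiable_bound[where S = "{0..1}" and f' = "\<lambda>t. D (s t) (y - z) - D y0 (y - z)"])
        show "((\<lambda>t. w (s t) - t * D y0 (y - z)) has_field_derivative D (s t) (y - z) - D y0 (y - z)) (at t within {0..1})"
          if "t \<in> {0..1}" for t
          using der[OF that] by (auto intro!: derivative_eq_intros)
        show "norm (D (s t) (y - z) - D y0 (y - z)) \<le> e * norm (y - z)" if "t \<in> {0..1}" for t
          using d1(2)[OF sA[OF that] _ yz] sd[OF that] unfolding d_def by (simp add: dist_commute)
      qed auto
      then show ?thesis unfolding s_def by simp
    qed
    moreover have "d > 0" using d1 d2 d_def by simp
    ultimately show ?thesis by blast
  qed
  then show ?thesis unfolding strictly_diff_def has_strict_derivative_along_def using D(1,2)[OF A(2)]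
    by (intro exI[of _ "D y0"] conjI ballI allI) simp_all
qed

lemma strictly_diff_subset:
  assumes "strictly_diff Z w y0" "Y \<subseteq> Z"
  shows "strictly_diff Y w y0"
proof -
  obtain T where T: "has_strict_derivative_along Z w T y0" using assms(1) unfolding strictly_diff_def by blast
  have "\<exists>d>0. \<forall>y\<in>Y. \<forall>z\<in>Y. norm (y - y0) < d \<longrightarrow> norm (z - y0) < d \<longrightarrow> \<bar>w y - w z - T (y - z)\<bar> \<le> e * norm (y - z)"
    if "e > 0" for e
    using has_strict_derivative_alongD(3)[OF T that] assms(2) by (elim exE conjE) (intro exI conjI, assumption, blast)
  then show ?thesis
    unfolding strictly_diff_def has_strict_derivative_along_def[of Y]
    using has_strict_derivative_alongD(1,2)[OF T] assms(2) by (intro exI[of _ T] conjI) blast+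
qed

lemma strictly_diff_of_C1_on:
  assumes "C1_on S w" "open S" "y0 \<in> S"
  shows "strictly_diff Y w y0"
  using strictly_diff_of_C1_on_subspace[of UNIV S w y0] assms C1_on_subspace_UNIV[of S w]
  by (auto intro: strictly_diff_subset[OF _ subset_UNIV])

text \<open>The identity is asked only on \<open>Y\<close> near \<open>y0\<close>, because the
  remainders of the iteration are prescribed only on \<open>N\<close>.\<close>

lemma strictly_diff_diff:
  assumes "strictly_diff Y w1 y0" "strictly_diff Y w2 y0"
    and eq: "\<rho> > 0" "\<And>y. y \<in> Y \<Longrightarrow> norm (y - y0) < \<rho> \<Longrightarrow> w y = w1 y - w2 y"
  shows "strictly_diff Y w y0"
proof -
  obtain T1 T2 where "has_strict_derivative_along Y w1 T1 y0" "has_strict_derivative_along Y w2 T2 y0"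
    using assms(1,2) unfolding strictly_diff_def by blast
  note T1 = has_strict_derivative_alongD[OF this(1)] and T2 = has_strict_derivative_alongD[OF this(2)]
  have "\<exists>d>0. \<forall>y\<in>Y. \<forall>z\<in>Y. norm (y - y0) < d \<longrightarrow> norm (z - y0) < d \<longrightarrow>
      \<bar>w y - w z - (T1 (y - z) - T2 (y - z))\<bar> \<le> e * norm (y - z)" if e: "e > 0" for e
  proof -
    obtain d1 where d1: "d1 > 0" "\<And>y z. y \<in> Y \<Longrightarrow> z \<in> Y \<Longrightarrow> norm (y - y0) < d1 \<Longrightarrow> norm (z - y0) < d1 \<Longrightarrow> \<bar>w1 y - w1 z - T1 (y - z)\<bar> \<le> e / 2 * norm (y - z)"
      using T1(3)[of "e/2"] e by (metis half_gt_zero)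
    obtain d2 where d2: "d2 > 0" "\<And>y z. y \<in> Y \<Longrightarrow> z \<in> Y \<Longrightarrow> norm (y - y0) < d2 \<Longrightarrow> norm (z - y0) < d2 \<Longrightarrow> \<bar>w2 y - w2 z - T2 (y - z)\<bar> \<le> e / 2 * norm (y - z)"
      using T2(3)[of "e/2"] e by (metis half_gt_zero)
    have "\<bar>w y - w z - (T1 (y - z) - T2 (y - z))\<bar> \<le> e * norm (y - z)"
      if "y \<in> Y" "z \<in> Y" "norm (y - y0) < min \<rho> (min d1 d2)" "norm (z - y0) < min \<rho> (min d1 d2)" for y z
    proof -
      have "\<bar>w1 y - w1 z - T1 (y - z)\<bar> \<le> e / 2 * norm (y - z)" "\<bar>w2 y - w2 z - T2 (y - z)\<bar> \<le> e / 2 * norm (y - z)"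
        using d1(2)[of y z] d2(2)[of y z] that by auto
      moreover have "w y = w1 y - w2 y" "w z = w1 z - w2 z" using eq(2)[of y] eq(2)[of z] that by auto
      moreover have "e / 2 * norm (y - z) + e / 2 * norm (y - z) = e * norm (y - z)" by simp
      ultimately show ?thesis by linarith
    qed
    then show ?thesis using d1(1) d2(1) eq(1) by (intro exI[of _ "min \<rho> (min d1 d2)"]) auto
  qed
  then show ?thesis
    unfolding strictly_diff_def has_strict_derivative_along_def using T1(1,2) T2(1,2)
    by (intro exI[of _ "\<lambda>v. T1 v - T2 v"]) (auto simp: algebra_simps)
qed

section \<open>Approximation in the model space\<close>

lemma norm_Lipschitz_extension:
  assumes \<nu>: "is_norm \<nu>" and L: "0 \<le> L"
    and f: "\<And>x y. x \<in> B \<Longrightarrow> y \<in> B \<Longrightarrow> \<bar>f x - f y\<bar> \<le> L * \<nu> (x - y)"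
  shows "\<exists>F. (\<forall>x\<in>B. F x = f x) \<and> (\<forall>x y. \<bar>F x - F y\<bar> \<le> L * \<nu> (x - y))"
proof -
  have "\<exists>F. (\<forall>p\<in>B. F p = f p) \<and> (\<forall>x y. norm_dist \<nu> x y \<noteq> top \<longrightarrow> ennreal \<bar>F x - F y\<bar> \<le> ennreal L * norm_dist \<nu> x y)"
  proof (rule McShane_extension)
    fix x y z
    show "norm_dist \<nu> x x = 0" "norm_dist \<nu> x y = norm_dist \<nu> y x"
      unfolding norm_dist_def using is_normD(2,7)[OF \<nu>] by auto
    show "norm_dist \<nu> x z \<le> norm_dist \<nu> x y + norm_dist \<nu> y z"
      unfolding norm_dist_def using is_normD(1,8)[OF \<nu>] by (simp flip: ennreal_plus)
  qed (use L f is_normD(1)[OF \<nu>] in \<open>auto simp: norm_dist_def simp flip: ennreal_mult\<close>)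
  then show ?thesis
    unfolding norm_dist_def using L is_normD(1)[OF \<nu>] by (simp flip: ennreal_mult)
qed

lemma smooth_approximation:
  assumes star: "property_star1 \<nu> C0" and \<nu>: "is_norm \<nu>" and L: "0 \<le> L" and \<epsilon>: "0 < \<epsilon>"
    and f: "\<And>x y. \<bar>f x - f y\<bar> \<le> L * \<nu> (x - y)"
  shows "\<exists>h. C1_on UNIV h \<and> (\<forall>x. \<bar>h x - f x\<bar> \<le> \<epsilon>) \<and> (\<forall>x y. \<bar>h x - h y\<bar> \<le> C0 * L * \<nu> (x - y))"
proof -
  have C0: "1 \<le> C0" using star unfolding property_star1_def by blast
  have f': "ennreal \<bar>f x - f y\<bar> \<le> ennreal L * norm_dist \<nu> x y" for x y
    unfolding norm_dist_def using f L is_normD(1)[OF \<nu>] by (simp flip: ennreal_mult)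
  then have "lipschitz_wrt (norm_dist \<nu>) UNIV f" unfolding lipschitz_wrt_def using L by blast
  then obtain h where h: "C1_on UNIV h" "\<And>x. \<bar>f x - h x\<bar> < \<epsilon>"
      "lip_const (norm_dist \<nu>) UNIV h \<le> ennreal C0 * lip_const (norm_dist \<nu>) UNIV f"
    using star \<epsilon> unfolding property_star1_def by blast
  have "lip_const (norm_dist \<nu>) UNIV f \<le> ennreal L" using f' by (subst lip_const_le_iff) auto
  then have "lip_const (norm_dist \<nu>) UNIV h \<le> ennreal C0 * ennreal L"
    using h(3) by (meson mult_left_mono order_trans zero_le)
  then have "lip_const (norm_dist \<nu>) UNIV h \<le> ennreal (C0 * L)" using C0 L by (simp add: ennreal_mult)
  then have "ennreal \<bar>h x - h y\<bar> \<le> ennreal (C0 * L) * norm_dist \<nu> x y" for x y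
    by (subst (asm) lip_const_le_iff) (auto simp: norm_dist_def)
  then have hL: "ennreal \<bar>h x - h y\<bar> \<le> ennreal (C0 * L) * ennreal (\<nu> (x - y))" for x y
    unfolding norm_dist_def .
  have CL: "0 \<le> C0 * L" using C0 L by simp
  have "\<bar>h x - h y\<bar> \<le> C0 * L * \<nu> (x - y)" for x y
    using hL[of x y] unfolding ennreal_mult[OF CL is_normD(1)[OF \<nu>], symmetric]
    using mult_nonneg_nonneg[OF CL is_normD(1)[OF \<nu>]] by (subst (asm) ennreal_le_iff) auto
  then show ?thesis using h(1,2) by (metis abs_minus_commute less_imp_le)
qed

text \<open>The approximation \<open>h\<close> is exact along \<open>Y\<close> up to a function \<open>G\<close> with small Lipschitz constant:
  the part \<open>Q\<close> of \<open>w\<close> that vanishes on \<open>Y\<close> is approximated by a function \<open>q\<close> with \<open>\<bar>q\<bar> \<le> \<epsilon>\<close>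
  on \<open>Y\<close>, and composing with a shrinking function makes it vanish there.\<close>

lemma approximation_along_subspace:
  fixes w :: "'x::banach \<Rightarrow> real"
  assumes star: "property_star1 \<nu> C0" and eqv: "equivalent_norm \<nu>" and Y: "subspace Y" and y0: "y0 \<in> Y"
    and r: "0 < r" and L: "0 \<le> L" and \<eta>: "0 < \<eta>" and \<epsilon>: "0 < \<epsilon>"
    and w: "\<And>y z. \<nu> (y - y0) < r \<Longrightarrow> \<nu> (z - y0) < r \<Longrightarrow> \<bar>w y - w z\<bar> \<le> L * \<nu> (y - z)"
    and T: "\<And>u v. u \<in> Y \<Longrightarrow> v \<in> Y \<Longrightarrow> T (u + v) = T u + T v" "\<And>a v. v \<in> Y \<Longrightarrow> T (a *\<^sub>R v) = a * T v"
    and wT: "\<And>y z. y \<in> Y \<Longrightarrow> z \<in> Y \<Longrightarrow> \<nu> (y - y0) < r \<Longrightarrow> \<nu> (z - y0) < r \<Longrightarrow> \<bar>w y - w z - T (y - z)\<bar> \<le> \<eta> * \<nu> (y - z)"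
  shows "\<exists>h G. C1_on UNIV h \<and> (\<forall>y z. \<bar>h y - h z\<bar> \<le> (L + \<eta> + C0 * \<eta> + C0 * (2 * L + 2 * \<eta>)) * \<nu> (y - z)) \<and>
    (\<forall>y. \<nu> (y - y0) < r \<longrightarrow> \<bar>h y - w y\<bar> \<le> 5 * \<epsilon>) \<and>
    (\<forall>y z. \<bar>G y - G z\<bar> \<le> (1 + C0) * \<eta> * \<nu> (y - z)) \<and> (\<forall>y. \<bar>G y\<bar> \<le> \<epsilon>) \<and>
    (\<forall>y\<in>Y. \<nu> (y - y0) < r \<longrightarrow> G y = w y - h y)"
proof -
  have \<nu>: "is_norm \<nu>" and C0: "1 \<le> C0"
    using eqv star unfolding equivalent_norm_def property_star1_def by auto
  define B where "B = {y. \<nu> (y - y0) < r}"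
  have y0B: "y0 \<in> B" unfolding B_def using r is_normD(2)[OF \<nu>] by simp
  define M where "M = L + \<eta>"
  \<comment> \<open>Continuity of \<open>T\<close> comes from \<open>w\<close>: after
    \<open>v\<close> is scaled into the ball by \<open>s\<close>, the increment of \<open>w\<close>
    contributes \<open>L\<close> and its deviation from \<open>T\<close> contributes
    \<open>\<eta>\<close>.\<close>
  have TM: "T v \<le> M * \<nu> v" if v: "v \<in> Y" for v
  proof -
    define s where "s = r / (\<nu> v + 1)"
    have s: "0 < s" unfolding s_def using r is_normD(1)[OF \<nu>, of v] by (simp add: add_nonneg_pos)
    have "s * \<nu> v < r" unfolding s_def using r is_normD(1)[OF \<nu>, of v] by (simp add: field_simps add_nonneg_pos)
    then have sB: "\<nu> (y0 + s *\<^sub>R v - y0) < r" using s is_normD(5)[OF \<nu>] by simp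
    have sY: "y0 + s *\<^sub>R v \<in> Y" using Y y0 v by (simp add: subspace_add subspace_scale)
    have "\<bar>w (y0 + s *\<^sub>R v) - w y0 - T (y0 + s *\<^sub>R v - y0)\<bar> \<le> \<eta> * \<nu> (y0 + s *\<^sub>R v - y0)"
      using wT[OF sY y0 sB] r is_normD(2)[OF \<nu>] by simp
    moreover have "\<bar>w (y0 + s *\<^sub>R v) - w y0\<bar> \<le> L * \<nu> (y0 + s *\<^sub>R v - y0)"
      using w[OF sB, of y0] r is_normD(2)[OF \<nu>] by simp
    moreover have "T (y0 + s *\<^sub>R v - y0) = s * T v" using T(2)[OF v] by simp
    moreover have "\<nu> (y0 + s *\<^sub>R v - y0) = s * \<nu> v" using s is_normD(5)[OF \<nu>] by simp
    ultimately have "s * T v \<le> L * (s * \<nu> v) + \<eta> * (s * \<nu> v)" by (simp add: abs_le_iff)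
    then have "s * T v \<le> s * (M * \<nu> v)" by (simp add: M_def algebra_simps)
    then show ?thesis using s by simp
  qed
  have M: "0 \<le> M" using L \<eta> M_def by simp
  obtain T' where T': "linear T'" "\<And>v. v \<in> Y \<Longrightarrow> T' v = T v" "\<And>v. \<bar>T' v\<bar> \<le> M * \<nu> v"
    using Hahn_Banach_norm[OF \<nu> Y M T TM] by blast
  have T'l: "\<bar>T' y - T' z\<bar> \<le> M * \<nu> (y - z)" for y z using T'(3)[of "y - z"] linear_diff[OF T'(1)] by simp
  obtain b where b: "\<And>v. \<nu> v \<le> b * norm v" using eqv unfolding equivalent_norm_def by blast
  have "bounded_linear T'"
  proof (rule bounded_linear_intro[where K = "M * b"])
    show "norm (T' v) \<le> norm v * (M * b)" for v
      using order_trans[OF T'(3)[of v] mult_left_mono[OF b[of v] M]] by (simp add: mult_ac)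
  qed (use T'(1) in \<open>auto simp: linear_add linear_scale\<close>)
  \<comment> \<open>On \<open>Y\<close> near \<open>y0\<close> only the small constant
    \<open>\<eta>\<close> is left, so the extension \<open>r1\<close> to the whole space has this
    constant too.\<close>
  have "\<bar>(w y - T' y) - (w z - T' z)\<bar> \<le> \<eta> * \<nu> (y - z)" if "y \<in> Y \<inter> B" "z \<in> Y \<inter> B" for y z
    using wT[of y z] that T'(2)[of "y - z"] linear_diff[OF T'(1), of y z] subspace_diff[OF Y, of y z]
    unfolding B_def by (simp add: algebra_simps)
  then obtain r1 where r1: "\<And>y. y \<in> Y \<inter> B \<Longrightarrow> r1 y = w y - T' y" "\<And>y z. \<bar>r1 y - r1 z\<bar> \<le> \<eta> * \<nu> (y - z)"
    using norm_Lipschitz_extension[OF \<nu>, of \<eta> "Y \<inter> B" "\<lambda>y. w y - T' y"] \<eta> by auto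
  obtain k where k: "C1_on UNIV k" "\<And>y. \<bar>k y - r1 y\<bar> \<le> \<epsilon>" "\<And>y z. \<bar>k y - k z\<bar> \<le> C0 * \<eta> * \<nu> (y - z)"
    using smooth_approximation[OF star \<nu> _ \<epsilon> r1(2)] \<eta> by auto
  define P where "P = 2 * L + 2 * \<eta>"
  have P: "0 \<le> P" using L \<eta> P_def by simp
  \<comment> \<open>The constants of \<open>w\<close>, \<open>T'\<close> and \<open>r1\<close> add
    up to \<open>P\<close>: \<open>L + (L + \<eta>) + \<eta>\<close>.\<close>
  have "\<bar>(w y - T' y - r1 y) - (w z - T' z - r1 z)\<bar> \<le> P * \<nu> (y - z)" if "y \<in> B" "z \<in> B" for y z
  proof -
    have "P * \<nu> (y - z) = L * \<nu> (y - z) + M * \<nu> (y - z) + \<eta> * \<nu> (y - z)" by (simp add: P_def M_def algebra_simps)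
    then show ?thesis using w[of y z] that T'l[of y z] r1(2)[of y z] unfolding B_def mem_Collect_eq by linarith
  qed
  then obtain Q where Q: "\<And>y. y \<in> B \<Longrightarrow> Q y = w y - T' y - r1 y" "\<And>y z. \<bar>Q y - Q z\<bar> \<le> P * \<nu> (y - z)"
    using norm_Lipschitz_extension[OF \<nu> P, of B "\<lambda>y. w y - T' y - r1 y"] by auto
  obtain q where q: "C1_on UNIV q" "\<And>y. \<bar>q y - Q y\<bar> \<le> \<epsilon>" "\<And>y z. \<bar>q y - q z\<bar> \<le> C0 * P * \<nu> (y - z)"
    using smooth_approximation[OF star \<nu> P \<epsilon> Q(2)] by auto
  obtain \<tau> :: "real \<Rightarrow> real" where \<tau>: "C1_on UNIV \<tau>" "\<And>s t. \<bar>\<tau> s - \<tau> t\<bar> \<le> \<bar>s - t\<bar>"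
      "\<And>s. \<bar>\<tau> s - s\<bar> \<le> 3 * \<epsilon>" "\<And>s. \<bar>s\<bar> \<le> \<epsilon> \<Longrightarrow> \<tau> s = 0"
    using smooth_shrink[OF \<epsilon>] by blast
  \<comment> \<open>On \<open>B\<close> one has \<open>w = T' + r1 + Q\<close>. The functional is
    kept, \<open>r1\<close> is replaced by \<open>k\<close> and \<open>Q\<close> by
    \<open>\<tau> \<circ> q\<close>; the errors \<open>\<epsilon>\<close> and
    \<open>3 * \<epsilon> + \<epsilon>\<close> give the 5.\<close>
  define h where "h y = T' y + k y + \<tau> (q y)" for y
  define G where "G y = r1 y - k y" for y
  have "C1_on UNIV h"
    unfolding h_def using C1_on_add[OF C1_on_add[OF C1_on_bounded_linear[OF \<open>bounded_linear T'\<close>] k(1)] C1_on_compose[OF q(1) \<tau>(1)]]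
    by (simp add: o_def)
  moreover have "\<bar>h y - h z\<bar> \<le> (L + \<eta> + C0 * \<eta> + C0 * (2 * L + 2 * \<eta>)) * \<nu> (y - z)" for y z
  proof -
    have "\<bar>h y - h z\<bar> \<le> M * \<nu> (y - z) + C0 * \<eta> * \<nu> (y - z) + C0 * P * \<nu> (y - z)"
      using T'l[of y z] k(3)[of y z] q(3)[of y z] \<tau>(2)[of "q y" "q z"] unfolding h_def by linarith
    then show ?thesis by (simp add: M_def P_def distrib_right)
  qed
  moreover have "\<bar>h y - w y\<bar> \<le> 5 * \<epsilon>" if "\<nu> (y - y0) < r" for y
    using Q(1)[of y] q(2)[of y] k(2)[of y] \<tau>(3)[of "q y"] that unfolding h_def B_def mem_Collect_eq by linarith
  moreover have "\<bar>G y - G z\<bar> \<le> (1 + C0) * \<eta> * \<nu> (y - z)" for y z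
  proof -
    have "\<bar>G y - G z\<bar> \<le> \<eta> * \<nu> (y - z) + C0 * \<eta> * \<nu> (y - z)"
      using r1(2)[of y z] k(3)[of y z] unfolding G_def by linarith
    then show ?thesis by (simp add: distrib_right)
  qed
  moreover have "\<bar>G y\<bar> \<le> \<epsilon>" for y using k(2)[of y] unfolding G_def by linarith
  \<comment> \<open>On \<open>Y \<inter> B\<close> the function \<open>Q\<close> vanishes, so
    \<open>q\<close> is at most \<open>\<epsilon>\<close> and \<open>\<tau>\<close> removes it; only
    \<open>r1 - k\<close> remains.\<close>
  moreover have "G y = w y - h y" if "y \<in> Y" "\<nu> (y - y0) < r" for y
  proof -
    have "y \<in> Y \<inter> B" using that B_def by simp
    then have "Q y = 0" using Q(1) r1(1) by simp
    then have "\<tau> (q y) = 0" using q(2)[of y] \<tau>(4) by simp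
    then show ?thesis using r1(1)[OF \<open>y \<in> Y \<inter> B\<close>] unfolding G_def h_def by simp
  qed
  ultimately show ?thesis by blast
qed

section \<open>Local approximation on a manifold\<close>

locale submanifold_extension = weak_uniform_manifold K \<A> nrm
  for K :: real and \<A> :: "('m::t2_space, 'x::banach) chart set" and nrm :: "('m, 'x) tangent_vec \<Rightarrow> real" +
  fixes C0 :: real and Y :: "'x set" and N :: "'m set"
  assumes star: "\<And>\<nu> :: 'x \<Rightarrow> real. equivalent_norm \<nu> \<Longrightarrow> property_star1 \<nu> C0"
    and submanifold: "C1_submanifold \<A> Y N" and closed_N: "closed N"
begin

lemma C0: "1 \<le> C0"
proof -
  obtain U \<phi> and x :: 'm where "(U, \<phi>) \<in> \<A>" "x \<in> U" using chart_ex by blast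
  then show ?thesis using star[OF cnorm_equivalent] unfolding property_star1_def by blast
qed

lemma smooth_on_cdom:
  assumes U: "(U, \<phi>) \<in> \<A>" "p \<in> U" and h: "C1_on UNIV h"
  shows "smooth_on (cdom U \<phi> p r) (\<lambda>x. h (\<phi> x))"
proof (rule smooth_on_chart[OF U(1) _ _ open_cdom[OF U]])
  show sub: "cdom U \<phi> p r \<subseteq> U" unfolding cdom_def by blast
  show "C1_on (\<phi> ` cdom U \<phi> p r) ((\<lambda>x. h (\<phi> x)) \<circ> inv_into U \<phi>)"
  proof (rule C1_on_cong[OF C1_on_subset[OF h subset_UNIV]])
    show "open (\<phi> ` cdom U \<phi> p r)" using open_chart_image[OF U(1) open_cdom[OF U] sub] .
  qed (use sub inv_chart[OF U(1)] in auto)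
qed

text \<open>The two passages between curves and the chart norm cost \<open>2 * K\<close> each, the
  approximation in between costs \<open>C0\<close>.\<close>

lemma local_approximation:
  assumes U: "(U, \<phi>) \<in> \<A>" "p \<in> U" and r: "good_radius U \<phi> p r"
    and v: "curve_lip L (cdom U \<phi> p r) v" and L: "0 \<le> L" and \<epsilon>: "0 < \<epsilon>"
  shows "\<exists>h. smooth_on (cdom U \<phi> p r) h \<and> curve_lip (4 * C0 * K\<^sup>2 * L) (cdom U \<phi> p r) h \<and>
    (\<forall>x\<in>cdom U \<phi> p r. \<bar>h x - v x\<bar> \<le> \<epsilon>)"
proof -
  let ?\<nu> = "cnorm U \<phi> p" and ?B = "cdom U \<phi> p r"
  have \<nu>: "is_norm ?\<nu>" using cnorm_is_norm[OF U] .
  have L': "0 \<le> 2 * K * L" using K L by simp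
  have inv: "inv_into U \<phi> (\<phi> x) = x" if "x \<in> ?B" for x using inv_chart[OF U(1)] that unfolding cdom_def by blast
  have "\<bar>v (inv_into U \<phi> y) - v (inv_into U \<phi> z)\<bar> \<le> 2 * K * L * ?\<nu> (y - z)" if "y \<in> \<phi> ` ?B" "z \<in> \<phi> ` ?B" for y z
    using that chart_lip_of_curve_lip[OF U r L v] inv by auto
  then obtain w where w: "\<And>y. y \<in> \<phi> ` ?B \<Longrightarrow> w y = v (inv_into U \<phi> y)" "\<And>y z. \<bar>w y - w z\<bar> \<le> 2 * K * L * ?\<nu> (y - z)"
    using norm_Lipschitz_extension[OF \<nu> L', of "\<phi> ` ?B" "\<lambda>y. v (inv_into U \<phi> y)"] by blast
  obtain h where h: "C1_on UNIV h" "\<And>y. \<bar>h y - w y\<bar> \<le> \<epsilon>" "\<And>y z. \<bar>h y - h z\<bar> \<le> C0 * (2 * K * L) * ?\<nu> (y - z)"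
    using smooth_approximation[OF star[OF cnorm_equivalent[OF U]] \<nu> L' \<epsilon> w(2)] by blast
  have "curve_lip (2 * K * (C0 * (2 * K * L))) ?B (\<lambda>x. h (\<phi> x))"
    by (rule curve_lip_of_chart[OF U r]) (use h(3) C0 L' in auto)
  then have "curve_lip (4 * C0 * K\<^sup>2 * L) ?B (\<lambda>x. h (\<phi> x))" by (simp add: power2_eq_square mult_ac)
  moreover have "\<bar>h (\<phi> x) - v x\<bar> \<le> \<epsilon>" if "x \<in> ?B" for x using h(2)[of "\<phi> x"] w(1)[of "\<phi> x"] inv[OF that] that by auto
  ultimately show ?thesis using smooth_on_cdom[OF U h(1)] by blast
qed

definition adapted :: "'m set \<Rightarrow> ('m \<Rightarrow> 'x) \<Rightarrow> 'x set \<Rightarrow> bool" where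
  "adapted U \<phi> A \<longleftrightarrow> (U, \<phi>) \<in> \<A> \<and> open A \<and> \<phi> ` (U \<inter> N) = A \<inter> Y"

text \<open>Since \<open>\<phi>\<close> maps \<open>U \<inter> N\<close> onto
  \<open>A \<inter> Y\<close>, this is a condition on the values of \<open>F\<close> on
  \<open>N\<close> alone.\<close>

definition smooth_along :: "('m \<Rightarrow> real) \<Rightarrow> bool" where
  "smooth_along F \<longleftrightarrow> (\<forall>U \<phi> A. adapted U \<phi> A \<longrightarrow> (\<forall>p\<in>U \<inter> N. strictly_diff Y (F \<circ> inv_into U \<phi>) (\<phi> p)))"

text \<open>Neither constant depends on \<open>\<epsilon>\<close>, so gluing may choose the accuracy
  after the weights. \<open>G\<close> extends the error on \<open>N\<close> to all of
  \<open>B\<close>.\<close>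

definition locally_approximable :: "real \<Rightarrow> real \<Rightarrow> ('m \<Rightarrow> real) \<Rightarrow> 'm set \<Rightarrow> bool" where
  "locally_approximable L \<eta> F B \<longleftrightarrow> (\<forall>\<epsilon>>0. \<exists>h G. smooth_on B h \<and> curve_lip L B h \<and>
    (\<forall>x\<in>B. \<bar>h x - F x\<bar> \<le> \<epsilon>) \<and> curve_lip \<eta> B G \<and> (\<forall>x\<in>B. \<bar>G x\<bar> \<le> \<epsilon>) \<and> (\<forall>x\<in>B \<inter> N. G x = F x - h x))"

lemma local_approximation_along_N:
  assumes F: "curve_lip L UNIV F" "smooth_along F" and L: "0 < L" and \<eta>: "0 < \<eta>" and p: "p \<in> N"
  shows "\<exists>U \<phi> r. (U, \<phi>) \<in> \<A> \<and> p \<in> U \<and> good_radius U \<phi> p r \<and>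
    locally_approximable (28 * C0 * K\<^sup>2 * L) \<eta> F (cdom U \<phi> p r)"
proof -
  obtain U \<phi> A where UA: "(U, \<phi>) \<in> \<A>" "p \<in> U" "open A" "\<phi> p \<in> A \<inter> Y" "\<phi> ` (U \<inter> N) = A \<inter> Y"
    using submanifold p unfolding C1_submanifold_def by blast
  have U: "(U, \<phi>) \<in> \<A>" "p \<in> U" using UA by auto
  have Y: "subspace Y" using submanifold unfolding C1_submanifold_def by blast
  let ?\<nu> = "cnorm U \<phi> p"
  have \<nu>: "is_norm ?\<nu>" using cnorm_is_norm[OF U] .
  define w where "w = F \<circ> inv_into U \<phi>"
  \<comment> \<open>The first bound keeps the constant of \<open>h\<close> proportional to
    \<open>L\<close>; the second brings the constant of \<open>G\<close>, after the passage to
    curves, below \<open>\<eta>\<close>.\<close>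
  define \<eta>' where "\<eta>' = min (2 * K * L) (\<eta> / (2 * K * (1 + C0)))"
  have \<eta>': "0 < \<eta>'" "\<eta>' \<le> 2 * K * L" "2 * K * ((1 + C0) * \<eta>') \<le> \<eta>"
  proof -
    show "0 < \<eta>'" "\<eta>' \<le> 2 * K * L" unfolding \<eta>'_def using K C0 L \<eta> by auto
    have "0 < 2 * K * (1 + C0)" using K C0 by simp
    moreover have "\<eta>' \<le> \<eta> / (2 * K * (1 + C0))" unfolding \<eta>'_def by simp
    ultimately have "\<eta>' * (2 * K * (1 + C0)) \<le> \<eta>" by (simp add: pos_le_divide_eq)
    then show "2 * K * ((1 + C0) * \<eta>') \<le> \<eta>" by (simp add: mult_ac)
  qed
  obtain a where a: "a > 0" "\<And>v. a * norm v \<le> ?\<nu> v"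
    using cnorm_equivalent[OF U] unfolding equivalent_norm_def by blast
  have "strictly_diff Y w (\<phi> p)"
    using F(2) UA p unfolding smooth_along_def adapted_def w_def by blast
  then obtain T where "has_strict_derivative_along Y w T (\<phi> p)" unfolding strictly_diff_def by blast
  note T = has_strict_derivative_alongD[OF this]
  \<comment> \<open>Strict differentiability refers to the original norm; accuracy
    \<open>\<eta>' * a\<close> there is accuracy \<open>\<eta>'\<close> in the chart norm.\<close>
  have "0 < \<eta>' * a" using \<eta>' a by simp
  then obtain d where d: "d > 0" "\<And>y z. y \<in> Y \<Longrightarrow> z \<in> Y \<Longrightarrow> norm (y - \<phi> p) < d \<Longrightarrow> norm (z - \<phi> p) < d \<Longrightarrow>
      \<bar>w y - w z - T (y - z)\<bar> \<le> \<eta>' * a * norm (y - z)"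
    using T(3) by metis
  obtain \<rho>1 where \<rho>1: "\<rho>1 > 0" "\<And>y. ?\<nu> (y - \<phi> p) < \<rho>1 \<Longrightarrow> y \<in> A \<inter> ball (\<phi> p) d"
    using cnorm_ball[OF U, of "A \<inter> ball (\<phi> p) d"] UA(3,4) d(1) by (auto simp: open_Int)
  obtain \<rho>2 where \<rho>2: "\<rho>2 > 0" "\<And>r. 0 < r \<Longrightarrow> r \<le> \<rho>2 \<Longrightarrow> good_radius U \<phi> p r" using good_radius_ex[OF U] by blast
  define r where "r = min \<rho>1 \<rho>2"
  have r0: "0 < r" and r: "good_radius U \<phi> p r" unfolding r_def using \<rho>1(1) \<rho>2 by auto
  let ?B = "cdom U \<phi> p r"
  have rA: "y \<in> A" "norm (y - \<phi> p) < d" if "?\<nu> (y - \<phi> p) < r" for y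
    using \<rho>1(2)[of y] that unfolding r_def by (auto simp: dist_norm norm_minus_commute)
  have inv: "inv_into U \<phi> (\<phi> x) = x" if "x \<in> ?B" for x using inv_chart[OF U(1)] that unfolding cdom_def by blast
  have Bim: "y \<in> \<phi> ` ?B" if "?\<nu> (y - \<phi> p) < r" for y using cdom_image[OF U(1) r] that by simp
  have w: "\<bar>w y - w z\<bar> \<le> 2 * K * L * ?\<nu> (y - z)" if "?\<nu> (y - \<phi> p) < r" "?\<nu> (z - \<phi> p) < r" for y z
    using Bim[OF that(1)] Bim[OF that(2)] chart_lip_of_curve_lip[OF U r _ curve_lip_mono[OF F(1) subset_UNIV order_refl]] L inv
    unfolding w_def by auto
  have wT: "\<bar>w y - w z - T (y - z)\<bar> \<le> \<eta>' * ?\<nu> (y - z)"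
    if "y \<in> Y" "z \<in> Y" "?\<nu> (y - \<phi> p) < r" "?\<nu> (z - \<phi> p) < r" for y z
  proof -
    have "\<bar>w y - w z - T (y - z)\<bar> \<le> \<eta>' * (a * norm (y - z))" using d(2)[of y z] that rA(2) by (simp add: mult.assoc)
    also have "\<dots> \<le> \<eta>' * ?\<nu> (y - z)" using a(2) \<eta>' by (intro mult_left_mono) auto
    finally show ?thesis .
  qed
  have BN: "\<phi> x \<in> Y" if "x \<in> ?B \<inter> N" for x using that UA(5) unfolding cdom_def by blast
  have "\<exists>h G. smooth_on ?B h \<and> curve_lip (28 * C0 * K\<^sup>2 * L) ?B h \<and> (\<forall>x\<in>?B. \<bar>h x - F x\<bar> \<le> \<epsilon>) \<and>
      curve_lip \<eta> ?B G \<and> (\<forall>x\<in>?B. \<bar>G x\<bar> \<le> \<epsilon>) \<and> (\<forall>x\<in>?B \<inter> N. G x = F x - h x)" if \<epsilon>: "\<epsilon> > 0" for \<epsilon>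
  proof -
    \<comment> \<open>As \<open>\<eta>'\<close> is at most \<open>2 * K * L\<close>,
      \<open>P\<close> is at most \<open>2 + 5 * C0 \<le> 7 * C0\<close> times
      \<open>2 * K * L\<close>; the passage to curves multiplies by another \<open>2 * K\<close>.
      The tolerance \<open>\<epsilon> / 5\<close> absorbs the factor 5 of the model
      approximation.\<close>
    define P where "P = 2 * K * L + \<eta>' + C0 * \<eta>' + C0 * (2 * (2 * K * L) + 2 * \<eta>')"
    have KL: "0 \<le> 2 * K * L" "0 < \<epsilon> / 5" using K L \<epsilon> by auto
    have "\<phi> p \<in> Y" using UA(4) by blast
    note approx = approximation_along_subspace[where \<nu> = ?\<nu> and w = w and T = T and ?y0.0 = "\<phi> p" and r = r,
        OF star[OF cnorm_equivalent[OF U]] cnorm_equivalent[OF U] Y this r0 KL(1) \<eta>'(1) KL(2) w T(1,2) wT, folded P_def]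
    obtain h G where h: "C1_on UNIV h" "\<And>y z. \<bar>h y - h z\<bar> \<le> P * ?\<nu> (y - z)"
        "\<And>y. ?\<nu> (y - \<phi> p) < r \<Longrightarrow> \<bar>h y - w y\<bar> \<le> 5 * (\<epsilon> / 5)"
      and G: "\<And>y z. \<bar>G y - G z\<bar> \<le> (1 + C0) * \<eta>' * ?\<nu> (y - z)" "\<And>y. \<bar>G y\<bar> \<le> \<epsilon> / 5"
        "\<And>y. y \<in> Y \<Longrightarrow> ?\<nu> (y - \<phi> p) < r \<Longrightarrow> G y = w y - h y"
      using approx by blast
    have "C0 * \<eta>' \<le> C0 * (2 * K * L)" using \<eta>'(2) C0 by (intro mult_left_mono) auto
    moreover have "1 * (K * L) \<le> C0 * (K * L)" using C0 K L by (intro mult_right_mono) auto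
    ultimately have "P \<le> 14 * (C0 * (K * L))"
      using \<eta>'(2) unfolding P_def distrib_left by (simp add: algebra_simps)
    then have P: "2 * K * P \<le> 28 * C0 * K\<^sup>2 * L"
      using mult_left_mono[of P "14 * (C0 * (K * L))" "2 * K"] K by (simp add: power2_eq_square mult_ac)
    have P0: "0 \<le> P" unfolding P_def using KL(1) \<eta>'(1) C0 by simp
    have "curve_lip (2 * K * P) ?B (\<lambda>x. h (\<phi> x))"
      by (rule curve_lip_of_chart[OF U r]) (use h(2) P0 in auto)
    then have "curve_lip (28 * C0 * K\<^sup>2 * L) ?B (\<lambda>x. h (\<phi> x))" using P by (auto elim: curve_lip_mono)
    moreover have "curve_lip (2 * K * ((1 + C0) * \<eta>')) ?B (\<lambda>x. G (\<phi> x))"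
      by (rule curve_lip_of_chart[OF U r]) (use G(1) C0 \<eta>'(1) in auto)
    then have "curve_lip \<eta> ?B (\<lambda>x. G (\<phi> x))" using \<eta>'(3) by (auto elim: curve_lip_mono)
    moreover have "\<bar>h (\<phi> x) - F x\<bar> \<le> \<epsilon>" if "x \<in> ?B" for x
      using h(3)[of "\<phi> x"] inv[OF that] that unfolding w_def cdom_def by simp
    moreover have "\<bar>G (\<phi> x)\<bar> \<le> \<epsilon>" for x using G(2)[of "\<phi> x"] \<epsilon> by simp
    moreover have "G (\<phi> x) = F x - h (\<phi> x)" if "x \<in> ?B \<inter> N" for x
      using G(3)[OF BN[OF that]] inv[of x] that unfolding w_def cdom_def by simp
    ultimately show ?thesis
      using smooth_on_cdom[OF U h(1)] by (intro exI[of _ "\<lambda>x. h (\<phi> x)"] exI[of _ "\<lambda>x. G (\<phi> x)"]) blast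
  qed
  then show ?thesis using U r unfolding locally_approximable_def by blast
qed

text \<open>Off the closed set \<open>N\<close> a ball missing \<open>N\<close> works with
  \<open>G = 0\<close>, and the constant 4 of \<open>local_approximation\<close> is below
  28.\<close>

lemma locally_approximable:
  assumes F: "curve_lip L UNIV F" "smooth_along F" and L: "0 < L" and \<eta>: "0 < \<eta>"
  shows "\<exists>U \<phi> r. (U, \<phi>) \<in> \<A> \<and> p \<in> U \<and> good_radius U \<phi> p r \<and>
    locally_approximable (28 * C0 * K\<^sup>2 * L) \<eta> F (cdom U \<phi> p r)"
proof (cases "p \<in> N")
  case True
  then show ?thesis using local_approximation_along_N[OF assms] by blast
next
  case False
  obtain U \<phi> where U: "(U, \<phi>) \<in> \<A>" "p \<in> U" using chart_ex by blast
  have "open (U - N)" using chartD(1)[OF U(1)] closed_N by (rule open_Diff)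
  then have "open (\<phi> ` (U - N))" using open_chart_image[OF U(1)] by blast
  then obtain \<rho>1 where \<rho>1: "\<rho>1 > 0" "\<And>y. cnorm U \<phi> p (y - \<phi> p) < \<rho>1 \<Longrightarrow> y \<in> \<phi> ` (U - N)"
    using cnorm_ball[OF U, of "\<phi> ` (U - N)"] U(2) False by auto
  obtain \<rho>2 where \<rho>2: "\<rho>2 > 0" "\<And>r. 0 < r \<Longrightarrow> r \<le> \<rho>2 \<Longrightarrow> good_radius U \<phi> p r" using good_radius_ex[OF U] by blast
  define r where "r = min \<rho>1 \<rho>2"
  have r: "good_radius U \<phi> p r" unfolding r_def using \<rho>1(1) \<rho>2 by auto
  let ?B = "cdom U \<phi> p r"
  have BN: "x \<notin> N" if "x \<in> ?B" for x
  proof -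
    have x: "x \<in> U" "cnorm U \<phi> p (\<phi> x - \<phi> p) < \<rho>1" using that unfolding cdom_def r_def by auto
    then obtain x' where "x' \<in> U - N" "\<phi> x = \<phi> x'" using \<rho>1(2) by blast
    then show ?thesis using x(1) inj_onD[OF chartD(3)[OF U(1)], of x x'] by blast
  qed
  have "locally_approximable (28 * C0 * K\<^sup>2 * L) \<eta> F ?B"
    unfolding locally_approximable_def
  proof (intro allI impI)
    fix \<epsilon> :: real assume \<epsilon>: "0 < \<epsilon>"
    obtain h where h: "smooth_on ?B h" "curve_lip (4 * C0 * K\<^sup>2 * L) ?B h" "\<forall>x\<in>?B. \<bar>h x - F x\<bar> \<le> \<epsilon>"
      using local_approximation[OF U r curve_lip_mono[OF F(1) subset_UNIV order_refl] _ \<epsilon>] L by auto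
    have "4 * C0 * K\<^sup>2 * L \<le> 28 * C0 * K\<^sup>2 * L" using C0 L by (intro mult_right_mono) auto
    then have "curve_lip (28 * C0 * K\<^sup>2 * L) ?B h" using h(2) by (auto elim: curve_lip_mono)
    moreover have "curve_lip \<eta> ?B (\<lambda>x. 0)" using \<eta> by (intro curve_lip_const) simp
    ultimately show "\<exists>h G. smooth_on ?B h \<and> curve_lip (28 * C0 * K\<^sup>2 * L) ?B h \<and> (\<forall>x\<in>?B. \<bar>h x - F x\<bar> \<le> \<epsilon>) \<and>
      curve_lip \<eta> ?B G \<and> (\<forall>x\<in>?B. \<bar>G x\<bar> \<le> \<epsilon>) \<and> (\<forall>x\<in>?B \<inter> N. G x = F x - h x)"
      using h BN \<epsilon> by (intro exI[of _ h] exI[of _ "\<lambda>x. 0"]) auto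
  qed
  then show ?thesis using U r by blast
qed

end

section \<open>Partitions of unity\<close>

text \<open>Minimal elements provide, at every point, a first bump that is positive there.\<close>

lemma wellorder_strict:
  "\<exists>lt :: 'a \<Rightarrow> 'a \<Rightarrow> bool. (\<forall>x y. x \<noteq> y \<longrightarrow> lt x y \<or> lt y x) \<and> (\<forall>x. \<not> lt x x) \<and>
     (\<forall>S x. x \<in> S \<longrightarrow> (\<exists>m\<in>S. \<forall>y. lt y m \<longrightarrow> y \<notin> S))"
proof -
  have "\<exists>r :: 'a rel. Well_order r \<and> Field r = UNIV" by (rule well_ordering)
  then obtain r :: "'a rel" where r: "Well_order r" "Field r = UNIV" by (elim exE conjE)
  define lt where "lt x y \<longleftrightarrow> (x, y) \<in> r - Id" for x y
  have "\<forall>x y. x \<noteq> y \<longrightarrow> lt x y \<or> lt y x"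
    using r unfolding lt_def well_order_on_def linear_order_on_def total_on_def by auto
  moreover have "wf (r - Id)" using r unfolding well_order_on_def by blast
  then have "\<exists>m\<in>S. \<forall>y. lt y m \<longrightarrow> y \<notin> S" if "x \<in> S" for S x
    using wfE_min[of "r - Id" x S] that unfolding lt_def by blast
  ultimately show ?thesis unfolding lt_def by (intro exI[of _ "\<lambda>x y. (x, y) \<in> r - Id"]) auto
qed

text \<open>A normalisation without division: the partial sums telescope to
  \<open>1 - (\<Prod>k<n. 1 - \<psi> k x)\<close>, hence equal 1 as soon as some factor
  vanishes.\<close>

definition weight :: "(nat \<Rightarrow> 'a \<Rightarrow> real) \<Rightarrow> nat \<Rightarrow> 'a \<Rightarrow> real" where
  "weight \<psi> n x = \<psi> n x * (\<Prod>k<n. 1 - \<psi> k x)"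

text \<open>Where some \<open>\<psi> m\<close> equals 1, all later weights vanish and the series is
  a finite sum.\<close>

definition glue :: "(nat \<Rightarrow> 'a \<Rightarrow> real) \<Rightarrow> (nat \<Rightarrow> 'a \<Rightarrow> real) \<Rightarrow> 'a \<Rightarrow> real" where
  "glue \<psi> H x = (\<Sum>n. weight \<psi> n x * H n x)"

lemma sum_weight: "(\<Sum>k<n. weight \<psi> k x) = 1 - (\<Prod>k<n. 1 - \<psi> k x)"
  by (induction n) (auto simp: weight_def algebra_simps)

lemma weight_eq_0:
  assumes "\<psi> m x = 1" "m < n"
  shows "weight \<psi> n x = 0"
proof -
  have "(\<Prod>k<n. 1 - \<psi> k x) = 0" using assms by (intro prod_zero) auto
  then show ?thesis unfolding weight_def by simp
qed

lemma sum_weight_eq_1: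
  assumes "\<psi> m x = 1"
  shows "(\<Sum>k\<le>m. weight \<psi> k x) = 1"
proof -
  have "(\<Prod>k<Suc m. 1 - \<psi> k x) = 0" using assms by (intro prod_zero) auto
  then show ?thesis using sum_weight[of \<psi> x "Suc m"] unfolding lessThan_Suc_atMost by simp
qed

lemma glue_eq_sum:
  assumes "\<psi> m x = 1"
  shows "glue \<psi> H x = (\<Sum>k\<le>m. weight \<psi> k x * H k x)"
  unfolding glue_def by (rule suminf_finite) (auto simp: weight_eq_0[where \<psi> = \<psi>, OF assms])

lemma weight_nonneg: "(\<And>k. 0 \<le> \<psi> k x \<and> \<psi> k x \<le> 1) \<Longrightarrow> 0 \<le> weight \<psi> n x"
  unfolding weight_def by (intro mult_nonneg_nonneg prod_nonneg) auto

context weak_uniform_manifold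
begin

text \<open>The constants of the factors add up, so the bound grows with the stage; the accuracies
  \<open>e n\<close> in \<open>curve_lip_glue\<close> compensate for this.\<close>

lemma curve_lip_weight:
  assumes \<psi>: "\<And>k. curve_lip (l k) UNIV (\<psi> k)" "\<And>k x. 0 \<le> \<psi> k x \<and> \<psi> k x \<le> 1"
  shows "curve_lip (\<Sum>k\<le>n. l k) UNIV (weight \<psi> n)"
proof -
  have "curve_lip (\<Sum>k<n. l k) UNIV (\<lambda>x. \<Prod>k<n. 1 - \<psi> k x) \<and> (\<forall>x. 0 \<le> (\<Prod>k<n. 1 - \<psi> k x) \<and> (\<Prod>k<n. 1 - \<psi> k x) \<le> 1)" for n
  proof (induction n)
    case 0
    then show ?case using curve_lip_const[of 0 UNIV 1] by simp
  next
    case (Suc n)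
    have "curve_lip (1 * l n) UNIV (\<lambda>x. 1 - \<psi> n x)" by (rule curve_lip_compose[OF \<psi>(1)]) auto
    then have "curve_lip ((\<Sum>k<n. l k) + l n) UNIV (\<lambda>x. (\<Prod>k<n. 1 - \<psi> k x) * (1 - \<psi> n x))"
      using Suc \<psi>(2) by (intro curve_lip_mult_unit) auto
    moreover have "0 \<le> (\<Prod>k<n. 1 - \<psi> k x) * (1 - \<psi> n x) \<and> (\<Prod>k<n. 1 - \<psi> k x) * (1 - \<psi> n x) \<le> 1" for x
      using Suc \<psi>(2)[of n x] by (auto intro: mult_le_one)
    ultimately show ?case by simp
  qed
  then have "curve_lip (l n + (\<Sum>k<n. l k)) UNIV (\<lambda>x. \<psi> n x * (\<Prod>k<n. 1 - \<psi> k x))"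
    using \<psi> by (intro curve_lip_mult_unit) auto
  then show ?thesis unfolding weight_def by (simp add: add.commute flip: lessThan_Suc_atMost)
qed

lemma smooth_on_weight:
  assumes "\<And>k. smooth_on U (\<psi> k)"
  shows "smooth_on U (weight \<psi> n)"
proof -
  have "smooth_on U (\<lambda>x. \<Prod>k<n. 1 - \<psi> k x)" for n
    by (induction n) (simp_all add: smooth_on_mult smooth_on_const smooth_on_diff assms)
  then show ?thesis unfolding weight_def using assms by (intro smooth_on_mult)
qed

text \<open>The functions \<open>\<psi> n\<close> play the role of the sum over a discrete family of bump functions: near each
  point of \<open>W n\<close> only the member of the family with index \<open>\<sigma> n\<close> is active.\<close>

definition partition :: "(nat \<Rightarrow> real) \<Rightarrow> (nat \<Rightarrow> 'm \<Rightarrow> real) \<Rightarrow> (nat \<Rightarrow> 'm set) \<Rightarrow> bool" where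
  "partition l \<psi> W \<longleftrightarrow>
    (\<forall>n. smooth_on UNIV (\<psi> n) \<and> curve_lip (l n) UNIV (\<psi> n) \<and> 0 \<le> l n \<and> open (W n)) \<and>
    (\<forall>n x. 0 \<le> \<psi> n x \<and> \<psi> n x \<le> 1) \<and>
    (\<forall>n x. x \<notin> W n \<longrightarrow> (\<exists>O'. open O' \<and> x \<in> O' \<and> (\<forall>y\<in>O'. \<psi> n y = 0))) \<and>
    (\<forall>x. \<exists>n O'. open O' \<and> x \<in> O' \<and> (\<forall>y\<in>O'. \<psi> n y = 1))"

text \<open>An index \<open>m\<close> with \<open>\<psi> m = 1\<close> near \<open>x\<close> cuts
  the series off. Of the remaining indices, those with \<open>x\<close> outside \<open>W k\<close>
  have zero weight near \<open>x\<close>; this matters because \<open>H k\<close> is controlled only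
  on \<open>W k\<close>.\<close>

lemma glue_local:
  assumes "partition l \<psi> W"
  obtains J O' where "open O'" "x \<in> O'" "finite J" "\<And>k. k \<in> J \<Longrightarrow> O' \<subseteq> W k"
    "\<And>y. y \<in> O' \<Longrightarrow> (\<Sum>k\<in>J. weight \<psi> k y) = 1"
    "\<And>y H. y \<in> O' \<Longrightarrow> glue \<psi> H y = (\<Sum>k\<in>J. weight \<psi> k y * H k y)"
proof -
  obtain m O1 where O1: "open O1" "x \<in> O1" "\<forall>y\<in>O1. \<psi> m y = 1"
    using assms unfolding partition_def by blast
  define J where "J = {k. k \<le> m \<and> x \<in> W k}"
  have "\<exists>O'. open O' \<and> x \<in> O' \<and> (if k \<in> J then O' \<subseteq> W k else (\<forall>y\<in>O'. weight \<psi> k y = 0))" if k: "k \<in> {..m}" for k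
  proof (cases "k \<in> J")
    case True
    moreover have "open (W k)" using assms unfolding partition_def by blast
    ultimately show ?thesis unfolding J_def by auto
  next
    case False
    then have "x \<notin> W k" using k unfolding J_def by simp
    then obtain O' where "open O'" "x \<in> O'" "\<forall>y\<in>O'. \<psi> k y = 0" using assms unfolding partition_def by blast
    then show ?thesis using False unfolding weight_def by auto
  qed
  then obtain V where V: "\<And>k. k \<in> {..m} \<Longrightarrow> open (V k) \<and> x \<in> V k \<and> (if k \<in> J then V k \<subseteq> W k else (\<forall>y\<in>V k. weight \<psi> k y = 0))"
    by metis
  define O' where "O' = O1 \<inter> (\<Inter>k\<in>{..m}. V k)"
  have J: "J \<subseteq> {..m}" unfolding J_def by auto
  show ?thesis
  proof (rule that[of O' J])
    show "open O'" unfolding O'_def using O1 V by (intro open_Int open_INT) auto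
    show "x \<in> O'" unfolding O'_def using O1 V by auto
    show "finite J" using J finite_subset by blast
    show "O' \<subseteq> W k" if "k \<in> J" for k
    proof -
      have "O' \<subseteq> V k" unfolding O'_def using that J by blast
      then show ?thesis using V[of k] that J by auto
    qed
    fix y H assume "y \<in> O'"
    then have y: "y \<in> O1" "\<And>k. k \<in> {..m} \<Longrightarrow> y \<in> V k" unfolding O'_def by auto
    then have m: "\<psi> m y = 1" using O1(3) by blast
    have "\<forall>k\<in>{..m} - J. weight \<psi> k y = 0" using V y(2) by (metis DiffD1 DiffD2)
    then have "(\<Sum>k\<in>J. weight \<psi> k y) = (\<Sum>k\<le>m. weight \<psi> k y)" "(\<Sum>k\<in>J. weight \<psi> k y * H k y) = (\<Sum>k\<le>m. weight \<psi> k y * H k y)"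
      using J by (auto intro!: sum.mono_neutral_left)
    then show "(\<Sum>k\<in>J. weight \<psi> k y) = 1" "glue \<psi> H y = (\<Sum>k\<in>J. weight \<psi> k y * H k y)"
      using sum_weight_eq_1[of \<psi> m y] glue_eq_sum[of \<psi> m y H] m by auto
  qed
qed

lemma partitionD:
  assumes "partition l \<psi> W"
  shows "smooth_on UNIV (\<psi> n)" "curve_lip (l n) UNIV (\<psi> n)" "0 \<le> l n" "0 \<le> \<psi> n x \<and> \<psi> n x \<le> 1" "0 \<le> weight \<psi> n x"
  using assms weight_nonneg[of \<psi> x n] unfolding partition_def by blast+

lemma smooth_on_glue:
  assumes p: "partition l \<psi> W" and H: "\<And>n. smooth_on (W n) (H n)"
  shows "smooth_on UNIV (glue \<psi> H)"
proof (rule smooth_on_local)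
  fix x
  obtain J O' where O': "open O'" "x \<in> O'" "finite J" "\<And>k. k \<in> J \<Longrightarrow> O' \<subseteq> W k"
    "\<And>y H. y \<in> O' \<Longrightarrow> glue \<psi> H y = (\<Sum>k\<in>J. weight \<psi> k y * H k y)"
    using glue_local[OF p, of x] by metis
  have "smooth_on O' (\<lambda>y. \<Sum>k\<in>J. weight \<psi> k y * H k y)"
    using H O'(4) by (intro smooth_on_sum O'(3) smooth_on_mult smooth_on_subset[OF smooth_on_weight[OF partitionD(1)[OF p]]])
      (auto intro: smooth_on_subset)
  then have "smooth_on O' (glue \<psi> H)" by (rule smooth_on_cong[OF _ O'(1)]) (simp add: O'(5))
  then show "\<exists>W. open W \<and> x \<in> W \<and> smooth_on W (glue \<psi> H)" using O' by blast
qed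

text \<open>The variation of the weights would be harmless if all \<open>H n\<close> agreed. As the
  weights sum to 1, a constant value of \<open>F\<close> may be subtracted, so that their variation
  multiplies only the differences \<open>H n - F\<close>, of size \<open>e n\<close>.\<close>

lemma curve_lip_glue:
  assumes p: "partition l \<psi> W" and L: "0 \<le> L" and H: "\<And>n. curve_lip L (W n) (H n)"
    and HF: "\<And>n x. x \<in> W n \<Longrightarrow> \<bar>H n x - F x\<bar> \<le> e n" and e: "\<And>n. 0 \<le> e n"
    and \<delta>: "\<And>m. (\<Sum>n\<le>m. (\<Sum>k\<le>n. l k) * e n) \<le> \<delta>"
  shows "curve_lip (L + \<delta>) UNIV (glue \<psi> H)"
proof (rule curve_lip_local)
  fix x
  note \<psi> = partitionD[OF p]
  obtain J O' where O': "open O'" "x \<in> O'" "finite J" "\<And>k. k \<in> J \<Longrightarrow> O' \<subseteq> W k"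
    "\<And>y. y \<in> O' \<Longrightarrow> (\<Sum>k\<in>J. weight \<psi> k y) = 1"
    "\<And>y H. y \<in> O' \<Longrightarrow> glue \<psi> H y = (\<Sum>k\<in>J. weight \<psi> k y * H k y)"
    using glue_local[OF p, of x] by metis
  obtain m where m: "J \<subseteq> {..m}" using O'(3) by (metis finite_nat_set_iff_bounded_le atMost_iff subsetI)
  have "curve_lip (L + \<delta>) O' (glue \<psi> H)"
    unfolding curve_lip_def
  proof (intro allI impI)
    fix a b c assume c: "a < b" "C1_curve \<A> a b c" "c ` {a..b} \<subseteq> O'"
    define y where "y = c b"
    define z where "z = c a"
    define d where "d = len a b c"
    have d: "0 \<le> d" unfolding d_def using len_nonneg c by blast
    have yz: "y \<in> O'" "z \<in> O'" using c unfolding y_def z_def by auto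
    \<comment> \<open>The same constant \<open>F z\<close> is subtracted at both ends of the curve;
      therefore no Lipschitz constant of \<open>F\<close> enters.\<close>
    have g: "glue \<psi> H v - F z = (\<Sum>k\<in>J. weight \<psi> k v * (H k v - F z))" if "v \<in> O'" for v
    proof -
      have E: "(\<Sum>k\<in>J. weight \<psi> k v * (H k v - F z)) = glue \<psi> H v - (\<Sum>k\<in>J. weight \<psi> k v) * F z"
        unfolding O'(6)[OF that] by (simp add: right_diff_distrib sum_subtractf sum_distrib_right)
      show ?thesis unfolding E O'(5)[OF that] by simp
    qed
    have le: "\<bar>weight \<psi> k y * (H k y - F z) - weight \<psi> k z * (H k z - F z)\<bar> \<le> weight \<psi> k y * (L * d) + ((\<Sum>i\<le>k. l i) * e k) * d"
      if k: "k \<in> J" for k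
    proof -
      have 1: "\<bar>H k y - H k z\<bar> \<le> L * d"
        unfolding y_def z_def d_def using curve_lipD[OF H c(1,2)] c(3) O'(4) k by blast
      have 2: "\<bar>weight \<psi> k y - weight \<psi> k z\<bar> \<le> (\<Sum>i\<le>k. l i) * d"
        unfolding y_def z_def d_def using curve_lipD[OF curve_lip_weight[where \<psi> = \<psi> and l = l and n = k, OF \<psi>(2,4)] c(1,2)] by blast
      have 3: "\<bar>H k z - F z\<bar> \<le> e k" using HF O'(4) k yz(2) by blast
      have "weight \<psi> k y * (H k y - F z) - weight \<psi> k z * (H k z - F z) =
        weight \<psi> k y * (H k y - H k z) + (weight \<psi> k y - weight \<psi> k z) * (H k z - F z)" by (simp add: algebra_simps)
      also have "\<bar>\<dots>\<bar> \<le> weight \<psi> k y * \<bar>H k y - H k z\<bar> + \<bar>weight \<psi> k y - weight \<psi> k z\<bar> * \<bar>H k z - F z\<bar>"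
        using abs_triangle_ineq \<psi>(5) by (metis abs_mult abs_of_nonneg)
      also have "\<dots> \<le> weight \<psi> k y * (L * d) + ((\<Sum>i\<le>k. l i) * d) * e k"
        using 1 2 3 \<psi>(3,5) d by (intro add_mono mult_left_mono mult_mono mult_nonneg_nonneg sum_nonneg) auto
      finally show ?thesis by (simp add: mult_ac)
    qed
    have "\<bar>glue \<psi> H y - glue \<psi> H z\<bar> = \<bar>\<Sum>k\<in>J. weight \<psi> k y * (H k y - F z) - weight \<psi> k z * (H k z - F z)\<bar>"
      using g[OF yz(1)] g[OF yz(2)] by (simp add: sum_subtractf)
    also have "\<dots> \<le> (\<Sum>k\<in>J. weight \<psi> k y * (L * d) + ((\<Sum>i\<le>k. l i) * e k) * d)"
      by (rule order_trans[OF sum_abs sum_mono[OF le]])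
    also have "\<dots> = (\<Sum>k\<in>J. weight \<psi> k y) * (L * d) + (\<Sum>k\<in>J. (\<Sum>i\<le>k. l i) * e k) * d"
      by (simp add: sum.distrib sum_distrib_right)
    also have "(\<Sum>k\<in>J. weight \<psi> k y) = 1" using O'(5)[OF yz(1)] .
    also have "(\<Sum>k\<in>J. (\<Sum>i\<le>k. l i) * e k) * d \<le> \<delta> * d"
    proof -
      have "(\<Sum>k\<in>J. (\<Sum>i\<le>k. l i) * e k) \<le> (\<Sum>k\<le>m. (\<Sum>i\<le>k. l i) * e k)"
        using m \<psi>(3) e by (intro sum_mono2) (auto intro!: mult_nonneg_nonneg sum_nonneg)
      then show ?thesis using \<delta>[of m] d by (intro mult_right_mono) auto
    qed
    finally show "\<bar>glue \<psi> H (c b) - glue \<psi> H (c a)\<bar> \<le> (L + \<delta>) * len a b c"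
      unfolding y_def z_def d_def by (simp add: distrib_right)
  qed
  then show "\<exists>W. open W \<and> x \<in> W \<and> curve_lip (L + \<delta>) W (glue \<psi> H)" using O' by blast
qed

lemma glue_bound:
  assumes p: "partition l \<psi> W" and H: "\<And>n. x \<in> W n \<Longrightarrow> \<bar>H n x - k\<bar> \<le> E"
  shows "\<bar>glue \<psi> H x - k\<bar> \<le> E"
proof -
  obtain J where J: "\<And>n. n \<in> J \<Longrightarrow> x \<in> W n" "(\<Sum>n\<in>J. weight \<psi> n x) = 1" "\<And>H. glue \<psi> H x = (\<Sum>n\<in>J. weight \<psi> n x * H n x)"
    using glue_local[OF p, of x] by (metis subsetD)
  have E: "(\<Sum>n\<in>J. weight \<psi> n x * (H n x - k)) = glue \<psi> H x - (\<Sum>n\<in>J. weight \<psi> n x) * k"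
    unfolding J(3) by (simp add: right_diff_distrib sum_subtractf sum_distrib_right)
  have "\<bar>glue \<psi> H x - k\<bar> = \<bar>\<Sum>n\<in>J. weight \<psi> n x * (H n x - k)\<bar>" unfolding E J(2) by simp
  also have "\<dots> \<le> (\<Sum>n\<in>J. weight \<psi> n x * E)"
    using H[OF J(1)] partitionD(5)[OF p]
    by (intro order_trans[OF sum_abs sum_mono]) (simp add: abs_mult mult_left_mono)
  also have "\<dots> = E" using J(2) by (simp flip: sum_distrib_right)
  finally show ?thesis .
qed

lemma glue_add:
  assumes p: "partition l \<psi> W" and H: "\<And>n. x \<in> W n \<Longrightarrow> H n x + H' n x = k"
  shows "glue \<psi> H x + glue \<psi> H' x = k"
proof -
  obtain J where J: "\<And>n. n \<in> J \<Longrightarrow> x \<in> W n" "(\<Sum>n\<in>J. weight \<psi> n x) = 1" "\<And>H. glue \<psi> H x = (\<Sum>n\<in>J. weight \<psi> n x * H n x)"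
    using glue_local[OF p, of x] by (metis subsetD)
  have "glue \<psi> H x + glue \<psi> H' x = (\<Sum>n\<in>J. weight \<psi> n x * (H n x + H' n x))"
    unfolding J(3) by (simp add: sum.distrib distrib_left)
  also have "\<dots> = (\<Sum>n\<in>J. weight \<psi> n x * k)" using H J(1) by (intro sum.cong) auto
  finally show ?thesis using J(2) by (simp flip: sum_distrib_right)
qed

text \<open>The selected index is locally constant, so near each point the selection is a single
  member of the family.\<close>

lemma
  assumes \<sigma>: "\<And>x. x \<in> W \<Longrightarrow> \<exists>O'. open O' \<and> x \<in> O' \<and> O' \<subseteq> B (\<sigma> x) \<and> (\<forall>y\<in>O'. \<sigma> y = \<sigma> x)"
  shows smooth_on_select: "(\<And>p. smooth_on (B p) (h p)) \<Longrightarrow> smooth_on W (\<lambda>x. h (\<sigma> x) x)"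
    and curve_lip_select: "(\<And>p. curve_lip L (B p) (h p)) \<Longrightarrow> curve_lip L W (\<lambda>x. h (\<sigma> x) x)"
proof -
  show "smooth_on W (\<lambda>x. h (\<sigma> x) x)" if h: "\<And>p. smooth_on (B p) (h p)"
  proof (rule smooth_on_local)
    fix x assume "x \<in> W"
    then obtain O' where O': "open O'" "x \<in> O'" "O' \<subseteq> B (\<sigma> x)" "\<forall>y\<in>O'. \<sigma> y = \<sigma> x" using \<sigma> by blast
    have "smooth_on O' (\<lambda>x. h (\<sigma> x) x)"
      by (rule smooth_on_cong[OF smooth_on_subset[OF h O'(3)] O'(1)]) (use O'(4) in auto)
    then show "\<exists>W. open W \<and> x \<in> W \<and> smooth_on W (\<lambda>x. h (\<sigma> x) x)" using O' by blast
  qed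
  show "curve_lip L W (\<lambda>x. h (\<sigma> x) x)" if h: "\<And>p. curve_lip L (B p) (h p)"
  proof (rule curve_lip_local)
    fix x assume "x \<in> W"
    then obtain O' where O': "open O'" "x \<in> O'" "O' \<subseteq> B (\<sigma> x)" "\<forall>y\<in>O'. \<sigma> y = \<sigma> x" using \<sigma> by blast
    have "curve_lip L O' (\<lambda>x. h (\<sigma> x) x)"
      by (rule curve_lip_cong[OF curve_lip_mono[OF h O'(3) order_refl]]) (use O'(4) in auto)
    then show "\<exists>W. open W \<and> x \<in> W \<and> curve_lip L W (\<lambda>x. h (\<sigma> x) x)" using O' by blast
  qed
qed

text \<open>Well-order the index set. At stage \<open>n\<close> the \<open>p\<close>-th bump lives where \<open>u p > 2 / 2 ^ n\<close> and
  \<open>u q < 2 / 2 ^ n\<close> for all \<open>q\<close> before \<open>p\<close>; these sets are disjoint, and uniformly separated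
  because all \<open>u q\<close> have the same Lipschitz constant.\<close>

lemma partition_ex:
  fixes B :: "'m \<Rightarrow> 'm set" and u :: "'m \<Rightarrow> 'm \<Rightarrow> real"
  assumes c: "0 \<le> c"
    and u: "\<And>p. curve_lip 1 UNIV (u p)" "\<And>p x. 0 \<le> u p x \<and> u p x \<le> 1" "\<And>p. 0 < u p p" "\<And>p x. 0 < u p x \<Longrightarrow> x \<in> B p"
    and approx: "\<And>p v \<epsilon>. curve_lip 1 UNIV v \<Longrightarrow> 0 < \<epsilon> \<Longrightarrow>
      \<exists>h. smooth_on (B p) h \<and> curve_lip c (B p) h \<and> (\<forall>x\<in>B p. \<bar>h x - v x\<bar> \<le> \<epsilon>)"
  shows "\<exists>l \<psi> W \<sigma>. partition l \<psi> W \<and>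
    (\<forall>n. \<forall>x\<in>W n. \<exists>O'. open O' \<and> x \<in> O' \<and> O' \<subseteq> B (\<sigma> n x) \<and> (\<forall>y\<in>O'. \<sigma> n y = \<sigma> n x))"
proof -
  obtain lt :: "'m \<Rightarrow> 'm \<Rightarrow> bool" where lt: "\<And>x y. x \<noteq> y \<Longrightarrow> lt x y \<or> lt y x" "\<And>x. \<not> lt x x"
    "\<And>S x. x \<in> S \<Longrightarrow> \<exists>m\<in>S. \<forall>y. lt y m \<longrightarrow> y \<notin> S"
    using wellorder_strict[where 'a='m] by (elim exE conjE) blast
  define t :: "nat \<Rightarrow> real" where "t n = (1/2) ^ n" for n
  have t: "0 < t n" "t n \<le> 1" for n unfolding t_def by (auto simp: power_le_one)
  define J where "J p = insert p {q. lt q p}" for p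
  \<comment> \<open>The margin by which the condition imposed by \<open>q\<close> holds. The infimum
    \<open>v\<close> over all conditions still has constant 1, although there may be infinitely many
    of them.\<close>
  define w where "w n p q x = (if q = p then u p x - 2 * t n else 2 * t n - u q x)" for n p q x
  define v where "v n p x = (INF q\<in>J p. w n p q x)" for n p x
  have wB: "-2 \<le> w n p q x" for n p q x
    using u(2)[of p x] u(2)[of q x] t[of n] unfolding w_def by auto
  have w_lip: "curve_lip 1 UNIV (w n p q)" for n p q
  proof (cases "q = p")
    case True
    have "curve_lip (1 * 1) UNIV (\<lambda>x. u p x - 2 * t n)" by (rule curve_lip_compose[OF u(1)]) auto
    moreover have "w n p q = (\<lambda>x. u p x - 2 * t n)" unfolding w_def[abs_def] using True by simp
    ultimately show ?thesis by simp
  next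
    case False
    have "curve_lip (1 * 1) UNIV (\<lambda>x. 2 * t n - u q x)" by (rule curve_lip_compose[OF u(1)]) auto
    moreover have "w n p q = (\<lambda>x. 2 * t n - u q x)" unfolding w_def[abs_def] using False by simp
    ultimately show ?thesis by simp
  qed
  have v_lip: "curve_lip 1 UNIV (v n p)" for n p
    unfolding v_def[abs_def] by (rule curve_lip_Inf[where B = "-2"]) (use w_lip wB in \<open>auto simp: J_def\<close>)
  have v_le: "v n p x \<le> w n p q x" if "q \<in> J p" for n p q x
    unfolding v_def using wB that by (intro cINF_lower bdd_belowI2[where m = "-2"])
  have v_le1: "v n p x \<le> u p x - 2 * t n" for n p x
    using v_le[of p p n x] unfolding J_def w_def by simp
  have v_le2: "v n p x \<le> 2 * t n - u q x" if "lt q p" for n p q x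
    using v_le[of q p n x] that lt(2)[of p] unfolding J_def w_def by (auto split: if_splits)
  \<comment> \<open>If \<open>q\<close> precedes \<open>p\<close>, then \<open>v n q x\<close> is at
    most \<open>u q x - 2 * t n\<close> and \<open>v n p x\<close> at most its negative.\<close>
  have unique: "p = q" if "0 < v n p x" "0 < v n q x" for n p q x
    using lt(1)[of p q] v_le1[of n p x] v_le1[of n q x] v_le2[of p q n x] v_le2[of q p n x] that by fastforce
  have vB: "x \<in> B p" if "0 < v n p x" for n p x
    using u(4)[of p x] v_le1[of n p x] t[of n] that by simp
  \<comment> \<open>Accuracy \<open>t n / 4\<close> fits the plateaus of \<open>\<beta>\<close>:
    after division by \<open>t n\<close>, \<open>b\<close> is at most 1/2 near points outside
    \<open>W n\<close> and at least 3/2 where \<open>v\<close> exceeds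
    \<open>7/4 * t n\<close>.\<close>
  have "\<exists>b. smooth_on (B p) b \<and> curve_lip c (B p) b \<and> (\<forall>x\<in>B p. \<bar>b x - v n p x\<bar> \<le> t n / 4)" for n p
    using approx[OF v_lip, of "t n / 4" p n p] t[of n] by simp
  then have "\<forall>z. \<exists>b. smooth_on (B (snd z)) b \<and> curve_lip c (B (snd z)) b \<and>
      (\<forall>x\<in>B (snd z). \<bar>b x - v (fst z) (snd z) x\<bar> \<le> t (fst z) / 4)" by blast
  from choice[OF this] obtain b' where b': "\<And>z. smooth_on (B (snd z)) (b' z) \<and> curve_lip c (B (snd z)) (b' z) \<and>
      (\<forall>x\<in>B (snd z). \<bar>b' z x - v (fst z) (snd z) x\<bar> \<le> t (fst z) / 4)" by blast
  define b where "b n p = b' (n, p)" for n p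
  have b: "smooth_on (B p) (b n p)" "curve_lip c (B p) (b n p)" "x \<in> B p \<Longrightarrow> \<bar>b n p x - v n p x\<bar> \<le> t n / 4" for n p x
    using b'[of "(n, p)"] unfolding b_def by auto
  obtain \<beta> :: "real \<Rightarrow> real" where \<beta>: "C1_on UNIV \<beta>" "\<And>s t. \<bar>\<beta> s - \<beta> t\<bar> \<le> 2 * \<bar>s - t\<bar>"
     "\<And>s. 0 \<le> \<beta> s \<and> \<beta> s \<le> 1" "\<And>s. s \<le> 1/2 \<Longrightarrow> \<beta> s = 0" "\<And>s. s \<ge> 3/2 \<Longrightarrow> \<beta> s = 1"
    using smooth_step by blast
  define W where "W n = {x. \<exists>p. 0 < v n p x}" for n
  define \<sigma> where "\<sigma> n x = (SOME p. 0 < v n p x)" for n x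
  define \<psi> where "\<psi> n x = (if x \<in> W n then \<beta> (1 / t n * b n (\<sigma> n x) x) else 0)" for n x
  define l where "l n = 2 / t n * c" for n
  have \<sigma>: "\<sigma> n x = p" if "0 < v n p x" for n p x
    unfolding \<sigma>_def using that unique by (metis someI)
  have \<psi>_eq: "\<psi> n x = \<beta> (1 / t n * b n p x)" if "0 < v n p x" for n p x
    using \<sigma>[OF that] that unfolding \<psi>_def W_def by auto
  have open_P: "open {x. 0 < v n p x}" for n p using curve_lip_open_less(2)[OF v_lip] .
  \<comment> \<open>Different points near \<open>x\<close> may belong to different bumps, so one
    neighbourhood must serve all \<open>v n p\<close> at once; equicontinuity provides it.\<close>
  have far: "\<exists>O'. open O' \<and> x \<in> O' \<and> (\<forall>y\<in>O'. \<psi> n y = 0)" if x: "x \<notin> W n" for n x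
  proof -
    obtain O' where O': "open O'" "x \<in> O'" "\<And>g y. curve_lip 1 UNIV g \<Longrightarrow> y \<in> O' \<Longrightarrow> \<bar>g y - g x\<bar> < t n / 4"
      using curve_lip_equicontinuous[of "t n / 4" x] t[of n] by auto
    have "\<psi> n y = 0" if y: "y \<in> O'" for y
    proof (cases "y \<in> W n")
      case True
      then obtain p where p: "0 < v n p y" unfolding W_def by blast
      have "v n p x \<le> 0" using x unfolding W_def by (simp add: not_less)
      then have "b n p y \<le> t n / 2" using O'(3)[OF v_lip y, of n p] b(3)[OF vB[OF p], of n] by linarith
      then have "1 / t n * b n p y \<le> 1 / 2" using t[of n] by (simp add: field_simps)
      then show ?thesis using \<psi>_eq[OF p] \<beta>(4) by simp
    qed (simp add: \<psi>_def)
    then show ?thesis using O' by blast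
  qed
  have cover: "\<exists>n O'. open O' \<and> x \<in> O' \<and> (\<forall>y\<in>O'. \<psi> n y = 1)" for x
  proof -
    \<comment> \<open>For the first \<open>p\<close> with \<open>u p x\<close> positive, all earlier
      functions vanish at \<open>x\<close>. Every term of the infimum is then at least
      \<open>2 * t n\<close> once \<open>4 * t n < u p x\<close>.\<close>
    obtain p where p: "0 < u p x" "\<And>q. lt q p \<Longrightarrow> \<not> 0 < u q x"
      using lt(3)[of x "{p. 0 < u p x}"] u(3)[of x] by auto
    obtain n where "t n < u p x / 4" unfolding t_def using real_arch_pow_inv[of "u p x / 4" "1/2"] p(1) by auto
    then have n: "4 * t n < u p x" by simp
    have "2 * t n \<le> v n p x"
      unfolding v_def
    proof (rule cINF_greatest)
      fix q assume "q \<in> J p"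
      then show "2 * t n \<le> w n p q x" using n p(2)[of q] u(2)[of q x] unfolding J_def w_def by auto
    qed (simp add: J_def)
    then have "x \<in> {y. 7/4 * t n < v n p y}" using t[of n] by simp
    moreover have "open {y. 7/4 * t n < v n p y}" using curve_lip_open_less(2)[OF v_lip] .
    moreover have "\<psi> n y = 1" if "7/4 * t n < v n p y" for y
    proof -
      have y: "0 < v n p y" using that t[of n] by simp
      have "3/2 * t n \<le> b n p y" using b(3)[OF vB[OF y], of n] that by linarith
      then have "3/2 \<le> 1 / t n * b n p y" using t[of n] by (simp add: field_simps)
      then show ?thesis using \<psi>_eq[OF y] \<beta>(5) by simp
    qed
    ultimately show ?thesis by blast
  qed
  have smooth: "smooth_on UNIV (\<psi> n)" for n
  proof (rule smooth_on_local)
    fix x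
    show "\<exists>O'. open O' \<and> x \<in> O' \<and> smooth_on O' (\<psi> n)"
    proof (cases "x \<in> W n")
      case True
      then obtain p where p: "0 < v n p x" unfolding W_def by blast
      have "smooth_on {y. 0 < v n p y} (\<lambda>y. \<beta> (1 / t n * b n p y))"
        using vB by (intro smooth_on_compose[OF \<beta>(1)] smooth_on_mult smooth_on_const smooth_on_subset[OF b(1)]) auto
      then have "smooth_on {y. 0 < v n p y} (\<psi> n)"
        by (rule smooth_on_cong) (use open_P \<psi>_eq in auto)
      then show ?thesis using open_P p by blast
    next
      case False
      then obtain O' where O': "open O'" "x \<in> O'" "\<forall>y\<in>O'. \<psi> n y = 0" using far by blast
      then have "smooth_on O' (\<psi> n)" by (intro smooth_on_cong[OF smooth_on_const[of O' 0]]) auto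
      then show ?thesis using O' by blast
    qed
  qed
  have lip: "curve_lip (l n) UNIV (\<psi> n)" for n
  proof (rule curve_lip_local)
    fix x
    have l0: "0 \<le> l n" unfolding l_def using c t[of n] by simp
    show "\<exists>O'. open O' \<and> x \<in> O' \<and> curve_lip (l n) O' (\<psi> n)"
    proof (cases "x \<in> W n")
      case True
      then obtain p where p: "0 < v n p x" unfolding W_def by blast
      have "curve_lip (2 / t n * c) {y. 0 < v n p y} (\<lambda>y. \<beta> (1 / t n * b n p y))"
      proof (rule curve_lip_compose[where \<tau> = "\<lambda>s. \<beta> (1 / t n * s)"])
        show "curve_lip c {y. 0 < v n p y} (b n p)" using vB by (intro curve_lip_mono[OF b(2)]) auto
        show "\<bar>\<beta> (1 / t n * s) - \<beta> (1 / t n * s')\<bar> \<le> 2 / t n * \<bar>s - s'\<bar>" for s s'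
          using \<beta>(2)[of "1 / t n * s" "1 / t n * s'"] t(1)[of n] by (simp add: abs_div flip: diff_divide_distrib)
      qed (use t[of n] in simp)
      then have "curve_lip (l n) {y. 0 < v n p y} (\<psi> n)"
        unfolding l_def by (rule curve_lip_cong) (use \<psi>_eq in auto)
      then show ?thesis using open_P p by blast
    next
      case False
      then obtain O' where O': "open O'" "x \<in> O'" "\<forall>y\<in>O'. \<psi> n y = 0" using far by blast
      then have "curve_lip (l n) O' (\<psi> n)" by (intro curve_lip_cong[OF curve_lip_const[OF l0, of O' 0]]) auto
      then show ?thesis using O' by blast
    qed
  qed
  have "open (W n)" for n
  proof -
    have "W n = (\<Union>p. {x. 0 < v n p x})" unfolding W_def by auto
    then show ?thesis using open_P by auto
  qed
  moreover have "0 \<le> l n" for n unfolding l_def using c t[of n] by simp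
  moreover have "0 \<le> \<psi> n x \<and> \<psi> n x \<le> 1" for n x unfolding \<psi>_def using \<beta>(3) by simp
  ultimately have "partition l \<psi> W" unfolding partition_def using smooth lip far cover by simp
  moreover have "\<exists>O'. open O' \<and> x \<in> O' \<and> O' \<subseteq> B (\<sigma> n x) \<and> (\<forall>y\<in>O'. \<sigma> n y = \<sigma> n x)" if x: "x \<in> W n" for n x
  proof -
    obtain p where p: "0 < v n p x" using x unfolding W_def by blast
    show ?thesis
      by (rule exI[of _ "{y. 0 < v n p y}"]) (use open_P p vB \<sigma> in auto)
  qed
  ultimately show ?thesis by blast
qed

end

context submanifold_extension
begin

section \<open>The approximation step\<close>

text \<open>Gluing costs \<open>L / 4\<close> in each constant: 28 becomes at most 29 for the
  approximant, since \<open>1 \<le> C0 * K\<^sup>2\<close>, and \<open>L / 4\<close> becomes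
  \<open>L / 2\<close> for the remainder.\<close>

lemma approximation_step:
  assumes F: "curve_lip L UNIV F" "smooth_along F" and L: "0 < L" and E: "0 < E"
  shows "\<exists>g G. smooth_on UNIV g \<and> curve_lip (29 * C0 * K\<^sup>2 * L) UNIV g \<and> (\<forall>x. \<bar>g x - F x\<bar> \<le> E) \<and>
    curve_lip (L / 2) UNIV G \<and> (\<forall>x. \<bar>G x\<bar> \<le> E) \<and> (\<forall>x\<in>N. G x = F x - g x)"
proof -
  let ?L = "28 * C0 * K\<^sup>2 * L"
  have CK: "1 \<le> C0 * K\<^sup>2" using C0 K by (metis mult_mono' mult_1 one_le_power zero_le_one)
  have L0: "0 \<le> ?L" using C0 L by simp
  have "\<forall>p. \<exists>U \<phi> r. (U, \<phi>) \<in> \<A> \<and> p \<in> U \<and> good_radius U \<phi> p r \<and> locally_approximable ?L (L / 4) F (cdom U \<phi> p r)"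
    using locally_approximable[OF F L, of "L / 4"] L by simp
  then obtain U \<phi> r where U: "\<And>p. (U p, \<phi> p) \<in> \<A>" "\<And>p. p \<in> U p" and r: "\<And>p. good_radius (U p) (\<phi> p) p (r p)"
    and loc: "\<And>p. locally_approximable ?L (L / 4) F (cdom (U p) (\<phi> p) p (r p))" by metis
  define B where "B p = cdom (U p) (\<phi> p) p (r p)" for p
  have "\<exists>u. curve_lip 1 UNIV u \<and> (\<forall>x. 0 \<le> u x \<and> u x \<le> 1) \<and> 0 < u p \<and> (\<forall>x. 0 < u x \<longrightarrow> x \<in> B p)" for p
    unfolding B_def using curve_lip_bump[OF U r] .
  then obtain u where u: "\<And>p. curve_lip 1 UNIV (u p)" "\<And>p x. 0 \<le> u p x \<and> u p x \<le> 1" "\<And>p. 0 < u p p"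
    "\<And>p x. 0 < u p x \<Longrightarrow> x \<in> B p" by metis
  have approx: "\<exists>h. smooth_on (B p) h \<and> curve_lip (4 * C0 * K\<^sup>2 * 1) (B p) h \<and> (\<forall>x\<in>B p. \<bar>h x - v x\<bar> \<le> \<epsilon>)"
    if "curve_lip 1 UNIV v" "0 < \<epsilon>" for p v \<epsilon>
    unfolding B_def
    by (rule local_approximation[OF U r curve_lip_mono[OF that(1) subset_UNIV order_refl] _ that(2)]) simp
  have "0 \<le> 4 * C0 * K\<^sup>2 * 1" using C0 by simp
  from partition_ex[where u = u and B = B, OF this u approx]
  obtain l \<psi> W \<sigma> where part: "partition l \<psi> W" and
    \<sigma>: "\<And>n x. x \<in> W n \<Longrightarrow> \<exists>O'. open O' \<and> x \<in> O' \<and> O' \<subseteq> B (\<sigma> n x) \<and> (\<forall>y\<in>O'. \<sigma> n y = \<sigma> n x)"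
    by blast
  define s where "s n = (\<Sum>k\<le>n. l k)" for n
  have s: "0 \<le> s n" for n unfolding s_def using part unfolding partition_def by (intro sum_nonneg) auto
  \<comment> \<open>Divided by the constant of the \<open>n\<close>-th weight and summed with the
    factors \<open>(1/2) ^ Suc n\<close>, the gluing losses total at most
    \<open>L / 4\<close>.\<close>
  define e where "e n = min E (L / 4 * (1/2) ^ Suc n / (s n + 1))" for n
  have e: "0 < e n" "e n \<le> E" for n
  proof -
    have "0 < s n + 1" using s[of n] by simp
    then show "0 < e n" "e n \<le> E" unfolding e_def using E L by auto
  qed
  have se: "(\<Sum>n\<le>m. (\<Sum>k\<le>n. l k) * e n) \<le> L / 4" for m
  proof -
    have "s n * e n \<le> L / 4 * (1/2) ^ Suc n" for n
    proof -
      have "s n * e n \<le> (s n + 1) * (L / 4 * (1/2) ^ Suc n / (s n + 1))"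
        using s[of n] e(1)[of n] unfolding e_def by (intro mult_mono) auto
      also have "\<dots> = L / 4 * (1/2) ^ Suc n"
      proof -
        have cancel: "a * (b / a) = b" if "a \<noteq> 0" for a b :: real using that by simp
        show ?thesis using s[of n] by (intro cancel) simp
      qed
      finally show ?thesis .
    qed
    then have "(\<Sum>n\<le>m. s n * e n) \<le> (\<Sum>n\<le>m. L / 4 * (1/2) ^ Suc n)" by (rule sum_mono)
    also have "\<dots> = L / 8 * (\<Sum>n\<le>m. (1/2) ^ n)" by (simp add: sum_distrib_left)
    also have "(\<Sum>n\<le>m. (1/2::real) ^ n) \<le> 2" by (simp add: sum_gp0)
    finally show ?thesis using L unfolding s_def by simp
  qed
  have "\<exists>h G. smooth_on (B p) h \<and> curve_lip ?L (B p) h \<and> (\<forall>x\<in>B p. \<bar>h x - F x\<bar> \<le> e n) \<and>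
      curve_lip (L / 4) (B p) G \<and> (\<forall>x\<in>B p. \<bar>G x\<bar> \<le> e n) \<and> (\<forall>x\<in>B p \<inter> N. G x = F x - h x)" for n p
    using loc[of p] e(1)[of n] unfolding locally_approximable_def B_def by blast
  \<comment> \<open>Approximant and remainder are chosen as one pair, because on \<open>N\<close>
    they must add up to \<open>F\<close>.\<close>
  then have "\<forall>z. \<exists>w. smooth_on (B (snd z)) (fst w) \<and> curve_lip ?L (B (snd z)) (fst w) \<and>
      (\<forall>x\<in>B (snd z). \<bar>fst w x - F x\<bar> \<le> e (fst z)) \<and> curve_lip (L / 4) (B (snd z)) (snd w) \<and>
      (\<forall>x\<in>B (snd z). \<bar>snd w x\<bar> \<le> e (fst z)) \<and> (\<forall>x\<in>B (snd z) \<inter> N. snd w x = F x - fst w x)" by simp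
  from choice[OF this] obtain w where w: "\<And>z. smooth_on (B (snd z)) (fst (w z)) \<and> curve_lip ?L (B (snd z)) (fst (w z)) \<and>
      (\<forall>x\<in>B (snd z). \<bar>fst (w z) x - F x\<bar> \<le> e (fst z)) \<and> curve_lip (L / 4) (B (snd z)) (snd (w z)) \<and>
      (\<forall>x\<in>B (snd z). \<bar>snd (w z) x\<bar> \<le> e (fst z)) \<and> (\<forall>x\<in>B (snd z) \<inter> N. snd (w z) x = F x - fst (w z) x)" by blast
  define h where "h n p = fst (w (n, p))" for n p
  define G where "G n p = snd (w (n, p))" for n p
  have h: "smooth_on (B p) (h n p)" "curve_lip ?L (B p) (h n p)" "x \<in> B p \<Longrightarrow> \<bar>h n p x - F x\<bar> \<le> e n"
    and G: "curve_lip (L / 4) (B p) (G n p)" "x \<in> B p \<Longrightarrow> \<bar>G n p x\<bar> \<le> e n"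
      "x \<in> B p \<Longrightarrow> x \<in> N \<Longrightarrow> G n p x = F x - h n p x" for n p x
    using w[of "(n, p)"] unfolding h_def G_def by auto
  define H where "H n x = h n (\<sigma> n x) x" for n x
  define G' where "G' n x = G n (\<sigma> n x) x" for n x
  have WB: "x \<in> B (\<sigma> n x)" if "x \<in> W n" for n x using \<sigma>[OF that] by blast
  have H_smooth: "smooth_on (W n) (H n)" and H_lip: "curve_lip ?L (W n) (H n)" and G_lip: "curve_lip (L / 4) (W n) (G' n)" for n
    unfolding H_def G'_def
    using smooth_on_select[where h = "h n", OF \<sigma> h(1)] curve_lip_select[where h = "h n", OF \<sigma> h(2)]
      curve_lip_select[where h = "G n", OF \<sigma> G(1)] by blast+
  have HF: "\<bar>H n x - F x\<bar> \<le> e n" "\<bar>G' n x - 0\<bar> \<le> e n" if "x \<in> W n" for n x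
    using h(3)[OF WB[OF that]] G(2)[OF WB[OF that]] unfolding H_def G'_def by auto
  have e0: "0 \<le> e n" for n using e(1)[of n] by simp
  have "smooth_on UNIV (glue \<psi> H)" using smooth_on_glue[OF part H_smooth] .
  moreover have "curve_lip (29 * C0 * K\<^sup>2 * L) UNIV (glue \<psi> H)"
  proof -
    have "curve_lip (?L + L / 4) UNIV (glue \<psi> H)"
      by (rule curve_lip_glue[OF part L0 H_lip HF(1) e0 se])
    moreover have "?L + L / 4 \<le> 29 * C0 * K\<^sup>2 * L" using mult_right_mono[OF CK, of L] L by simp
    ultimately show ?thesis by (rule curve_lip_mono[OF _ order_refl])
  qed
  moreover have "\<bar>glue \<psi> H x - F x\<bar> \<le> E" for x
    using glue_bound[OF part order_trans[OF HF(1) e(2)]] .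
  \<comment> \<open>Here the reference function of \<open>curve_lip_glue\<close> is 0: the local
    remainders are themselves bounded by \<open>e n\<close>.\<close>
  moreover have "curve_lip (L / 2) UNIV (glue \<psi> G')"
  proof -
    have "curve_lip (L / 4 + L / 4) UNIV (glue \<psi> G')"
      by (rule curve_lip_glue[OF part _ G_lip HF(2) e0 se]) (use L in simp)
    then show ?thesis by simp
  qed
  moreover have "\<bar>glue \<psi> G' x - 0\<bar> \<le> E" for x
    using glue_bound[OF part order_trans[OF HF(2) e(2)]] .
  moreover have "glue \<psi> H x + glue \<psi> G' x = F x" if "x \<in> N" for x
    by (rule glue_add[OF part]) (use G(3)[OF WB that] in \<open>simp add: H_def G'_def\<close>)
  then have "glue \<psi> G' x = F x - glue \<psi> H x" if "x \<in> N" for x using that by fastforce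
  ultimately show ?thesis by (intro exI[of _ "glue \<psi> H"] exI[of _ "glue \<psi> G'"]) simp
qed

text \<open>Near \<open>\<phi> p\<close> the points of \<open>Y\<close> are images of points of
  \<open>N\<close>, so the identity on \<open>N\<close> suffices. With \<open>g = 0\<close> this
  transfers the property between functions that agree on \<open>N\<close>.\<close>

lemma smooth_along_diff:
  assumes F: "smooth_along F" and g: "smooth_on UNIV g" and G: "\<And>x. x \<in> N \<Longrightarrow> G x = F x - g x"
  shows "smooth_along G"
  unfolding smooth_along_def
proof (intro allI impI ballI)
  fix U \<phi> A p assume ad: "adapted U \<phi> A" and p: "p \<in> U \<inter> N"
  have U: "(U, \<phi>) \<in> \<A>" "open A" "\<phi> ` (U \<inter> N) = A \<inter> Y" using ad unfolding adapted_def by auto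
  have "\<phi> p \<in> A" using U(3) p by blast
  then obtain \<rho> where \<rho>: "\<rho> > 0" "ball (\<phi> p) \<rho> \<subseteq> A" using U(2) by (metis openE)
  show "strictly_diff Y (G \<circ> inv_into U \<phi>) (\<phi> p)"
  proof (rule strictly_diff_diff[OF _ _ \<rho>(1)])
    show "strictly_diff Y (F \<circ> inv_into U \<phi>) (\<phi> p)" using F ad p unfolding smooth_along_def by blast
    have "C1_on (\<phi> ` U) (g \<circ> inv_into U \<phi>)" using g U(1) unfolding smooth_on_def by fastforce
    then show "strictly_diff Y (g \<circ> inv_into U \<phi>) (\<phi> p)"
      by (rule strictly_diff_of_C1_on[OF _ chartD(2)[OF U(1)]]) (use p in auto)
    fix y assume "y \<in> Y" "norm (y - \<phi> p) < \<rho>"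
    then have "y \<in> A \<inter> Y" using \<rho>(2) by (auto simp: dist_norm norm_minus_commute subset_iff)
    then obtain x where "x \<in> U \<inter> N" "y = \<phi> x" using U(3) by blast
    then show "(G \<circ> inv_into U \<phi>) y = (F \<circ> inv_into U \<phi>) y - (g \<circ> inv_into U \<phi>) y"
      using G inv_chart[OF U(1)] by simp
  qed
qed

end

section \<open>Series of \<open>C\<^sup>1\<close> functions\<close>

lemma norm_derivative_le_Lipschitz:
  fixes f :: "'x::real_normed_vector \<Rightarrow> real"
  assumes D: "(f has_derivative blinfun_apply D) (at x)" and S: "open S" "x \<in> S" and M: "0 \<le> M"
    and lip: "\<And>y z. y \<in> S \<Longrightarrow> z \<in> S \<Longrightarrow> \<bar>f y - f z\<bar> \<le> M * norm (y - z)"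
  shows "norm D \<le> M"
proof (rule field_le_epsilon)
  fix e :: real assume e: "0 < e"
  obtain d1 where d1: "d1 > 0" "ball x d1 \<subseteq> S" using S by (metis openE)
  obtain d2 where d2: "d2 > 0" "\<And>y. norm (y - x) < d2 \<Longrightarrow> norm (f y - f x - D (y - x)) \<le> e * norm (y - x)"
    using D e unfolding has_derivative_at_alt by blast
  define d where "d = min d1 d2"
  have "0 < d" unfolding d_def using d1 d2 by simp
  show "norm D \<le> M + e"
  proof (rule norm_blinfun_bound)
    fix v :: 'x
    define s where "s = d / 2 / (norm v + 1)"
    have s: "s > 0" unfolding s_def using \<open>0 < d\<close> by (simp add: add_nonneg_pos)
    have "s * norm v < d"
    proof -
      have "s * norm v \<le> s * (norm v + 1)" using s by simp
      also have "\<dots> = d / 2"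
      proof -
        have cancel: "a / b * b = a" if "b \<noteq> 0" for a b :: real using that by simp
        have "norm v + 1 \<noteq> 0" by (smt (verit) norm_ge_zero)
        then show ?thesis unfolding s_def by (rule cancel)
      qed
      also have "\<dots> < d" using \<open>0 < d\<close> by simp
      finally show ?thesis .
    qed
    then have n: "norm (x + s *\<^sub>R v - x) < d1" "norm (x + s *\<^sub>R v - x) < d2" using s unfolding d_def by auto
    have "x + s *\<^sub>R v \<in> S" using d1(2) n(1) by (auto simp: dist_norm subset_iff)
    then have "\<bar>f (x + s *\<^sub>R v) - f x\<bar> \<le> M * (s * norm v)" using lip[of "x + s *\<^sub>R v" x] S(2) s by simp
    moreover have "\<bar>f (x + s *\<^sub>R v) - f x - s * D v\<bar> \<le> e * (s * norm v)"
      using d2(2)[OF n(2)] s by (simp add: blinfun.scaleR_right)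
    ultimately have "\<bar>s * D v\<bar> \<le> M * (s * norm v) + e * (s * norm v)" by linarith
    also have "\<dots> = s * ((M + e) * norm v)" by (simp add: algebra_simps)
    finally have "s * \<bar>D v\<bar> \<le> s * ((M + e) * norm v)" using s by (simp add: abs_mult)
    then show "norm (D v) \<le> (M + e) * norm v" using s by simp
  qed (use M e in simp)
qed

text \<open>The Lipschitz constants bound the derivatives, so the Weierstrass test makes the series
  of derivatives converge uniformly; on a convex set it may then be differentiated termwise.\<close>

lemma C1_on_series:
  fixes f :: "nat \<Rightarrow> 'x::real_normed_vector \<Rightarrow> real"
  assumes S: "open S" "convex S" and f: "\<And>n. C1_on S (f n)" and M: "summable M" "\<And>n. 0 \<le> M n"
    and lip: "\<And>n y z. y \<in> S \<Longrightarrow> z \<in> S \<Longrightarrow> \<bar>f n y - f n z\<bar> \<le> M n * norm (y - z)"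
    and sm: "\<And>y. y \<in> S \<Longrightarrow> summable (\<lambda>n. f n y)"
  shows "C1_on S (\<lambda>y. \<Sum>n. f n y)"
proof (cases "S = {}")
  case True
  then show ?thesis unfolding C1_on_def by simp
next
  case False
  then obtain y0 where y0: "y0 \<in> S" by blast
  have "\<forall>n. \<exists>D. continuous_on S D \<and> (\<forall>x\<in>S. (f n has_derivative blinfun_apply (D x)) (at x))"
    using f unfolding C1_on_def by blast
  then obtain D where D: "\<And>n. continuous_on S (D n)" "\<And>n x. x \<in> S \<Longrightarrow> (f n has_derivative blinfun_apply (D n x)) (at x)"
    by metis
  have DM: "norm (D n x) \<le> M n" if "x \<in> S" for n x
    using norm_derivative_le_Lipschitz[OF D(2)[OF that] S(1) that M(2) lip] .
  define D' where "D' x = (\<Sum>n. D n x)" for x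
  have u: "uniform_limit S (\<lambda>n x. \<Sum>i<n. D i x) D' sequentially"
    unfolding D'_def[abs_def] using DM M(1) by (intro Weierstrass_m_test) auto
  have cont: "continuous_on S D'"
    by (rule uniform_limit_theorem[OF _ u]) (auto intro!: always_eventually continuous_on_sum D(1))
  have "\<exists>g. \<forall>x\<in>S. (\<lambda>n. f n x) sums g x \<and> (g has_derivative blinfun_apply (D' x)) (at x within S)"
  proof (rule has_derivative_series[OF S(2)])
    show "(f n has_derivative blinfun_apply (D n x)) (at x within S)" if "x \<in> S" for n x
      using D(2)[OF that] by (rule has_derivative_at_withinI)
    fix e :: real assume e: "e > 0"
    have "\<forall>\<^sub>F n in sequentially. \<forall>x\<in>S. dist (\<Sum>i<n. D i x) (D' x) < e"
      using u e unfolding uniform_limit_iff by blast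
    then show "\<forall>\<^sub>F n in sequentially. \<forall>x\<in>S. \<forall>h. norm ((\<Sum>i<n. blinfun_apply (D i x) h) - blinfun_apply (D' x) h) \<le> e * norm h"
    proof (rule eventually_mono, intro ballI allI)
      fix n x h assume "\<forall>x\<in>S. dist (\<Sum>i<n. D i x) (D' x) < e" "x \<in> S"
      then have "norm ((\<Sum>i<n. D i x) - D' x) \<le> e" by (auto simp: dist_norm intro: less_imp_le)
      then show "norm ((\<Sum>i<n. blinfun_apply (D i x) h) - blinfun_apply (D' x) h) \<le> e * norm h"
        using norm_blinfun[of "(\<Sum>i<n. D i x) - D' x" h] mult_right_mono[of "norm ((\<Sum>i<n. D i x) - D' x)" e "norm h"]
        by (simp add: blinfun.diff_left blinfun.sum_left)
    qed
  next
    show "(\<lambda>n. f n y0) sums (\<Sum>n. f n y0)" using sm[OF y0] by (rule summable_sums)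
  qed (rule y0)
  then obtain g where g: "\<And>x. x \<in> S \<Longrightarrow> (\<lambda>n. f n x) sums g x"
    "\<And>x. x \<in> S \<Longrightarrow> (g has_derivative blinfun_apply (D' x)) (at x)"
    using at_within_open[OF _ S(1)] by metis
  have "C1_on S g" unfolding C1_on_def using cont g(2) by blast
  then show ?thesis by (rule C1_on_cong) (use S(1) g(1) sums_unique in auto)
qed

context weak_uniform_manifold
begin

text \<open>In coordinates the chart balls are convex, and constants along curves become constants
  for the norm up to the factor \<open>2 * K * b\<close>, which is the same for all terms.\<close>

lemma smooth_on_series:
  assumes g: "\<And>n. smooth_on UNIV (g n)" "\<And>n. curve_lip (M n) UNIV (g n)" and M: "summable M" "\<And>n. 0 \<le> M n"
    and sm: "\<And>x. summable (\<lambda>n. g n x)"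
  shows "smooth_on UNIV (\<lambda>x. \<Sum>n. g n x)"
proof (rule smooth_on_local)
  fix p
  obtain U \<phi> where U: "(U, \<phi>) \<in> \<A>" "p \<in> U" using chart_ex by blast
  obtain r where r: "good_radius U \<phi> p r" "0 < r" using good_radius_ex[OF U] by blast
  let ?B = "cdom U \<phi> p r" and ?\<nu> = "cnorm U \<phi> p"
  have \<nu>: "is_norm ?\<nu>" using cnorm_is_norm[OF U] .
  obtain b where b: "b > 0" "\<And>v. ?\<nu> v \<le> b * norm v" using cnorm_equivalent[OF U] unfolding equivalent_norm_def by blast
  have BU: "?B \<subseteq> U" unfolding cdom_def by blast
  have inv: "inv_into U \<phi> (\<phi> x) = x" if "x \<in> ?B" for x using inv_chart[OF U(1)] that BU by blast
  have "C1_on (\<phi> ` ?B) (\<lambda>y. \<Sum>n. g n (inv_into U \<phi> y))"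
  proof (rule C1_on_series)
    show "open (\<phi> ` ?B)" using open_chart_image[OF U(1) open_cdom[OF U] BU] .
    show "convex (\<phi> ` ?B)"
      unfolding cdom_image[OF U(1) r(1)] convex_alt
    proof (intro ballI allI impI, unfold mem_Collect_eq)
      fix y z and t :: real assume yz: "?\<nu> (y - \<phi> p) < r" "?\<nu> (z - \<phi> p) < r" and t: "0 \<le> t \<and> t \<le> 1"
      have "(1 - t) *\<^sub>R y + t *\<^sub>R z - \<phi> p = (1 - t) *\<^sub>R (y - \<phi> p) + t *\<^sub>R (z - \<phi> p)" by (simp add: algebra_simps)
      then have "?\<nu> ((1 - t) *\<^sub>R y + t *\<^sub>R z - \<phi> p) \<le> (1 - t) * ?\<nu> (y - \<phi> p) + t * ?\<nu> (z - \<phi> p)"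
        using is_normD(4)[OF \<nu>, of "(1 - t) *\<^sub>R (y - \<phi> p)" "t *\<^sub>R (z - \<phi> p)"] is_normD(5)[OF \<nu>] t by simp
      also have "\<dots> < r" using convex_bound_lt[OF yz, of "1 - t" t] t by simp
      finally show "?\<nu> ((1 - t) *\<^sub>R y + t *\<^sub>R z - \<phi> p) < r" .
    qed
    show "C1_on (\<phi> ` ?B) (\<lambda>y. g n (inv_into U \<phi> y))" for n
    proof -
      have "C1_on (\<phi> ` (U \<inter> UNIV)) (g n \<circ> inv_into U \<phi>)" using g(1) U(1) unfolding smooth_on_def by blast
      then show ?thesis using BU by (auto simp: o_def elim!: C1_on_subset)
    qed
    show "summable (\<lambda>n. 2 * K * b * M n)" using M(1) by (rule summable_mult)
    show "0 \<le> 2 * K * b * M n" for n using K b(1) M(2) by simp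
    show "summable (\<lambda>n. g n (inv_into U \<phi> y))" for y using sm .
    fix n y z assume "y \<in> \<phi> ` ?B" "z \<in> \<phi> ` ?B"
    then obtain x x' where x: "x \<in> ?B" "y = \<phi> x" "x' \<in> ?B" "z = \<phi> x'" by blast
    have "\<bar>g n x - g n x'\<bar> \<le> 2 * K * M n * ?\<nu> (\<phi> x - \<phi> x')"
      by (rule chart_lip_of_curve_lip[OF U r(1) M(2) curve_lip_mono[OF g(2) subset_UNIV order_refl] x(1,3)])
    also have "\<dots> \<le> 2 * K * M n * (b * norm (\<phi> x - \<phi> x'))" using b(2) K M(2) by (intro mult_left_mono) auto
    finally show "\<bar>g n (inv_into U \<phi> y) - g n (inv_into U \<phi> z)\<bar> \<le> 2 * K * b * M n * norm (y - z)"
      unfolding x using inv x by (simp add: mult_ac)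
  qed
  then have "smooth_on ?B (\<lambda>x. \<Sum>n. g n x)"
    by (intro smooth_on_chart[OF U(1) BU _ open_cdom[OF U]]) (simp add: o_def)
  then show "\<exists>W. open W \<and> p \<in> W \<and> smooth_on W (\<lambda>x. \<Sum>n. g n x)"
    using open_cdom[OF U] center_in_cdom[OF U r(2)] by blast
qed

lemma curve_lip_series:
  assumes g: "\<And>n. curve_lip (M n) UNIV (g n)" and M: "summable M" and sm: "\<And>x. summable (\<lambda>n. g n x)"
  shows "curve_lip (suminf M) UNIV (\<lambda>x. \<Sum>n. g n x)"
  unfolding curve_lip_def
proof (intro allI impI)
  fix a b c assume c: "a < b" "C1_curve \<A> a b c"
  have le: "\<bar>g n (c b) - g n (c a)\<bar> \<le> M n * len a b c" for n using curve_lipD[OF g c] by simp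
  have s: "summable (\<lambda>n. M n * len a b c)" using M by (rule summable_mult2)
  have s': "summable (\<lambda>n. \<bar>g n (c b) - g n (c a)\<bar>)"
    by (rule summable_comparison_test'[OF s, of 0]) (use le in simp)
  have "\<bar>(\<Sum>n. g n (c b)) - (\<Sum>n. g n (c a))\<bar> = \<bar>\<Sum>n. g n (c b) - g n (c a)\<bar>"
    by (simp add: suminf_diff sm)
  also have "\<dots> \<le> (\<Sum>n. \<bar>g n (c b) - g n (c a)\<bar>)" using s' by (rule summable_rabs)
  also have "\<dots> \<le> (\<Sum>n. M n * len a b c)" using le s' s by (rule suminf_le)
  also have "\<dots> = suminf M * len a b c" using M by (simp add: suminf_mult2)
  finally show "\<bar>(\<Sum>n. g n (c b)) - (\<Sum>n. g n (c a))\<bar> \<le> suminf M * len a b c" .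
qed

text \<open>Such a function is constant on chart balls. This settles the case where the Lipschitz
  constant of \<open>f\<close> is 0, to which \<open>approximation_step\<close> does not
  apply.\<close>

lemma smooth_on_curve_lip_0:
  assumes "curve_lip 0 UNIV F"
  shows "smooth_on UNIV F"
proof (rule smooth_on_local)
  fix p
  obtain U \<phi> where U: "(U, \<phi>) \<in> \<A>" "p \<in> U" using chart_ex by blast
  obtain r where r: "good_radius U \<phi> p r" "0 < r" using good_radius_ex[OF U] by blast
  have "F p = F x" if "x \<in> cdom U \<phi> p r" for x
    using chart_lip_of_curve_lip[OF U r(1) order_refl curve_lip_mono[OF assms subset_UNIV order_refl] center_in_cdom[OF U r(2)] that]
    by simp
  then have "smooth_on (cdom U \<phi> p r) F"
    using open_cdom[OF U] by (intro smooth_on_cong[OF smooth_on_const]) auto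
  then show "\<exists>W. open W \<and> p \<in> W \<and> smooth_on W F"
    using open_cdom[OF U] center_in_cdom[OF U r(2)] by blast
qed

end

context submanifold_extension
begin

text \<open>Two geometric rates are at work: the halved Lipschitz constants make the series C1 and
  Lipschitz, the tolerances make its values converge.\<close>

lemma smooth_extension:
  assumes F: "curve_lip L UNIV F" "smooth_along F" and L: "0 < L"
  shows "\<exists>g. smooth_on UNIV g \<and> curve_lip (58 * C0 * K\<^sup>2 * L) UNIV g \<and> (\<forall>x\<in>N. g x = F x)"
proof -
  \<comment> \<open>Stage 0 is special because \<open>F\<close> may be unbounded; every later
    remainder is bounded by the tolerance of the step that produced it.\<close>
  define P where "P n F' \<longleftrightarrow> curve_lip (L * (1/2) ^ n) UNIV F' \<and> smooth_along F' \<and>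
    (if n = 0 then F' = F else \<forall>x. \<bar>F' x\<bar> \<le> (1/2) ^ n)" for n :: nat and F' :: "'m \<Rightarrow> real"
  define C where "C = 29 * C0 * K\<^sup>2 * L"
  define Q where "Q n F' F'' g \<longleftrightarrow> smooth_on UNIV g \<and> curve_lip (C * (1/2) ^ n) UNIV g \<and>
    (\<forall>x. \<bar>g x - F' x\<bar> \<le> (1/2) ^ Suc n) \<and> (\<forall>x\<in>N. F'' x = F' x - g x)" for n :: nat and F' F'' g :: "'m \<Rightarrow> real"
  have "\<exists>f. \<forall>n. P n (f n) \<and> (\<exists>g. Q n (f n) (f (Suc n)) g)"
  proof (rule dependent_nat_choice)
    show "\<exists>F'. P 0 F'" unfolding P_def using F by simp
    fix F' n assume F': "P n F'"
    have "0 < L * (1/2) ^ n" using L by simp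
    then obtain g G where g: "smooth_on UNIV g" "curve_lip (29 * C0 * K\<^sup>2 * (L * (1/2) ^ n)) UNIV g"
        "\<And>x. \<bar>g x - F' x\<bar> \<le> (1/2) ^ Suc n"
      and G: "curve_lip (L * (1/2) ^ n / 2) UNIV G" "\<And>x. \<bar>G x\<bar> \<le> (1/2) ^ Suc n" "\<And>x. x \<in> N \<Longrightarrow> G x = F' x - g x"
      using approximation_step[of "L * (1/2) ^ n" F' "(1/2) ^ Suc n"] F' unfolding P_def by auto
    have "smooth_along G" using smooth_along_diff[OF _ g(1) G(3)] F' unfolding P_def by blast
    then have "P (Suc n) G" unfolding P_def using G by (simp add: mult_ac)
    moreover have "Q n F' G g" unfolding Q_def C_def using g G(3) by (simp add: mult_ac)
    ultimately show "\<exists>F''. P (Suc n) F'' \<and> (\<exists>g. Q n F' F'' g)" by blast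
  qed
  then obtain f where f: "\<And>n. P n (f n)" "\<forall>n. \<exists>g. Q n (f n) (f (Suc n)) g" by blast
  from choice[OF f(2)] obtain g where g: "\<And>n. Q n (f n) (f (Suc n)) (g n)" by blast
  have f0: "f 0 = F" using f(1)[of 0] unfolding P_def by simp
  have fn: "\<bar>f (Suc n) x\<bar> \<le> (1/2) ^ Suc n" for n x using f(1)[of "Suc n"] unfolding P_def by simp
  have geo: "summable (\<lambda>n. k * (1/2 :: real) ^ n)" for k by (intro summable_mult summable_geometric) simp
  \<comment> \<open>The comparison starts at index 1, since \<open>g 0\<close> is close to the
    possibly unbounded \<open>F\<close>.\<close>
  have sm: "summable (\<lambda>n. g n x)" for x
  proof (rule summable_comparison_test'[OF geo[of 2], of 1])
    fix n :: nat assume "1 \<le> n"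
    then obtain m where m: "n = Suc m" by (metis One_nat_def Suc_le_D)
    have "\<bar>g n x - f n x\<bar> \<le> (1/2) ^ Suc n" using g[of n] unfolding Q_def by blast
    moreover have "\<bar>f n x\<bar> \<le> (1/2) ^ n" using fn[of m x] m by simp
    ultimately have "\<bar>g n x\<bar> \<le> (1/2) ^ n + (1/2) ^ Suc n" by linarith
    also have "\<dots> \<le> 2 * (1/2) ^ n" by simp
    finally show "norm (g n x) \<le> 2 * (1/2) ^ n" by simp
  qed
  have gn: "smooth_on UNIV (g n)" "curve_lip (C * (1/2) ^ n) UNIV (g n)" for n using g[of n] unfolding Q_def by blast+
  have C: "0 \<le> C" unfolding C_def using C0 L by simp
  define G where "G x = (\<Sum>n. g n x)" for x
  have "smooth_on UNIV G"
    unfolding G_def by (rule smooth_on_series[OF gn geo _ sm]) (use C in simp)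
  \<comment> \<open>Ratio 1/2 doubles the constant 29.\<close>
  moreover have "(\<Sum>n. C * (1/2) ^ n) = 58 * C0 * K\<^sup>2 * L"
    using suminf_geometric[of "1/2 :: real"] by (simp add: suminf_mult C_def)
  then have "curve_lip (58 * C0 * K\<^sup>2 * L) UNIV G"
    unfolding G_def using curve_lip_series[OF gn(2) geo sm] by simp
  moreover have "G x = F x" if x: "x \<in> N" for x
  proof -
    \<comment> \<open>On \<open>N\<close> each step passes from \<open>f m\<close> to
      \<open>f m - g m\<close>, so the partial sums telescope.\<close>
    have "(\<Sum>n<m. g n x) = F x - f m x" for m
    proof (induction m)
      case (Suc m)
      then show ?case using g[of m] x unfolding Q_def by simp
    qed (simp add: f0)
    moreover have "(\<lambda>m. f m x) \<longlonglongrightarrow> 0"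
    proof (rule LIMSEQ_offset[where k = 1], rule Lim_null_comparison)
      show "\<forall>\<^sub>F n in sequentially. norm (f (n + 1) x) \<le> (1/2) ^ Suc n" using fn by simp
      show "(\<lambda>n. (1/2 :: real) ^ Suc n) \<longlonglongrightarrow> 0" by (intro LIMSEQ_Suc LIMSEQ_power_zero) simp
    qed
    then have "(\<lambda>m. F x - f m x) \<longlonglongrightarrow> F x - 0" by (intro tendsto_intros)
    ultimately have "(\<lambda>m. \<Sum>n<m. g n x) \<longlonglongrightarrow> F x" by simp
    then show ?thesis unfolding G_def using summable_LIMSEQ[OF sm[of x]] LIMSEQ_unique by blast
  qed
  ultimately show ?thesis by blast
qed

end

theorem proposition6p3:
  fixes K C0 R S :: real
    and \<A> :: "('m::t2_space, 'x::banach) chart set"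
    and nrm :: "('m, 'x) tangent_vec \<Rightarrow> real"
    and Y :: "'x set" and N :: "'m set" and f :: "'m \<Rightarrow> real"
  assumes "1 \<le> K"
    and "paracompact_space (euclidean :: 'm topology)"
    and "C1_structure \<A>"
    and "weak_uniform_finsler K \<A> nrm"
    and "\<And>\<nu> :: 'x \<Rightarrow> real. equivalent_norm \<nu> \<Longrightarrow> property_star1 \<nu> C0"
    and "C1_submanifold \<A> Y N" and "closed N"
    and "C1_function_on_submanifold \<A> Y N f"
    and "lipschitz_wrt (finsler_dist \<A> nrm) N f"
    and "R = 29 / 2 * C0 * (9 / 4 + 66 * C0)"
    and "S = 1 / 2 + 2 * R * K\<^sup>2"
  shows "\<exists>g :: 'm \<Rightarrow> real. C1_function \<A> g \<and> lipschitz_wrt (finsler_dist \<A> nrm) UNIV g \<and>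
           (\<forall>p\<in>N. g p = f p) \<and>
           lip_const (finsler_dist \<A> nrm) UNIV g \<le> ennreal S * lip_const (finsler_dist \<A> nrm) N f"
proof -
  interpret submanifold_extension K \<A> nrm C0 Y N
    using assms by unfold_locales auto
  obtain L' where L': "0 \<le> L'" "\<And>p q. p \<in> N \<Longrightarrow> q \<in> N \<Longrightarrow> ennreal \<bar>f p - f q\<bar> \<le> ennreal L' * dM p q"
    using assms(9) unfolding lipschitz_wrt_def by blast
  \<comment> \<open>\<open>L'\<close> only shows that the least constant \<open>L\<close> is finite;
    \<open>F\<close> must be built with \<open>L\<close> itself to obtain a bound by
    \<open>lip_const\<close>.\<close>
  have "lip_const dM N f \<le> ennreal L'" using L' by (subst lip_const_le_iff) auto
  then have "lip_const dM N f \<noteq> top" by (auto simp: top_unique)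
  then obtain L where L: "lip_const dM N f = ennreal L" "0 \<le> L" by (cases "lip_const dM N f") auto
  have "\<forall>p\<in>N. \<forall>q\<in>N. dM p q \<noteq> top \<longrightarrow> ennreal \<bar>f p - f q\<bar> \<le> ennreal L * dM p q"
    using lip_const_le_iff[of "ennreal L" dM N f] L(1) by simp
  then obtain F where F: "\<And>p. p \<in> N \<Longrightarrow> F p = f p" "curve_lip L UNIV F"
    using curve_lip_extension[OF L(2), of N f] by blast
  have "smooth_along f"
    unfolding smooth_along_def
  proof (intro allI impI ballI)
    fix U \<phi> A p assume *: "adapted U \<phi> A" "p \<in> U \<inter> N"
    then have "C1_on_subspace Y (A \<inter> Y) (f \<circ> inv_into U \<phi>)" "open A" "\<phi> p \<in> A \<inter> Y"
      using assms(8) unfolding C1_function_on_submanifold_def adapted_def by blast+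
    then show "strictly_diff Y (f \<circ> inv_into U \<phi>) (\<phi> p)"
      using strictly_diff_of_C1_on_subspace assms(6) unfolding C1_submanifold_def by blast
  qed
  then have F': "smooth_along F"
    by (rule smooth_along_diff[OF _ smooth_on_const[of UNIV 0]]) (simp add: F(1))
  have K2: "1 \<le> K\<^sup>2" using K by simp
  \<comment> \<open>Expanding \<open>S\<close> leaves \<open>261 / 4 * (C0 * K\<^sup>2)\<close> plus
    nonnegative terms, and 261/4 exceeds 58.\<close>
  have "1 * (C0 * K\<^sup>2) \<le> C0 * (C0 * K\<^sup>2)" using C0 by (intro mult_right_mono) auto
  moreover have "S = 1 / 2 + 261 / 4 * (C0 * K\<^sup>2) + 1914 * (C0 * (C0 * K\<^sup>2))"
    unfolding assms(10,11) by (simp add: field_simps)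
  moreover have "0 \<le> C0 * K\<^sup>2" using C0 by simp
  ultimately have S: "58 * C0 * K\<^sup>2 \<le> S" "0 \<le> S" by linarith+
  have "\<exists>g. smooth_on UNIV g \<and> curve_lip (S * L) UNIV g \<and> (\<forall>x\<in>N. g x = F x)"
  proof (cases "L = 0")
    case True
    then show ?thesis using F(2) smooth_on_curve_lip_0[of F] by auto
  next
    case False
    then obtain g where g: "smooth_on UNIV g" "curve_lip (58 * C0 * K\<^sup>2 * L) UNIV g" "\<forall>x\<in>N. g x = F x"
      using smooth_extension[OF F(2) F'] L(2) by auto
    have "58 * C0 * K\<^sup>2 * L \<le> S * L" using S L by (intro mult_right_mono)
    then have "curve_lip (S * L) UNIV g" using g(2) by (auto elim: curve_lip_mono)
    then show ?thesis using g by blast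
  qed
  then obtain g where g: "smooth_on UNIV g" "curve_lip (S * L) UNIV g" "\<forall>x\<in>N. g x = F x" by blast
  have SL: "0 \<le> S * L" using S L by simp
  have lip: "ennreal \<bar>g p - g q\<bar> \<le> ennreal (S * L) * dM p q" if "dM p q \<noteq> top" for p q
    using curve_lip_imp_lipschitz[OF g(2) SL that] .
  have "lip_const dM UNIV g \<le> ennreal (S * L)"
    by (subst lip_const_le_iff) (use lip in auto)
  also have "\<dots> = ennreal S * lip_const dM N f" unfolding L(1) using S L by (simp add: ennreal_mult)
  finally have "lip_const dM UNIV g \<le> ennreal S * lip_const dM N f" .
  moreover have "lipschitz_wrt dM UNIV g"
    unfolding lipschitz_wrt_def
  \<comment> \<open>The added 1 covers pairs at infinite distance: if \<open>S * L\<close> were 0,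
    the bound \<open>0 * top\<close> would be 0.\<close>
  proof (intro exI[of _ "S * L + 1"] conjI ballI)
    fix p q
    show "ennreal \<bar>g p - g q\<bar> \<le> ennreal (S * L + 1) * dM p q"
    proof (cases "dM p q = top")
      case True
      then show ?thesis using SL by (simp add: ennreal_mult_top)
    next
      case False
      have "ennreal (S * L) * dM p q \<le> ennreal (S * L + 1) * dM p q" using SL by (intro mult_right_mono ennreal_leI) auto
      then show ?thesis using lip[OF False] by (rule order_trans[rotated])
    qed
  qed (use SL in simp)
  moreover have "\<forall>p\<in>N. g p = f p" using g(3) F(1) by simp
  ultimately show ?thesis using g(1) unfolding smooth_on_UNIV by blast
qed

end
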